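(* Let $\Omega\subset\mathbb{R}^n$ be open and let $s\in\mathbb{R}$. Then: (i) The restriction operator $|_\Omega: H^s_{\overline\Omega}\to H^s(\Omega)$ is injective if and only if $\partial\Omega$ is $s$-null. (ii) If $s\ge 0$, then $|_\Omega:\mathring{H}^s(\Omega)\to H^s(\Omega)$ is injective; if $s\in\mathbb{N}_0$, then it is a unitary isomorphism onto its image in $H^s(\Omega)$. (iii) If $s\ge 0$, then $|_\Omega:\widetilde H^s(\Omega)\to H^s_0(\Omega)$ is injective and has dense image; if $s\in\mathbb{N}_0$, then it is a unitary isomorphism onto $H^s_0(\Omega)$.
   Context: Here $n\in\mathbb{N}$ and $\mathbb{N}_0=\{0,1,2,\dots\}$. $\mathscr{D}(\mathbb{R}^n)$ is the space of compactly supported smooth functions on $\mathbb{R}^n$; for open $\Omega\subset\mathbb{R}^n$, $\mathscr{D}(\Omega)=\{u\in\mathscr{D}(\mathbb{R}^n):\operatorname{supp}u\subset\Omega\}$. $\mathscr{D}^*(\Omega)$ is the space of distributions on $\Omega$ (anti-linear continuous functionals on $\mathscr{D}(\Omega)$), and $\mathscr{S}^*(\mathbb{R}^n)$ is the space of tempered distributions (anti-linear continuous functionals on the Schwartz space). The Fourier transform is $\hat u(\xi)=(2\pi)^{-n/2}\int_{\mathbb{R}^n}e^{-i\xi\cdot x}u(x)\,dx$, extended to $\mathscr{S}^*(\mathbb{R}^n)$. For $s\in\mathbb{R}$, $H^s(\mathbb{R}^n)$ is the Hilbert space of $u\in\mathscr{S}^*(\mathbb{R}^n)$ with $\|u\|_{H^s(\mathbb{R}^n)}^2=\int_{\mathbb{R}^n}(1+|\xi|^2)^s|\hat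 u(\xi)|^2\,d\xi<\infty$, with inner product $(u,v)_{H^s(\mathbb{R}^n)}=\int_{\mathbb{R}^n}(1+|\xi|^2)^s\hat u(\xi)\overline{\hat v(\xi)}\,d\xi$. For closed $F\subset\mathbb{R}^n$, $H^s_F=\{u\in H^s(\mathbb{R}^n):\operatorname{supp}u\subset F\}$; in particular $H^s_{\overline\Omega}$ is the case $F=\overline\Omega$. A set $E\subset\mathbb{R}^n$ is $s$-null if $H^s_F=\{0\}$ for every closed set $F\subset E$. Further, $\widetilde H^s(\Omega)$ is the closure of $\mathscr{D}(\Omega)$ in $H^s(\mathbb{R}^n)$, and for $s\ge0$, $\mathring{H}^s(\Omega)=\{u\in H^s(\mathbb{R}^n):u=0\text{ a.e. in }\Omega^c\}$, where $\Omega^c=\mathbb{R}^n\setminus\Omega$. These are closed subspaces of $H^s(\mathbb{R}^n)$ and carry its inner product. $H^s(\Omega)=\{u\in\mathscr{D}^*(\Omega):u=U|_\Omega\text{ for some }U\in H^s(\mathbb{R}^n)\}$, where $U|_\Omega$ is the restriction of the distribution $U$ to $\Omega$, with norm $\|u\|_{H^s(\Omega)}=\min\{\|U\|_{H^s(\mathbb{R}^n)}:U\in H^s(\mathbb{R}^n),\ U|_\Omega=u\}$; it is a Hilbert space with inner product $(u,v)_{H^s(\Omega)}=(Q_sU,Q_sV)_{H^s(\mathbb{R}^n)}$, where $U|_\Omega=u$, $V|_\Omega=v$ and $Q_s$ is the orthogonal projection of $H^s(\mathbb{R}^n)$ onto $(H^s_{\Omega^c})^\perp$. $H^s_0(\Omega)$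 is the closure of $\{\phi|_\Omega:\phi\in\mathscr{D}(\Omega)\}$ in $H^s(\Omega)$. A unitary isomorphism is a surjective linear isometry between Hilbert spaces. *)

theory Defs
  imports "HOL-Analysis.Analysis"
begin

section \<open>Smooth functions, test functions, Schwartz functions\<close>

definition partial :: "'n::finite \<Rightarrow> (real^'n \<Rightarrow> complex) \<Rightarrow> (real^'n \<Rightarrow> complex)" where
  "partial i f = (\<lambda>x. frechet_derivative f (at x) (axis i 1))"

primrec partials :: "'n::finite list \<Rightarrow> (real^'n \<Rightarrow> complex) \<Rightarrow> (real^'n \<Rightarrow> complex)" where
  "partials [] f = f"
| "partials (i # is) f = partial i (partials is f)"

definition smooth :: "(real^'n::finite \<Rightarrow> complex) \<Rightarrow> bool" where
  "smooth f \<longleftrightarrow> (\<forall>is x. partials is f differentiable at x)"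

definition fun_supp :: "(real^'n::finite \<Rightarrow> complex) \<Rightarrow> (real^'n) set" where
  "fun_supp f = closure {x. f x \<noteq> 0}"

definition test_funs :: "(real^'n::finite) set \<Rightarrow> (real^'n \<Rightarrow> complex) set" where
  "test_funs \<Omega> = {\<phi>. smooth \<phi> \<and> compact (fun_supp \<phi>) \<and> fun_supp \<phi> \<subseteq> \<Omega>}"

definition schwartz :: "(real^'n::finite \<Rightarrow> complex) set" where
  "schwartz = {\<phi>. smooth \<phi> \<and>
     (\<forall>k is. bounded (range (\<lambda>x. (1 + norm x) ^ k *\<^sub>R partials is \<phi> x)))}"

definition test_conv ::
  "(real^'n::finite) set \<Rightarrow> (nat \<Rightarrow> real^'n \<Rightarrow> complex) \<Rightarrow> (real^'n \<Rightarrow> complex) \<Rightarrow> bool" where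
  "test_conv \<Omega> \<phi>s \<phi> \<longleftrightarrow>
     (\<forall>j. \<phi>s j \<in> test_funs \<Omega>) \<and> \<phi> \<in> test_funs \<Omega> \<and>
     (\<exists>K. compact K \<and> K \<subseteq> \<Omega> \<and> (\<forall>j. fun_supp (\<phi>s j) \<subseteq> K)) \<and>
     (\<forall>is. uniform_limit UNIV (\<lambda>j. partials is (\<phi>s j)) (partials is \<phi>) sequentially)"

definition schwartz_conv ::
  "(nat \<Rightarrow> real^'n::finite \<Rightarrow> complex) \<Rightarrow> (real^'n \<Rightarrow> complex) \<Rightarrow> bool" where
  "schwartz_conv \<phi>s \<phi> \<longleftrightarrow>
     (\<forall>j. \<phi>s j \<in> schwartz) \<and> \<phi> \<in> schwartz \<and>
     (\<forall>k is. uniform_limit UNIV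
        (\<lambda>j x. (1 + norm x) ^ k *\<^sub>R partials is (\<phi>s j) x)
        (\<lambda>x. (1 + norm x) ^ k *\<^sub>R partials is \<phi> x) sequentially)"

section \<open>Distributions\<close>

text \<open>A functional on a space of functions is a total function that takes the value 0
  outside that space, so that equality of functionals is equality in HOL and the vector
  space operations are pointwise. Continuity of antilinear functionals on
  the spaces of test functions and of Schwartz functions is sequential continuity.\<close>

type_synonym 'n functional = "(real^'n \<Rightarrow> complex) \<Rightarrow> complex"

definition antilinear_on :: "(real^'n::finite \<Rightarrow> complex) set \<Rightarrow> 'n functional \<Rightarrow> bool" where
  "antilinear_on X u \<longleftrightarrow> (\<forall>\<phi>\<in>X. \<forall>\<psi>\<in>X. \<forall>a b.
     u (\<lambda>x. a * \<phi> x + b * \<psi> x) = cnj a * u \<phi> + cnj b * u \<psi>)"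

definition distributions :: "(real^'n::finite) set \<Rightarrow> 'n functional set" where
  "distributions \<Omega> = {u. antilinear_on (test_funs \<Omega>) u \<and>
     (\<forall>\<phi>s \<phi>. test_conv \<Omega> \<phi>s \<phi> \<longrightarrow> (\<lambda>j. u (\<phi>s j)) \<longlonglongrightarrow> u \<phi>) \<and>
     (\<forall>\<phi>. \<phi> \<notin> test_funs \<Omega> \<longrightarrow> u \<phi> = 0)}"

definition tempered :: "'n::finite functional set" where
  "tempered = {u. antilinear_on schwartz u \<and>
     (\<forall>\<phi>s \<phi>. schwartz_conv \<phi>s \<phi> \<longrightarrow> (\<lambda>j. u (\<phi>s j)) \<longlonglongrightarrow> u \<phi>) \<and>
     (\<forall>\<phi>. \<phi> \<notin> schwartz \<longrightarrow> u \<phi> = 0)}"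

definition restr :: "(real^'n::finite) set \<Rightarrow> 'n functional \<Rightarrow> 'n functional" where
  "restr \<Omega> u = (\<lambda>\<phi>. if \<phi> \<in> test_funs \<Omega> then u \<phi> else 0)"

text \<open>The support is the complement of the largest open set on which the distribution
  vanishes.\<close>

definition dist_supp :: "'n::finite functional \<Rightarrow> (real^'n) set" where
  "dist_supp u = - \<Union>{U. open U \<and> (\<forall>\<phi>\<in>test_funs U. u \<phi> = 0)}"

text \<open>A function \<open>g\<close> is identified with the functional \<open>\<phi> \<mapsto> \<integral> g \<phi>\<^sup>*\<close>,
  where \<open>\<phi>\<^sup>*\<close> is the complex conjugate.\<close>

definition of_function :: "(real^'n::finite \<Rightarrow> complex) \<Rightarrow> 'n functional" where
  "of_function g = (\<lambda>\<phi>. if \<phi> \<in> schwartz then (LINT x|lborel. g x * cnj (\<phi> x)) else 0)"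

definition represented_by :: "'n::finite functional \<Rightarrow> (real^'n \<Rightarrow> complex) \<Rightarrow> bool" where
  "represented_by u g \<longleftrightarrow> g \<in> borel_measurable lborel \<and>
     (\<forall>\<phi>\<in>schwartz. integrable lborel (\<lambda>x. g x * cnj (\<phi> x))) \<and> u = of_function g"

section \<open>Fourier transform\<close>

definition fourier :: "(real^'n::finite \<Rightarrow> complex) \<Rightarrow> (real^'n \<Rightarrow> complex)" where
  "fourier u = (\<lambda>\<xi>. complex_of_real ((2 * pi) powr (- real CARD('n) / 2)) *
     (LINT x|lborel. exp (- (\<i> * complex_of_real (\<xi> \<bullet> x))) * u x))"

definition fourier_inv :: "(real^'n::finite \<Rightarrow> complex) \<Rightarrow> (real^'n \<Rightarrow> complex)" where
  "fourier_inv u = (\<lambda>x. fourier u (- x))"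

text \<open>As functionals are antilinear and \<open>g\<close> acts by \<open>\<phi> \<mapsto> \<integral> g \<phi>\<^sup>*\<close>, the transform of
  functions extends by duality with the inverse transform.\<close>

definition fourier_dist :: "'n::finite functional \<Rightarrow> 'n functional" where
  "fourier_dist u = (\<lambda>\<phi>. if \<phi> \<in> schwartz then u (fourier_inv \<phi>) else 0)"

section \<open>Sobolev spaces on the whole space\<close>

definition Hs :: "real \<Rightarrow> 'n::finite functional set" where
  "Hs s = {u \<in> tempered. \<exists>g. represented_by (fourier_dist u) g \<and>
     integrable lborel (\<lambda>\<xi>. (1 + (norm \<xi>)\<^sup>2) powr s * (cmod (g \<xi>))\<^sup>2)}"

text \<open>The representing function is unique up to a null set, which does not affect the
  integrals below.\<close>

definition fourier_fun :: "'n::finite functional \<Rightarrow> (real^'n \<Rightarrow> complex)" where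
  "fourier_fun u = (SOME g. represented_by (fourier_dist u) g)"

definition Hs_norm :: "real \<Rightarrow> 'n::finite functional \<Rightarrow> real" where
  "Hs_norm s u =
     sqrt (LINT \<xi>|lborel. (1 + (norm \<xi>)\<^sup>2) powr s * (cmod (fourier_fun u \<xi>))\<^sup>2)"

definition Hs_inner :: "real \<Rightarrow> 'n::finite functional \<Rightarrow> 'n functional \<Rightarrow> complex" where
  "Hs_inner s u v = (LINT \<xi>|lborel. complex_of_real ((1 + (norm \<xi>)\<^sup>2) powr s) *
     fourier_fun u \<xi> * cnj (fourier_fun v \<xi>))"

definition Hs_supp :: "real \<Rightarrow> (real^'n::finite) set \<Rightarrow> 'n functional set" where
  "Hs_supp s F = {u \<in> Hs s. dist_supp u \<subseteq> F}"

definition s_null :: "real \<Rightarrow> (real^'n::finite) set \<Rightarrow> bool" where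
  "s_null s E \<longleftrightarrow> (\<forall>F. closed F \<and> F \<subseteq> E \<longrightarrow> Hs_supp s F = {\<lambda>\<phi>. 0})"

definition norm_closure ::
  "'n::finite functional set \<Rightarrow> ('n functional \<Rightarrow> real) \<Rightarrow> 'n functional set \<Rightarrow> 'n functional set"
  where
  "norm_closure V nrm A = {u \<in> V. \<forall>e>0. \<exists>a\<in>A. nrm (\<lambda>\<phi>. u \<phi> - a \<phi>) < e}"

definition Hs_tilde :: "real \<Rightarrow> (real^'n::finite) set \<Rightarrow> 'n functional set" where
  "Hs_tilde s \<Omega> = norm_closure (Hs s) (Hs_norm s) (of_function ` test_funs \<Omega>)"

definition Hs_ring :: "real \<Rightarrow> (real^'n::finite) set \<Rightarrow> 'n functional set" where
  "Hs_ring s \<Omega> = {u \<in> Hs s. \<exists>g. represented_by u g \<and> (AE x in lborel. x \<in> - \<Omega> \<longrightarrow> g x = 0)}"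

definition Hs_orth :: "real \<Rightarrow> 'n::finite functional set \<Rightarrow> 'n functional set" where
  "Hs_orth s M = {u \<in> Hs s. \<forall>v\<in>M. Hs_inner s u v = 0}"

definition Hs_proj :: "real \<Rightarrow> 'n::finite functional set \<Rightarrow> 'n functional \<Rightarrow> 'n functional" where
  "Hs_proj s M u = (THE p. p \<in> M \<and> (\<lambda>\<phi>. u \<phi> - p \<phi>) \<in> Hs_orth s M)"

section \<open>Sobolev spaces on an open set\<close>

definition HsD :: "real \<Rightarrow> (real^'n::finite) set \<Rightarrow> 'n functional set" where
  "HsD s \<Omega> = {u \<in> distributions \<Omega>. \<exists>U\<in>Hs s. u = restr \<Omega> U}"

text \<open>The infimum is a minimum, as the extensions of \<open>u\<close> form a closed affine subspace
  of a Hilbert space.\<close>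

definition HsD_norm :: "real \<Rightarrow> (real^'n::finite) set \<Rightarrow> 'n functional \<Rightarrow> real" where
  "HsD_norm s \<Omega> u = Inf {Hs_norm s U | U. U \<in> Hs s \<and> restr \<Omega> U = u}"

definition Qproj :: "real \<Rightarrow> (real^'n::finite) set \<Rightarrow> 'n functional \<Rightarrow> 'n functional" where
  "Qproj s \<Omega> = Hs_proj s (Hs_orth s (Hs_supp s (- \<Omega>)))"

definition some_ext :: "real \<Rightarrow> (real^'n::finite) set \<Rightarrow> 'n functional \<Rightarrow> 'n functional" where
  "some_ext s \<Omega> u = (SOME U. U \<in> Hs s \<and> restr \<Omega> U = u)"

text \<open>Two extensions of \<open>u\<close> differ by an element of \<open>Hs_supp s (- \<Omega>)\<close>, so the choice of
  extension does not matter.\<close>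

definition HsD_inner ::
  "real \<Rightarrow> (real^'n::finite) set \<Rightarrow> 'n functional \<Rightarrow> 'n functional \<Rightarrow> complex" where
  "HsD_inner s \<Omega> u v =
     Hs_inner s (Qproj s \<Omega> (some_ext s \<Omega> u)) (Qproj s \<Omega> (some_ext s \<Omega> v))"

definition HsD_0 :: "real \<Rightarrow> (real^'n::finite) set \<Rightarrow> 'n functional set" where
  "HsD_0 s \<Omega> = norm_closure (HsD s \<Omega>) (HsD_norm s \<Omega>)
     ((\<lambda>\<phi>. restr \<Omega> (of_function \<phi>)) ` test_funs \<Omega>)"

section \<open>Unitary isomorphisms\<close>

text \<open>Preservation of the norm and of the inner product are both required, because the norm
  and the inner product of \<open>HsD s \<Omega>\<close> are defined independently of each other.\<close>

definition unitary_iso ::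
  "'n::finite functional set \<Rightarrow> ('n functional \<Rightarrow> real) \<Rightarrow> ('n functional \<Rightarrow> 'n functional \<Rightarrow> complex) \<Rightarrow>
   'n functional set \<Rightarrow> ('n functional \<Rightarrow> real) \<Rightarrow> ('n functional \<Rightarrow> 'n functional \<Rightarrow> complex) \<Rightarrow>
   ('n functional \<Rightarrow> 'n functional) \<Rightarrow> bool" where
  "unitary_iso V nV iV W nW iW T \<longleftrightarrow>
     T ` V = W \<and>
     (\<forall>u\<in>V. \<forall>v\<in>V. \<forall>a b. T (\<lambda>\<phi>. a * u \<phi> + b * v \<phi>) = (\<lambda>\<phi>. a * T u \<phi> + b * T v \<phi>)) \<and>
     (\<forall>u\<in>V. nW (T u) = nV u) \<and>
     (\<forall>u\<in>V. \<forall>v\<in>V. iW (T u) (T v) = iV u v)"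

end

theory Submission
  imports Defs "HOL-Probability.Probability"
begin

text \<open>
  Two extensions of a distribution on \<open>\<Omega>\<close> differ by an element of \<open>H\<^sup>s\<^bsub>\<Omega>\<^sup>c\<^esub>\<close>, and a distribution supported in
  the closure of \<open>\<Omega>\<close> that vanishes on \<open>\<Omega>\<close> is supported in the frontier; this is (i). For \<open>s \<ge> 0\<close> the spaces
  in (ii) and (iii) consist of \<open>L\<^sup>2\<close> functions vanishing almost everywhere outside \<open>\<Omega>\<close>, which are determined
  by their restrictions. For \<open>s = m \<in> \<nat>\<close> the point is that such a function \<open>u\<close> is orthogonal in \<open>H\<^sup>m\<close> to every
  \<open>v\<close> that vanishes on \<open>\<Omega>\<close>, so that \<open>u\<close> is the minimal extension of its restriction. This rests on the fact
  that a weak derivative in \<open>L\<^sup>2\<close> of a function vanishes almost everywhere on the zero set of the function,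
  applied to \<open>u\<close> on the complement of \<open>\<Omega>\<close> and to \<open>v\<close> on \<open>\<Omega>\<close>: expanding
  \<open>(1 + |\<xi>|\<^sup>2)\<^sup>m\<^sup>+\<^sup>1 = (1 + |\<xi>|\<^sup>2)\<^sup>m (1 + \<Sum>\<^sub>j \<xi>\<^sub>j\<^sup>2)\<close>, all terms of the inner product vanish by induction on \<open>m\<close>.
\<close>


section \<open>Smooth functions\<close>

text \<open>For a general open \<Omega> the elements of \<open>Hs_ring s \<Omega>\<close> need not
  be limits of test functions of \<Omega>, and the boundary may have positive measure. The
  orthogonality for integer order therefore cannot be had by integrating by parts against test
  functions; it has to be read off from zero sets alone, and this is why difference quotients and
  the continuity of translations in L^2 appear. Integer order matters because the weight (1 +
  |\<xi>|^2)^m is then a polynomial, the symbol of a differential operator, and differential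
  operators are local; fractional weights are not. Distributions are concrete functionals here, so
  the L^2 transform is a closure of the transform on Schwartz functions, tied to
  \<open>fourier_dist\<close> by duality. \<open>Qproj\<close> is a description and
  \<open>HsD_norm\<close> an infimum; their values are computed only where they can be exhibited,
  namely at elements already orthogonal to everything that vanishes on \<Omega>.\<close>

lemma partial_eqI: "(f has_derivative f') (at x) \<Longrightarrow> partial i f x = f' (axis i 1)"
  by (simp add: partial_def frechet_derivative_at[symmetric])

lemma partials_append: "partials (xs @ ys) f = partials xs (partials ys f)"
  by (induction xs) auto

lemma smooth_differentiable: "smooth f \<Longrightarrow> f differentiable at x"
  unfolding smooth_def by (metis partials.simps(1))

lemma smooth_partials: "smooth f \<Longrightarrow> smooth (partials is f)"
  unfolding smooth_def by (metis partials_append)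

lemma smooth_partial: "smooth f \<Longrightarrow> smooth (partial i f)"
  using smooth_partials[of f "[i]"] by simp

lemma smooth_has_derivative:
  "smooth f \<Longrightarrow> (f has_derivative frechet_derivative f (at x)) (at x)"
  using smooth_differentiable frechet_derivative_works by blast

lemma smooth_continuous_on: "smooth f \<Longrightarrow> continuous_on S f"
  using smooth_differentiable differentiable_imp_continuous_within
  by (metis continuous_at_imp_continuous_on)

lemma smooth_borel [measurable_dest]: "smooth f \<Longrightarrow> f \<in> borel_measurable borel"
  by (intro borel_measurable_continuous_onI smooth_continuous_on)

inductive_set sum_closure :: "('a \<Rightarrow> complex) set \<Rightarrow> ('a \<Rightarrow> complex) set" for B where
  base: "f \<in> B \<Longrightarrow> f \<in> sum_closure B"
| add: "f \<in> sum_closure B \<Longrightarrow> g \<in> sum_closure B \<Longrightarrow> (\<lambda>x. f x + g x) \<in> sum_closure B"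

lemma partial_add:
  assumes "f differentiable at x" "g differentiable at x"
  shows "partial i (\<lambda>x. f x + g x) x = partial i f x + partial i g x"
  by (rule partial_eqI[THEN trans])
    (use assms in \<open>auto intro!: derivative_eq_intros simp: frechet_derivative_works partial_def\<close>)

lemma partial_mult:
  assumes "f differentiable at x" "g differentiable at x"
  shows "partial i (\<lambda>x. f x * g x) x = f x * partial i g x + partial i f x * g x"
  by (rule partial_eqI[THEN trans])
    (use assms in \<open>auto intro!: derivative_eq_intros simp: frechet_derivative_works partial_def\<close>)

lemma partial_linear_image:
  assumes "f differentiable at x" "bounded_linear L"
  shows "partial i (\<lambda>x. L (f x)) x = L (partial i f x)"
  unfolding partial_def
  by (metis assms bounded_linear.has_derivative frechet_derivative_at frechet_derivative_works)

lemma partial_uminus: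
  assumes "f differentiable at (- x)"
  shows "partial i (\<lambda>x. f (- x)) x = - partial i f (- x)"
proof -
  have "((\<lambda>x. f (- x)) has_derivative (\<lambda>h. frechet_derivative f (at (- x)) (- h))) (at x)"
    using assms unfolding frechet_derivative_works
    by (auto intro!: has_derivative_compose[of uminus] derivative_eq_intros)
  from partial_eqI[OF this] show ?thesis
    using linear_frechet_derivative[OF assms] by (simp add: partial_def linear_neg)
qed

lemma sum_closure_differentiable:
  assumes "f \<in> sum_closure B" "\<And>f x. f \<in> B \<Longrightarrow> f differentiable at x"
  shows "f differentiable at x"
  using assms(1) by induction (auto intro: assms(2))

lemma sum_closure_partials:
  assumes "f \<in> sum_closure B"
    and diff: "\<And>f x. f \<in> B \<Longrightarrow> f differentiable at x"
    and par: "\<And>f i. f \<in> B \<Longrightarrow> partial i f \<in> sum_closure B"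
  shows "partials is f \<in> sum_closure B"
proof (induction "is")
  case (Cons i "is")
  have "partial i g \<in> sum_closure B" if "g \<in> sum_closure B" for g
    using that
  proof induction
    case (add f g)
    then have "partial i (\<lambda>x. f x + g x) = (\<lambda>x. partial i f x + partial i g x)"
      by (intro ext partial_add) (auto intro: sum_closure_differentiable diff)
    with add show ?case by (auto intro: sum_closure.add)
  qed (rule par)
  with Cons show ?case by simp
qed (use assms in auto)

text \<open>The closure under sums is there because of the product rule, which takes a product to a sum of two
  products.\<close>

lemma smooth_coinduct:
  assumes "f \<in> sum_closure B"
    and "\<And>f x. f \<in> B \<Longrightarrow> f differentiable at x"
    and "\<And>f i. f \<in> B \<Longrightarrow> partial i f \<in> sum_closure B"
  shows "smooth f"
  unfolding smooth_def
  using sum_closure_partials[OF assms] sum_closure_differentiable assms(2) by blast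

lemma smooth_mult:
  assumes "smooth f" "smooth g"
  shows "smooth (\<lambda>x. f x * g x)"
proof (rule smooth_coinduct[where B = "{\<lambda>x. f x * g x | f g. smooth f \<and> smooth g}"])
  fix h :: "real^'n \<Rightarrow> complex" and i
  assume "h \<in> {\<lambda>x. f x * g x | f g. smooth f \<and> smooth g}"
  then obtain f g where h: "h = (\<lambda>x. f x * g x)" "smooth f" "smooth g" by auto
  then have "partial i h = (\<lambda>x. f x * partial i g x + partial i f x * g x)"
    by (auto intro!: ext partial_mult smooth_differentiable)
  then show "partial i h \<in> sum_closure {\<lambda>x. f x * g x | f g. smooth f \<and> smooth g}"
    using h smooth_partial by (simp only:) (rule sum_closure.add; rule sum_closure.base; blast)
  show "h differentiable at x" for x
    unfolding h(1) using h by (intro differentiable_mult smooth_differentiable[of f] smooth_differentiable[of g])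
qed (use assms in \<open>auto intro!: sum_closure.base\<close>)

lemma smooth_const: "smooth (\<lambda>x. c)"
proof (rule smooth_coinduct[where B = "range (\<lambda>c x. c)"])
  fix h :: "real^'n \<Rightarrow> complex" and i
  assume "h \<in> range (\<lambda>c x. c)"
  then have "partial i h = (\<lambda>x. 0)" by (auto intro!: ext partial_eqI[THEN trans] derivative_eq_intros)
  then show "partial i h \<in> sum_closure (range (\<lambda>c x. c))" by (auto intro: sum_closure.base)
qed (auto intro: sum_closure.base)

lemma smooth_cmult: "smooth f \<Longrightarrow> smooth (\<lambda>x. c * f x)"
  by (intro smooth_mult smooth_const)

lemma smooth_add: "smooth f \<Longrightarrow> smooth g \<Longrightarrow> smooth (\<lambda>x. f x + g x)"
  by (rule smooth_coinduct[where B = "Collect smooth"], rule sum_closure.add)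
    (auto intro!: sum_closure.base smooth_differentiable smooth_partial)

lemma smooth_diff: "smooth f \<Longrightarrow> smooth g \<Longrightarrow> smooth (\<lambda>x. f x - g x)"
  using smooth_add[of f "\<lambda>x. (-1) * g x"] smooth_cmult[of g "-1"] by simp

lemma smooth_sum: "(\<And>i. i \<in> I \<Longrightarrow> smooth (f i)) \<Longrightarrow> smooth (\<lambda>x. \<Sum>i\<in>I. f i x)"
proof (induction I rule: infinite_finite_induct)
  case (insert j I)
  have "smooth (f j)" "smooth (\<lambda>x. \<Sum>i\<in>I. f i x)" using insert by simp_all
  from smooth_add[OF this] show ?case using insert(1,2) by simp
qed (simp_all add: smooth_const)

lemma smooth_prod: "(\<And>i. i \<in> I \<Longrightarrow> smooth (f i)) \<Longrightarrow> smooth (\<lambda>x. \<Prod>i\<in>I. f i x)"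
proof (induction I rule: infinite_finite_induct)
  case (insert j I)
  have "smooth (f j)" "smooth (\<lambda>x. \<Prod>i\<in>I. f i x)" using insert by simp_all
  from smooth_mult[OF this] show ?case using insert(1,2) by simp
qed (simp_all add: smooth_const)

lemma smooth_power: "smooth f \<Longrightarrow> smooth (\<lambda>x. f x ^ k)"
proof (induction k)
  case (Suc k)
  with smooth_mult[of f "\<lambda>x. f x ^ k"] show ?case by simp
qed (simp add: smooth_const)

subsection \<open>Supports\<close>

lemma fun_supp_subset: "closed S \<Longrightarrow> (\<And>x. x \<notin> S \<Longrightarrow> f x = 0) \<Longrightarrow> fun_supp f \<subseteq> S"
  unfolding fun_supp_def by (rule closure_minimal) auto

lemma not_in_fun_supp: "x \<notin> fun_supp f \<Longrightarrow> f x = 0"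
  using closure_subset[of "{x. f x \<noteq> 0}"] by (auto simp: fun_supp_def)

lemma closed_fun_supp: "closed (fun_supp f)"
  unfolding fun_supp_def by simp

lemma fun_supp_mono: "(\<And>x. g x = 0 \<Longrightarrow> f x = 0) \<Longrightarrow> fun_supp f \<subseteq> fun_supp g"
  unfolding fun_supp_def by (rule closure_mono) auto

lemma has_derivative_off_supp:
  assumes "x \<notin> fun_supp f"
  shows "(f has_derivative (\<lambda>h. 0)) (at x)"
  by (rule has_derivative_transform_within_open[where f = "\<lambda>x. 0" and s = "- fun_supp f"])
    (use assms closed_fun_supp in \<open>auto simp: not_in_fun_supp\<close>)

lemma fun_supp_partial: "fun_supp (partial i f) \<subseteq> fun_supp f"
  by (rule fun_supp_subset[OF closed_fun_supp])
    (use has_derivative_off_supp partial_eqI in fastforce)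

lemma fun_supp_partials: "fun_supp (partials is f) \<subseteq> fun_supp f"
  by (induction "is") (auto dest: subsetD[OF fun_supp_partial])

text \<open>The denominator may vanish off the support of \<open>f\<close>, where the quotient is
  locally 0 (HOL sets x / 0 = 0). This suits partitions of unity, whose denominator is positive only
  near a compact set.\<close>

lemma smooth_divide:
  assumes f: "smooth f" and g: "smooth g" and nz: "\<And>x. x \<in> fun_supp f \<Longrightarrow> g x \<noteq> 0"
  shows "smooth (\<lambda>x. f x / g x)"
proof -
  \<comment> \<open>Powers of \<open>g\<close> make the class stable under the quotient rule: the
    derivative is kept as a sum of two fractions over \<open>g x ^ k\<close> and
    \<open>g x ^ Suc k\<close>, and the supports of the numerators never grow.\<close>
  define B where "B = {\<lambda>x. h x / g x ^ k | h k. smooth h \<and> fun_supp h \<subseteq> fun_supp f}"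
  have deriv: "((\<lambda>x. h x / g x ^ k) has_derivative (\<lambda>v. frechet_derivative h (at x) v / g x ^ k
      - of_nat k * h x * frechet_derivative g (at x) v / g x ^ Suc k)) (at x)"
    if h: "smooth h" "fun_supp h \<subseteq> fun_supp f" for h k x
  proof (cases "x \<in> fun_supp f")
    case True
    have "((\<lambda>x. h x / g x ^ k) has_derivative (\<lambda>v. (frechet_derivative h (at x) v * g x ^ k
        - h x * (of_nat k * frechet_derivative g (at x) v * g x ^ (k - 1))) / (g x ^ k * g x ^ k))) (at x)"
      using nz[OF True]
      by (intro has_derivative_divide' has_derivative_power smooth_has_derivative h g) simp
    then show ?thesis
      by (rule has_derivative_eq_rhs) (use nz[OF True] in \<open>cases k; auto simp: field_simps\<close>)
  next
    case False
    then have "x \<notin> fun_supp h" using h by auto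
    then have "frechet_derivative h (at x) = (\<lambda>v. 0)" "h x = 0"
      using has_derivative_off_supp frechet_derivative_at by (metis, simp add: not_in_fun_supp)
    moreover have "x \<notin> fun_supp (\<lambda>x. h x / g x ^ k)"
      using \<open>x \<notin> fun_supp h\<close> fun_supp_mono[of h "\<lambda>x. h x / g x ^ k"] by auto
    ultimately show ?thesis using has_derivative_off_supp by fastforce
  qed
  show ?thesis
  proof (rule smooth_coinduct[where B = B])
    show "(\<lambda>x. f x / g x) \<in> sum_closure B"
      unfolding B_def using f
      by (intro sum_closure.base CollectI exI[of _ f] exI[of _ 1]) auto
    fix h i assume "h \<in> B"
    then obtain h' k where h': "h = (\<lambda>x. h' x / g x ^ k)" "smooth h'" "fun_supp h' \<subseteq> fun_supp f"
      unfolding B_def by auto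
    show "h differentiable at x" for x
      using deriv[OF h'(2,3)] h'(1) unfolding differentiable_def by auto
    have *: "partial i h = (\<lambda>x. partial i h' x / g x ^ k +
        ((- of_nat k) * h' x * partial i g x) / g x ^ Suc k)"
      unfolding h'(1)
      by (rule ext, subst partial_eqI[OF deriv[OF h'(2,3)]]) (simp add: partial_def)
    have "smooth (partial i h')" "fun_supp (partial i h') \<subseteq> fun_supp f"
      using h' smooth_partial fun_supp_partial by (auto, blast)
    moreover have "smooth (\<lambda>x. (- of_nat k) * h' x * partial i g x)"
      by (intro smooth_mult smooth_const h' smooth_partial g)
    moreover have "fun_supp (\<lambda>x. (- of_nat k) * h' x * partial i g x) \<subseteq> fun_supp f"
      by (rule order_trans[OF fun_supp_mono h'(3)]) auto
    ultimately show "partial i h \<in> sum_closure B"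
      unfolding * B_def
      by (intro sum_closure.add sum_closure.base CollectI) (metis, metis)
  qed
qed

subsection \<open>Bump functions\<close>

text \<open>For \<open>k = 0\<close> this is the classical smooth function that is flat at 0. The
  factors 1 / t^k are there because differentiation then stays within linear combinations of the
  family, so that smoothness reduces to first derivatives.\<close>

definition flat :: "nat \<Rightarrow> real \<Rightarrow> real" where
  "flat k t = (if t > 0 then exp (- (1 / t)) / t ^ k else 0)"

lemma flat_nonneg: "0 \<le> flat k t"
  by (simp add: flat_def)

lemma flat_le_1: "flat 0 t \<le> 1"
  by (simp add: flat_def)

lemma flat_tendsto_0: "(flat k \<longlongrightarrow> 0) (at 0)"
proof -
  \<comment> \<open>The substitution y = 1 / t turns the claim into y^k / exp y \<rightarrow> 0 for
    growing y.\<close>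
  have "((\<lambda>t. inverse t ^ k / exp (inverse t)) \<longlongrightarrow> (0::real)) (at_right 0)"
    by (rule filterlim_compose[OF tendsto_power_div_exp_0 filterlim_inverse_at_top_right])
  then have "(flat k \<longlongrightarrow> 0) (at_right 0)"
    by (rule Lim_transform_eventually)
      (auto simp: eventually_at_right_less flat_def exp_minus field_simps intro!: eventually_at_rightI[of 0 1])
  moreover have "(flat k \<longlongrightarrow> 0) (at_left 0)"
    by (rule Lim_transform_eventually[OF tendsto_const])
      (auto simp: flat_def intro!: eventually_at_leftI[of "-1" 0])
  ultimately show ?thesis by (simp add: filterlim_split_at)
qed

lemma flat_deriv:
  "(flat k has_real_derivative (flat (k + 2) t - real k * flat (k + 1) t)) (at t)"
proof -
  consider "t > 0" | "t < 0" | "t = 0" by linarith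
  then show ?thesis
  proof cases
    case 1
    have "((\<lambda>t. exp (- (1 / t)) / t ^ k) has_real_derivative (flat (k + 2) t - real k * flat (k + 1) t)) (at t)"
    proof (cases k)
      case (Suc m)
      have "((\<lambda>t. exp (- (1 / t)) / t ^ Suc m) has_real_derivative
         (exp (- (1 / t)) * (1 / t\<^sup>2) * t ^ Suc m - exp (- (1 / t)) * (real (Suc m) * t ^ m)) / (t ^ Suc m * t ^ Suc m)) (at t)"
        using 1 by (auto intro!: derivative_eq_intros simp: power2_eq_square simp del: power_Suc of_nat_Suc) 
      then show ?thesis unfolding Suc
        by (rule DERIV_cong) (use 1 Suc in \<open>auto simp: flat_def field_simps power2_eq_square\<close>)
    qed (use 1 in \<open>auto intro!: derivative_eq_intros simp: flat_def field_simps power2_eq_square\<close>)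
    then show ?thesis
      by (rule has_field_derivative_transform_within_open[where S = "{0<..}"])
        (use 1 in \<open>auto simp: flat_def\<close>)
  next
    case 2
    have "((\<lambda>t. 0) has_real_derivative 0) (at t)" by simp
    then have "(flat k has_real_derivative 0) (at t)"
      by (rule has_field_derivative_transform_within_open[where S = "{..<0}"])
        (use 2 in \<open>auto simp: flat_def\<close>)
    then show ?thesis using 2 by (simp add: flat_def)
  next
    case 3
    \<comment> \<open>The difference quotient of \<open>flat k\<close> at 0 is
      \<open>flat (Suc k)\<close>, whose limit at 0 is already known.\<close>
    have "((\<lambda>h. (flat k (0 + h) - flat k 0) / h) \<longlongrightarrow> 0) (at 0)"
      by (rule Lim_transform_eventually[OF flat_tendsto_0[of "Suc k"]])
        (auto simp: flat_def eventually_at_filter)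
    then show ?thesis using 3 by (simp add: DERIV_def flat_def)
  qed
qed

lemma smooth_flat: "smooth (\<lambda>x::real^'n. complex_of_real (flat k (a * x $ i + b)))"
proof -
  define B where "B = {\<lambda>x::real^'n. c * complex_of_real (flat k (a * x $ i + b)) | c k. True}"
  have deriv: "((\<lambda>x::real^'n. c * complex_of_real (flat k (a * x $ i + b))) has_derivative
     (\<lambda>h. c * of_real (a * h $ i * (flat (k + 2) (a * x $ i + b) - real k * flat (k + 1) (a * x $ i + b))))) (at x)"
    for c k x
  proof -
    have "((\<lambda>x::real^'n. a * x $ i + b) has_derivative (\<lambda>h. a * h $ i)) (at x)"
      by (auto intro!: derivative_eq_intros bounded_linear.has_derivative[OF bounded_linear_vec_nth])
    from has_derivative_compose[OF this, of "flat k"] flat_deriv[of k "a * x $ i + b"]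
    have "((\<lambda>x::real^'n. flat k (a * x $ i + b)) has_derivative
      (\<lambda>h. (flat (k + 2) (a * x $ i + b) - real k * flat (k + 1) (a * x $ i + b)) * (a * h $ i))) (at x)"
      unfolding has_field_derivative_def by blast
    then show ?thesis
      by (auto intro!: derivative_eq_intros simp: mult_ac)
  qed
  show ?thesis
  proof (rule smooth_coinduct[where B = B])
    show "(\<lambda>x. complex_of_real (flat k (a * x $ i + b))) \<in> sum_closure B"
      unfolding B_def by (intro sum_closure.base CollectI exI[of _ 1] exI[of _ k]) auto
    fix h j assume "h \<in> B"
    then obtain c k where h: "h = (\<lambda>x. c * complex_of_real (flat k (a * x $ i + b)))"
      unfolding B_def by auto
    show "h differentiable at x" for x
      using deriv h unfolding differentiable_def by blast
    have "partial j h = (\<lambda>x. (c * of_real (a * axis j 1 $ i)) * complex_of_real (flat (k + 2) (a * x $ i + b))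
       + (- c * of_real (a * axis j 1 $ i * real k)) * complex_of_real (flat (k + 1) (a * x $ i + b)))"
      unfolding h by (rule ext, subst partial_eqI[OF deriv]) (simp add: algebra_simps)
    then show "partial j h \<in> sum_closure B"
      unfolding B_def by (simp only:) (rule sum_closure.add; rule sum_closure.base; blast)
  qed
qed

text \<open>A bump without plateau: indicators of boxes are reached through powers of
  \<open>1 - bump\<close>, and partitions of unity through division by a sum of bumps, so positivity
  exactly on the open box and values in [0, 1] are what counts.\<close>

definition bump :: "real^'n \<Rightarrow> real^'n \<Rightarrow> real^'n \<Rightarrow> real" where
  "bump a b x = (\<Prod>i\<in>UNIV. flat 0 (x $ i - a $ i) * flat 0 (b $ i - x $ i))"

lemma smooth_bump:
  fixes a b :: "real^'n"
  shows "smooth (\<lambda>x. complex_of_real (bump a b x))"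
proof -
  have "smooth (\<lambda>x::real^'n. complex_of_real (flat 0 (x $ i - a $ i)))" for i
    using smooth_flat[of 0 1 i "- a $ i"] by simp
  moreover have "smooth (\<lambda>x::real^'n. complex_of_real (flat 0 (b $ i - x $ i)))" for i
    using smooth_flat[of 0 "-1" i "b $ i"] by simp
  ultimately show ?thesis unfolding bump_def of_real_prod of_real_mult
    by (intro smooth_prod smooth_mult) auto
qed

lemma bump_range: "0 \<le> bump a b x" "bump a b x \<le> 1"
  unfolding bump_def
  by (auto intro!: prod_nonneg prod_le_1 mult_nonneg_nonneg mult_le_one flat_nonneg flat_le_1)

lemma bump_pos_iff: "0 < bump a b x \<longleftrightarrow> x \<in> box a b"
proof -
  have nn: "0 \<le> flat 0 (x $ i - a $ i) * flat 0 (b $ i - x $ i)" for i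
    by (simp add: flat_nonneg)
  have "0 < bump a b x \<longleftrightarrow> (\<forall>i. flat 0 (x $ i - a $ i) * flat 0 (b $ i - x $ i) \<noteq> 0)"
    using bump_range(1)[of a b x] unfolding bump_def by (simp add: less_le eq_commute[of 0])
  also have "\<dots> \<longleftrightarrow> x \<in> box a b"
    by (auto simp: mem_box_cart flat_def)
  finally show ?thesis .
qed

lemma fun_supp_bump: "fun_supp (\<lambda>x. complex_of_real (bump a b x)) \<subseteq> cbox a b"
proof (rule fun_supp_subset)
  fix x assume "x \<notin> cbox a b"
  then have "\<not> 0 < bump a b x" unfolding bump_pos_iff using box_subset_cbox by blast
  then show "complex_of_real (bump a b x) = 0" using bump_range(1)[of a b x] by simp
qed auto

section \<open>Schwartz functions\<close>

lemma bounded_range_weighted: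
  "bounded (range (\<lambda>x. (1 + norm x) ^ k *\<^sub>R f x)) \<longleftrightarrow> (\<exists>C. \<forall>x::real^'n. (1 + norm x) ^ k * cmod (f x) \<le> C)"
  by (simp add: bounded_iff abs_of_nonneg)

lemma schwartz_smooth: "\<phi> \<in> schwartz \<Longrightarrow> smooth \<phi>"
  by (simp add: schwartz_def)

lemma schwartz_differentiable: "\<phi> \<in> schwartz \<Longrightarrow> \<phi> differentiable at x"
  by (simp add: schwartz_smooth smooth_differentiable)

lemma schwartz_borel [measurable_dest]: "\<phi> \<in> schwartz \<Longrightarrow> \<phi> \<in> borel_measurable borel"
  by (simp add: schwartz_smooth smooth_borel)

lemma schwartz_partials: "\<phi> \<in> schwartz \<Longrightarrow> partials is \<phi> \<in> schwartz"
  by (auto simp: schwartz_def smooth_partials partials_append[symmetric])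

lemma schwartz_partial: "\<phi> \<in> schwartz \<Longrightarrow> partial i \<phi> \<in> schwartz"
  using schwartz_partials[of \<phi> "[i]"] by simp

lemma schwartz_bound:
  fixes \<phi> :: "real^'n \<Rightarrow> complex"
  assumes "\<phi> \<in> schwartz"
  obtains C where "0 \<le> C" "\<And>x. (1 + norm x) ^ k * cmod (\<phi> x) \<le> C"
proof -
  have "bounded (range (\<lambda>x. (1 + norm x) ^ k *\<^sub>R partials [] \<phi> x))"
    using assms unfolding schwartz_def by blast
  then obtain C where C: "\<And>x. (1 + norm x) ^ k * cmod (\<phi> x) \<le> C"
    unfolding bounded_range_weighted by auto
  from C[of 0] have "0 \<le> C" by (simp add: order_trans[OF norm_ge_zero])
  with C show ?thesis using that by blast
qed

lemma weighted_bounded_add: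
  fixes f g :: "real^'n \<Rightarrow> complex"
  assumes "bounded (range (\<lambda>x. (1 + norm x) ^ k *\<^sub>R f x))" "bounded (range (\<lambda>x. (1 + norm x) ^ k *\<^sub>R g x))"
  shows "bounded (range (\<lambda>x. (1 + norm x) ^ k *\<^sub>R (f x + g x)))"
  using bounded_plus_comp[OF assms] by (simp add: scaleR_add_right)

text \<open>Weights have to be checked on \<open>B\<close> only: iterated derivatives never leave
  \<open>sum_closure B\<close>, and weighted boundedness survives sums.\<close>

lemma schwartz_coinduct:
  fixes f :: "real^'n \<Rightarrow> complex"
  assumes "f \<in> sum_closure B"
    and diff: "\<And>f x. f \<in> B \<Longrightarrow> f differentiable at x"
    and par: "\<And>f i. f \<in> B \<Longrightarrow> partial i f \<in> sum_closure B"
    and bdd: "\<And>f k. f \<in> B \<Longrightarrow> bounded (range (\<lambda>x. (1 + norm x) ^ k *\<^sub>R f x))"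
  shows "f \<in> schwartz"
proof -
  have "bounded (range (\<lambda>x. (1 + norm x) ^ k *\<^sub>R g x))" if "g \<in> sum_closure B" for g k
    using that by induction (auto intro: bdd weighted_bounded_add)
  then show ?thesis
    using sum_closure_partials[OF assms(1) diff par] smooth_coinduct[OF assms(1) diff par]
    unfolding schwartz_def by blast
qed

lemma schwartz_add:
  assumes "\<phi> \<in> schwartz" "\<psi> \<in> schwartz"
  shows "(\<lambda>x. \<phi> x + \<psi> x) \<in> schwartz"
proof (rule schwartz_coinduct[where B = schwartz])
  show "bounded (range (\<lambda>x. (1 + norm x) ^ k *\<^sub>R f x))" if "f \<in> schwartz" for f :: "real^'n \<Rightarrow> complex" and k
  proof -
    have "bounded (range (\<lambda>x. (1 + norm x) ^ k *\<^sub>R partials [] f x))"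
      using that unfolding schwartz_def by blast
    then show ?thesis by simp
  qed
  show "(\<lambda>x. \<phi> x + \<psi> x) \<in> sum_closure schwartz"
    by (intro sum_closure.add sum_closure.base assms)
qed (auto intro!: sum_closure.base simp: schwartz_differentiable schwartz_partial)

text \<open>Such functions are multipliers of the Schwartz space; the instances below are constants,
  coordinates and characters.\<close>

definition slowly_growing :: "(real^'n \<Rightarrow> complex) \<Rightarrow> bool" where
  "slowly_growing M \<longleftrightarrow> smooth M \<and> (\<forall>is. \<exists>k C. \<forall>x. cmod (partials is M x) \<le> C * (1 + norm x) ^ k)"

lemma slowly_growing_coinduct:
  fixes f :: "real^'n \<Rightarrow> complex"
  assumes f: "f \<in> B"
    and diff: "\<And>f x. f \<in> B \<Longrightarrow> f differentiable at x"
    and par: "\<And>f i. f \<in> B \<Longrightarrow> partial i f \<in> B"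
    and bdd: "\<And>f. f \<in> B \<Longrightarrow> \<exists>k C. \<forall>x. cmod (f x) \<le> C * (1 + norm x) ^ k"
  shows "slowly_growing f"
proof -
  have "partials is f \<in> B" for "is"
    by (induction "is") (auto intro: f par)
  moreover have "smooth f"
    by (rule smooth_coinduct[where B = B]) (auto intro: sum_closure.base f diff par)
  ultimately show ?thesis
    unfolding slowly_growing_def using bdd by simp
qed

lemma slowly_growing_partial: "slowly_growing M \<Longrightarrow> slowly_growing (partial i M)"
proof -
  assume "slowly_growing M"
  moreover have "partials is (partial i M) = partials (is @ [i]) M" for "is"
    by (simp add: partials_append)
  ultimately show ?thesis
    by (simp add: slowly_growing_def smooth_partial)
qed

text \<open>Both factors vary in the generating set since the product rule differentiates either
  one. Decay of order \<open>k\<close> of the product comes from decay of order \<open>k + l\<close>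
  of the Schwartz factor, where \<open>l\<close> is the growth order of the multiplier.\<close>

lemma schwartz_mult_slowly_growing:
  fixes M \<psi> :: "real^'n \<Rightarrow> complex"
  assumes "slowly_growing M" "\<psi> \<in> schwartz"
  shows "(\<lambda>x. M x * \<psi> x) \<in> schwartz"
proof (rule schwartz_coinduct[where B = "{\<lambda>x. M x * \<psi> x | M \<psi>. slowly_growing M \<and> \<psi> \<in> schwartz}"])
  fix h :: "real^'n \<Rightarrow> complex"
  assume "h \<in> {\<lambda>x. M x * \<psi> x | M \<psi>. slowly_growing M \<and> \<psi> \<in> schwartz}"
  then obtain M \<psi> where h: "h = (\<lambda>x. M x * \<psi> x)" and M: "slowly_growing M" and \<psi>: "\<psi> \<in> schwartz" by auto
  have d: "M differentiable at x" "\<psi> differentiable at x" for x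
    using M \<psi> schwartz_differentiable smooth_differentiable slowly_growing_def by blast+
  show "h differentiable at x" for x
    unfolding h by (intro differentiable_mult d)
  show "partial i h \<in> sum_closure {\<lambda>x. M x * \<psi> x | M \<psi>. slowly_growing M \<and> \<psi> \<in> schwartz}" for i
    unfolding h partial_mult[OF d, abs_def]
    using M \<psi> schwartz_partial slowly_growing_partial
    by - (rule sum_closure.add; rule sum_closure.base; blast)
  show "bounded (range (\<lambda>x. (1 + norm x) ^ k *\<^sub>R h x))" for k
  proof -
    obtain l C where C: "\<And>x. cmod (M x) \<le> C * (1 + norm x) ^ l"
      using M unfolding slowly_growing_def by (metis partials.simps(1))
    obtain D where D: "0 \<le> D" "\<And>x. (1 + norm x) ^ (k + l) * cmod (\<psi> x) \<le> D"
      using schwartz_bound[OF \<psi>] by metis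
    have "0 \<le> C" using C[of 0] by (simp add: order_trans[OF norm_ge_zero])
    have "(1 + norm x) ^ k * cmod (h x) \<le> C * D" for x
    proof -
      have "(1 + norm x) ^ k * cmod (h x) = (1 + norm x) ^ k * (cmod (M x) * cmod (\<psi> x))"
        by (simp add: h norm_mult)
      also have "\<dots> \<le> (1 + norm x) ^ k * (C * (1 + norm x) ^ l * cmod (\<psi> x))"
        by (intro mult_left_mono mult_right_mono C) auto
      also have "\<dots> = C * ((1 + norm x) ^ (k + l) * cmod (\<psi> x))"
        by (simp add: power_add mult_ac)
      also have "\<dots> \<le> C * D"
        by (intro mult_left_mono D \<open>0 \<le> C\<close>)
      finally show ?thesis .
    qed
    then show ?thesis unfolding bounded_range_weighted by blast
  qed
qed (use assms in \<open>auto intro!: sum_closure.base\<close>)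

text \<open>Affine functions of one coordinate are closed under \<open>partial\<close>; one family
  thus yields scalar multiples (\<open>c = 0\<close>) and multiplication by a coordinate
  (\<open>d = 0\<close>).\<close>

lemma slowly_growing_affine: "slowly_growing (\<lambda>x::real^'n. c * complex_of_real (x $ i) + d)"
proof (rule slowly_growing_coinduct[where B = "{\<lambda>x. c * complex_of_real (x $ i) + d | c d. True}"])
  fix h :: "real^'n \<Rightarrow> complex"
  assume "h \<in> {\<lambda>x. c * complex_of_real (x $ i) + d | c d. True}"
  then obtain c d where h: "h = (\<lambda>x. c * complex_of_real (x $ i) + d)" by blast
  have D: "(h has_derivative (\<lambda>v. c * complex_of_real (v $ i))) (at x)" for x
    unfolding h by (auto intro!: derivative_eq_intros bounded_linear.has_derivative[OF bounded_linear_vec_nth])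
  show "h differentiable at x" for x using D differentiable_def by blast
  have "partial j h = (\<lambda>x. 0 * complex_of_real (x $ i) + c * complex_of_real (axis j 1 $ i))" for j
    by (rule ext, subst partial_eqI[OF D]) simp
  then show "partial j h \<in> {\<lambda>x. c * complex_of_real (x $ i) + d | c d. True}" for j
    by blast
  show "\<exists>k C. \<forall>x. cmod (h x) \<le> C * (1 + norm x) ^ k"
  proof (intro exI allI)
    fix x
    have "cmod (h x) \<le> cmod c * \<bar>x $ i\<bar> + cmod d"
      unfolding h by (rule order_trans[OF norm_triangle_ineq]) (simp add: norm_mult)
    also have "\<dots> \<le> cmod c * (1 + norm x) + cmod d * (1 + norm x)"
      by (intro add_mono mult_left_mono order_trans[OF component_le_norm_cart]) (auto simp: algebra_simps)
    finally show "cmod (h x) \<le> (cmod c + cmod d) * (1 + norm x) ^ 1" by (simp add: algebra_simps)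
  qed
qed blast

lemma schwartz_cmult: "\<psi> \<in> schwartz \<Longrightarrow> (\<lambda>x. c * \<psi> x) \<in> schwartz"
  using schwartz_mult_slowly_growing[OF slowly_growing_affine[of 0 undefined c]] by simp

lemma schwartz_linear: "\<phi> \<in> schwartz \<Longrightarrow> \<psi> \<in> schwartz \<Longrightarrow> (\<lambda>x. a * \<phi> x + b * \<psi> x) \<in> schwartz"
  by (intro schwartz_add schwartz_cmult)

lemma schwartz_zero: "(\<lambda>x. 0) \<in> schwartz"
  by (rule schwartz_coinduct[where B = "{\<lambda>x. 0}"])
    (auto intro!: sum_closure.base ext partial_eqI[THEN trans] derivative_eq_intros)

lemma schwartz_mult_component: "\<psi> \<in> schwartz \<Longrightarrow> (\<lambda>x. complex_of_real (x $ i) * \<psi> x) \<in> schwartz"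
  using schwartz_mult_slowly_growing[OF slowly_growing_affine[of 1 i 0]] by simp

lemma slowly_growing_character: "slowly_growing (\<lambda>x::real^'n. exp (\<i> * complex_of_real (a \<bullet> x)))"
proof (rule slowly_growing_coinduct[where B = "{\<lambda>x. c * exp (\<i> * complex_of_real (a \<bullet> x)) | c. True}"])
  fix h :: "real^'n \<Rightarrow> complex"
  assume "h \<in> {\<lambda>x. c * exp (\<i> * complex_of_real (a \<bullet> x)) | c. True}"
  then obtain c where h: "h = (\<lambda>x. c * exp (\<i> * complex_of_real (a \<bullet> x)))" by blast
  have D: "(h has_derivative (\<lambda>v. (c * \<i> * complex_of_real (a \<bullet> v)) * exp (\<i> * complex_of_real (a \<bullet> x)))) (at x)" for x
  proof -
    have "((\<lambda>x. \<i> * complex_of_real (a \<bullet> x)) has_derivative (\<lambda>v. \<i> * complex_of_real (a \<bullet> v))) (at x)"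
      by (auto intro!: derivative_eq_intros)
    from has_derivative_compose[OF this DERIV_exp[unfolded has_field_derivative_def]]
    show ?thesis
      unfolding h by (auto intro!: derivative_eq_intros simp: mult_ac)
  qed
  show "h differentiable at x" for x using D differentiable_def by blast
  have "partial j h = (\<lambda>x. (c * \<i> * complex_of_real (a \<bullet> axis j 1)) * exp (\<i> * complex_of_real (a \<bullet> x)))" for j
    by (rule ext, subst partial_eqI[OF D]) simp
  then show "partial j h \<in> {\<lambda>x. c * exp (\<i> * complex_of_real (a \<bullet> x)) | c. True}" for j
    by blast
  show "\<exists>k C. \<forall>x. cmod (h x) \<le> C * (1 + norm x) ^ k"
    by (intro exI[of _ 0] exI[of _ "cmod c"]) (simp add: h norm_mult)
qed (auto intro!: exI[of _ 1])

lemma schwartz_mult_character: "\<psi> \<in> schwartz \<Longrightarrow> (\<lambda>x. exp (\<i> * complex_of_real (a \<bullet> x)) * \<psi> x) \<in> schwartz"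
  by (rule schwartz_mult_slowly_growing[OF slowly_growing_character])

lemma schwartz_weighted_bounded:
  fixes \<phi> :: "real^'n \<Rightarrow> complex"
  shows "\<phi> \<in> schwartz \<Longrightarrow> bounded (range (\<lambda>x. (1 + norm x) ^ k *\<^sub>R \<phi> x))"
  unfolding bounded_range_weighted by (rule schwartz_bound) auto

lemma schwartz_cnj: "\<phi> \<in> schwartz \<Longrightarrow> (\<lambda>x. cnj (\<phi> x)) \<in> schwartz"
proof (rule schwartz_coinduct[where B = "{\<lambda>x. cnj (\<phi> x) | \<phi>. \<phi> \<in> schwartz}"])
  fix h :: "real^'n \<Rightarrow> complex"
  assume "h \<in> {\<lambda>x. cnj (\<phi> x) | \<phi>. \<phi> \<in> schwartz}"
  then obtain \<phi> where h: "h = (\<lambda>x. cnj (\<phi> x))" and \<phi>: "\<phi> \<in> schwartz" by auto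
  show "h differentiable at x" for x
    unfolding h using schwartz_differentiable[OF \<phi>, of x]
    by (auto simp: differentiable_def intro: has_derivative_cnj)
  have "partial i h = (\<lambda>x. cnj (partial i \<phi> x))" for i
    unfolding h by (rule ext, rule partial_linear_image[OF schwartz_differentiable[OF \<phi>] bounded_linear_cnj])
  then show "partial i h \<in> sum_closure {\<lambda>x. cnj (\<phi> x) | \<phi>. \<phi> \<in> schwartz}" for i
    using \<phi> schwartz_partial by (auto intro!: sum_closure.base)
  show "bounded (range (\<lambda>x. (1 + norm x) ^ k *\<^sub>R h x))" for k
    using schwartz_weighted_bounded[OF \<phi>, of k] unfolding bounded_range_weighted h by simp
qed (auto intro!: sum_closure.base)

lemma schwartz_uminus: "\<phi> \<in> schwartz \<Longrightarrow> (\<lambda>x. \<phi> (- x)) \<in> schwartz"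
proof (rule schwartz_coinduct[where B = "{\<lambda>x. \<phi> (- x) | \<phi>. \<phi> \<in> schwartz}"])
  fix h :: "real^'n \<Rightarrow> complex"
  assume "h \<in> {\<lambda>x. \<phi> (- x) | \<phi>. \<phi> \<in> schwartz}"
  then obtain \<phi> where h: "h = (\<lambda>x. \<phi> (- x))" and \<phi>: "\<phi> \<in> schwartz" by auto
  show "h differentiable at x" for x
    unfolding h
    by (rule differentiable_compose[of \<phi> uminus]) (auto intro: schwartz_differentiable[OF \<phi>])
  have "partial i h = (\<lambda>x. (\<lambda>y. (-1) * partial i \<phi> y) (- x))" for i
    unfolding h by (rule ext, subst partial_uminus[OF schwartz_differentiable[OF \<phi>]]) simp
  moreover have "(\<lambda>y. (-1) * partial i \<phi> y) \<in> schwartz" for i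
    by (intro schwartz_cmult schwartz_partial \<phi>)
  ultimately show "partial i h \<in> sum_closure {\<lambda>x. \<phi> (- x) | \<phi>. \<phi> \<in> schwartz}" for i
    by (auto intro!: sum_closure.base)
  show "bounded (range (\<lambda>x. (1 + norm x) ^ k *\<^sub>R h x))" for k
    using schwartz_weighted_bounded[OF \<phi>, of k] unfolding bounded_range_weighted h
    by (metis norm_minus_cancel)
qed (auto intro!: sum_closure.base)

lemma schwartz_sum: "(\<And>i. i \<in> I \<Longrightarrow> f i \<in> schwartz) \<Longrightarrow> (\<lambda>x. \<Sum>i\<in>I. f i x) \<in> schwartz"
proof (induction I rule: infinite_finite_induct)
  case (insert j I)
  have "f j \<in> schwartz" "(\<lambda>x. \<Sum>i\<in>I. f i x) \<in> schwartz" using insert by simp_all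
  from schwartz_add[OF this] show ?case using insert(1,2) by simp
qed (simp_all add: schwartz_zero)

subsection \<open>Integrability\<close>

text \<open>The exponent lets (1 + |x|)^2 dominate 1 + x_i^2 once for each coordinate, so the
  integrable product of the one-dimensional functions 1 / (1 + x_i^2) is a majorant.\<close>

definition decay :: "real^'n \<Rightarrow> real" where
  "decay x = inverse ((1 + norm x) ^ (2 * CARD('n)))"

lemma decay_pos: "0 < decay x"
  by (simp add: decay_def add_pos_nonneg)

lemma decay_borel [measurable]: "decay \<in> borel_measurable borel"
  unfolding decay_def by measurable

lemma integrable_decay: "integrable lborel (decay :: real^'n \<Rightarrow> real)"
proof (rule integrableI_bounded)
  have int1: "integrable lborel (\<lambda>x::real. inverse (1 + x\<^sup>2))"
    using integrable_inverse_1_plus_square by (simp add: set_integrable_def)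
  have "(\<integral>\<^sup>+x. norm (decay x) \<partial>(lborel :: (real^'n) measure))
      \<le> (\<integral>\<^sup>+x. (\<Prod>b\<in>Basis. ennreal (inverse (1 + (x \<bullet> b)\<^sup>2))) \<partial>(lborel :: (real^'n) measure))"
  proof (rule nn_integral_mono)
    fix x :: "real^'n"
    have "decay x = (\<Prod>b\<in>(Basis::(real^'n) set). inverse ((1 + norm x)\<^sup>2))"
      by (simp add: decay_def power_mult power_inverse)
    also have "\<dots> \<le> (\<Prod>b\<in>Basis. inverse (1 + (x \<bullet> b)\<^sup>2))"
    proof (intro prod_mono conjI le_imp_inverse_le)
      fix b :: "real^'n" assume "b \<in> Basis"
      then have "(x \<bullet> b)\<^sup>2 \<le> (norm x)\<^sup>2"
        by (metis Basis_le_norm abs_norm_cancel abs_le_square_iff)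
      moreover have "0 \<le> norm x" by simp
      ultimately show "1 + (x \<bullet> b)\<^sup>2 \<le> (1 + norm x)\<^sup>2"
        unfolding power2_sum by (simp add: add_increasing2)
    qed (auto simp: add_pos_nonneg)
    finally show "ennreal (norm (decay x)) \<le> (\<Prod>b\<in>Basis. ennreal (inverse (1 + (x \<bullet> b)\<^sup>2)))"
      using decay_pos[of x] by (subst prod_ennreal) (auto intro!: ennreal_leI)
  qed
  also have "\<dots> = (\<Prod>b\<in>(Basis::(real^'n) set). (\<integral>\<^sup>+x. ennreal (inverse (1 + x\<^sup>2)) \<partial>lborel))"
    by (rule nn_integral_lborel_prod) auto
  also have "\<dots> < \<infinity>"
    using int1 by (simp add: integrable_iff_bounded less_top[symmetric] ennreal_prod_eq_top del: prod_constant)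
  finally show "(\<integral>\<^sup>+x. norm (decay x) \<partial>(lborel :: (real^'n) measure)) < \<infinity>" .
qed simp

lemma schwartz_decay_bound:
  fixes \<phi> :: "real^'n \<Rightarrow> complex"
  assumes "\<phi> \<in> schwartz"
  obtains C where "0 \<le> C" "\<And>x. (1 + norm x) ^ k * cmod (\<phi> x) \<le> C * decay x"
proof -
  obtain C where C: "0 \<le> C" "\<And>x. (1 + norm x) ^ (k + 2 * CARD('n)) * cmod (\<phi> x) \<le> C"
    using schwartz_bound[OF assms] by metis
  have "(1 + norm x) ^ k * cmod (\<phi> x) \<le> C * decay x" for x
    using C(2)[of x] by (simp add: decay_def power_add field_simps add_pos_nonneg)
  with C(1) that show ?thesis by blast
qed

lemma schwartz_integrable_weighted:
  fixes \<phi> :: "real^'n \<Rightarrow> complex"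
  assumes "\<phi> \<in> schwartz"
  shows "integrable lborel (\<lambda>x. (1 + norm x) ^ k * cmod (\<phi> x))"
proof -
  obtain C where C: "0 \<le> C" "\<And>x. (1 + norm x) ^ k * cmod (\<phi> x) \<le> C * decay x"
    using schwartz_decay_bound[OF assms] by metis
  note [measurable] = schwartz_borel[OF assms]
  show ?thesis
    by (rule Bochner_Integration.integrable_bound[where f = "\<lambda>x. C * decay x"])
      (auto intro!: AE_I2 integrable_decay order_trans[OF C(2)])
qed

lemma schwartz_integrable:
  fixes \<phi> :: "real^'n \<Rightarrow> complex"
  assumes "\<phi> \<in> schwartz"
  shows "integrable lborel \<phi>"
  using schwartz_integrable_weighted[OF assms, of 0] schwartz_borel[OF assms]
  by (simp add: integrable_norm_iff)

subsection \<open>Test functions\<close>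

lemma test_funs_schwartz: "\<phi> \<in> test_funs \<Omega> \<Longrightarrow> \<phi> \<in> schwartz"
proof -
  assume \<phi>: "\<phi> \<in> test_funs \<Omega>"
  have "bounded (range (\<lambda>x. (1 + norm x) ^ k *\<^sub>R partials is \<phi> x))" for k "is"
  proof -
    let ?g = "\<lambda>x. (1 + norm x) ^ k *\<^sub>R partials is \<phi> x"
    have "compact (?g ` fun_supp \<phi>)"
      using \<phi> by (intro compact_continuous_image continuous_intros smooth_continuous_on smooth_partials)
        (auto simp: test_funs_def)
    moreover have "range ?g \<subseteq> insert 0 (?g ` fun_supp \<phi>)"
    proof
      fix y assume "y \<in> range ?g"
      then obtain x where y: "y = ?g x" by blast
      show "y \<in> insert 0 (?g ` fun_supp \<phi>)"
      proof (cases "x \<in> fun_supp \<phi>")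
        case False
        then have "partials is \<phi> x = 0"
          using fun_supp_partials not_in_fun_supp by blast
        then show ?thesis by (simp add: y)
      qed (auto simp: y)
    qed
    ultimately show ?thesis
      by (meson bounded_insert bounded_subset compact_imp_bounded)
  qed
  then show ?thesis using \<phi> by (simp add: schwartz_def test_funs_def)
qed

lemma test_funs_mono: "U \<subseteq> V \<Longrightarrow> test_funs U \<subseteq> test_funs V"
  by (auto simp: test_funs_def)

lemma test_funsI:
  assumes "smooth \<phi>" "compact K" "K \<subseteq> \<Omega>" "\<And>x. x \<notin> K \<Longrightarrow> \<phi> x = 0"
  shows "\<phi> \<in> test_funs \<Omega>"
proof -
  have "fun_supp \<phi> \<subseteq> K" by (rule fun_supp_subset) (use assms compact_imp_closed in auto)
  then show ?thesis
    using assms closed_fun_supp[of \<phi>] compact_Int_closed[of K "fun_supp \<phi>"]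
    by (auto simp: test_funs_def Int_absorb1)
qed

lemma test_funs_linear:
  assumes "\<phi> \<in> test_funs \<Omega>" "\<psi> \<in> test_funs \<Omega>"
  shows "(\<lambda>x. a * \<phi> x + b * \<psi> x) \<in> test_funs \<Omega>"
proof (rule test_funsI[where K = "fun_supp \<phi> \<union> fun_supp \<psi>"])
  show "smooth (\<lambda>x. a * \<phi> x + b * \<psi> x)"
    using assms by (intro smooth_add smooth_cmult) (auto simp: test_funs_def)
qed (use assms in \<open>auto simp: test_funs_def not_in_fun_supp\<close>)

lemma test_funs_zero: "(\<lambda>x. 0) \<in> test_funs \<Omega>"
  by (rule test_funsI[where K = "{}"]) (auto intro: smooth_const)

lemma test_conv_schwartz_conv:
  assumes "test_conv \<Omega> \<phi>s \<phi>"
  shows "schwartz_conv \<phi>s \<phi>"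
proof -
  obtain K where K: "compact K" "\<And>j. fun_supp (\<phi>s j) \<subseteq> K"
    and lim: "\<And>is. uniform_limit UNIV (\<lambda>j. partials is (\<phi>s j)) (partials is \<phi>) sequentially"
    using assms unfolding test_conv_def by blast
  obtain R where R: "\<And>x. x \<in> K \<Longrightarrow> norm x \<le> R"
    using compact_imp_bounded[OF K(1)] unfolding bounded_iff by blast
  have "uniform_limit UNIV (\<lambda>j x. (1 + norm x) ^ k *\<^sub>R partials is (\<phi>s j) x)
        (\<lambda>x. (1 + norm x) ^ k *\<^sub>R partials is \<phi> x) sequentially" for k "is"
  proof (rule uniform_limitI)
    fix e :: real assume "e > 0"
    define c where "c = (1 + \<bar>R\<bar>) ^ k"
    have "c > 0" by (simp add: c_def add_pos_nonneg)
    have off: "partials is (\<phi>s j) x = 0" if "x \<notin> K" for x j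
      using that K(2) fun_supp_partials not_in_fun_supp by blast
    \<comment> \<open>\<open>test_conv\<close> confines only the supports of the
      \<open>\<phi>s j\<close> to \<open>K\<close>; the limit vanishes off \<open>K\<close> as a
      pointwise limit.\<close>
    then have off': "partials is \<phi> x = 0" if "x \<notin> K" for x
      using tendsto_uniform_limitI[OF lim, of x "is"] that LIMSEQ_unique[OF _ tendsto_const] by auto
    from uniform_limitD[OF lim, of "e / c" "is"] \<open>e > 0\<close> \<open>c > 0\<close>
    have "\<forall>\<^sub>F j in sequentially. \<forall>x\<in>UNIV. dist (partials is (\<phi>s j) x) (partials is \<phi> x) < e / c" by simp
    then show "\<forall>\<^sub>F j in sequentially. \<forall>x\<in>UNIV. dist ((1 + norm x) ^ k *\<^sub>R partials is (\<phi>s j) x)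
      ((1 + norm x) ^ k *\<^sub>R partials is \<phi> x) < e"
    proof eventually_elim
      case (elim j)
      show ?case
      proof
        fix x
        show "dist ((1 + norm x) ^ k *\<^sub>R partials is (\<phi>s j) x) ((1 + norm x) ^ k *\<^sub>R partials is \<phi> x) < e"
        proof (cases "x \<in> K")
          case True
          have "(1 + norm x) ^ k \<le> c"
            unfolding c_def using R[OF True] by (intro power_mono) auto
          have "dist ((1 + norm x) ^ k *\<^sub>R partials is (\<phi>s j) x) ((1 + norm x) ^ k *\<^sub>R partials is \<phi> x)
            = (1 + norm x) ^ k * dist (partials is (\<phi>s j) x) (partials is \<phi> x)"
            by (simp add: dist_norm scaleR_diff_right[symmetric])
          also have "\<dots> \<le> c * dist (partials is (\<phi>s j) x) (partials is \<phi> x)"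
            by (intro mult_right_mono) (fact, simp)
          also have "\<dots> < e"
            using elim \<open>c > 0\<close> by (simp add: field_simps)
          finally show ?thesis .
        qed (use off off' \<open>e > 0\<close> in simp)
      qed
    qed
  qed
  then show ?thesis
    using assms test_funs_schwartz unfolding schwartz_conv_def test_conv_def by blast
qed

section \<open>The fundamental lemma of the calculus of variations\<close>

text \<open>Dynkin's argument: open boxes are stable under intersection and generate the Borel sets,
  and the sets with zero integral are closed under complements and disjoint countable
  unions.\<close>

lemma AE_zero_if_box_integrals_zero:
  fixes h :: "'a::euclidean_space \<Rightarrow> complex"
  assumes h: "integrable lborel h"
    and box: "\<And>a b. (LINT x:box a b|lborel. h x) = 0"
  shows "AE x in lborel. h x = 0"
proof (rule sigma_finite_measure.density_zero[OF sigma_finite_lborel h])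
  have int: "set_integrable lborel A h" if "A \<in> sets borel" for A
    using integrable_mult_indicator[of A lborel h] that h by (simp add: set_integrable_def)
  let ?A = "\<lambda>n::nat. box (- (real n *\<^sub>R One)) (real n *\<^sub>R One) :: 'a set"
  \<comment> \<open>The integral over the whole space, on which the complement step relies, is
    reached by exhausting the space by boxes.\<close>
  have "(\<lambda>n. (LINT x:?A n|lborel. h x)) \<longlonglongrightarrow> (LINT x:(\<Union>n. ?A n)|lborel. h x)"
  proof (rule set_integral_cont_up)
    show "incseq ?A"
      by (auto simp: incseq_def box_def intro: less_le_trans le_less_trans)
    show "set_integrable lborel (\<Union>n. ?A n) h" by (rule int) auto
  qed auto
  then have total: "(LINT x|lborel. h x) = 0"
    unfolding UN_box_eq_UNIV box LIMSEQ_const_iff by (simp add: set_lebesgue_integral_def)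
  fix A :: "'a set" assume "A \<in> sets lborel"
  then have A: "A \<in> sigma_sets UNIV (range (\<lambda>(a, b). box a b))"
    by (simp add: borel_eq_box)
  show "(LINT x:A|lborel. h x) = 0"
  proof (rule sigma_sets_induct_disjoint[OF _ _ A, where P = "\<lambda>A. (LINT x:A|lborel. h x) = 0"])
    show "Int_stable (range (\<lambda>(a, b). box a b :: 'a set))"
      by (auto simp: Int_stable_def box_Int_box)
    show "range (\<lambda>(a, b). box a b :: 'a set) \<subseteq> Pow UNIV" by auto
    show "(LINT x:A|lborel. h x) = 0" if "A \<in> range (\<lambda>(a, b). box a b :: 'a set)" for A
      using that box by auto
    show "(LINT x:{}|lborel. h x) = 0" by (simp add: set_lebesgue_integral_def)
    show "(LINT x:UNIV - A|lborel. h x) = 0"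
      if "A \<in> sigma_sets UNIV (range (\<lambda>(a, b). box a b :: 'a set))" "(LINT x:A|lborel. h x) = 0" for A
    proof -
      have A: "A \<in> sets borel" using that(1) by (simp add: borel_eq_box)
      have "(LINT x:A \<union> (UNIV - A)|lborel. h x) = (LINT x:A|lborel. h x) + (LINT x:UNIV - A|lborel. h x)"
        by (rule set_integral_Un) (use A in \<open>auto intro!: int\<close>)
      moreover have "A \<union> (UNIV - A) = UNIV" by auto
      ultimately show ?thesis using total that(2) by (simp add: set_lebesgue_integral_def)
    qed
    show "(LINT x:(\<Union>i. A i)|lborel. h x) = 0"
      if dis: "disjoint_family A" and A: "range A \<subseteq> sigma_sets UNIV (range (\<lambda>(a, b). box a b :: 'a set))"
        and z: "\<And>i. (LINT x:A i|lborel. h x) = 0" for A :: "nat \<Rightarrow> 'a set"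
    proof -
      have A': "A i \<in> sets borel" for i using A by (auto simp: borel_eq_box)
      have "(LINT x:(\<Union>i. A i)|lborel. h x) = (\<Sum>i. (LINT x:A i|lborel. h x))"
        by (rule lebesgue_integral_countable_add)
          (use A' dis in \<open>auto intro!: int simp: disjoint_family_on_def\<close>)
      then show ?thesis by (simp add: z)
    qed
  qed
qed

text \<open>The powers \<open>1 - (1 - bump)\<^sup>k\<close> of a bump function increase to the indicator of the box.\<close>

lemma fundamental_lemma:
  fixes f :: "real^'n \<Rightarrow> complex"
  assumes \<Omega>: "open \<Omega>"
    and int: "\<And>\<phi>. \<phi> \<in> test_funs \<Omega> \<Longrightarrow> integrable lborel (\<lambda>x. f x * cnj (\<phi> x))"
    and zero: "\<And>\<phi>. \<phi> \<in> test_funs \<Omega> \<Longrightarrow> (LINT x|lborel. f x * cnj (\<phi> x)) = 0"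
  shows "AE x in lborel. x \<in> \<Omega> \<longrightarrow> f x = 0"
proof -
  have on_box: "AE x in lborel. x \<in> cbox c d \<longrightarrow> f x = 0" if sub: "cbox c d \<subseteq> \<Omega>" for c d :: "real^'n"
  proof -
    \<comment> \<open>\<open>f\<close> is integrable only against test functions; one bump as a
      factor makes it integrable on the whole space, and that bump is positive inside the
      box.\<close>
    define h where "h x = f x * complex_of_real (bump c d x)" for x
    have test: "(\<lambda>x. complex_of_real (bump c d x) * g x) \<in> test_funs \<Omega>" if "smooth g" for g
    proof (rule test_funsI[of _ "cbox c d"])
      show "complex_of_real (bump c d x) * g x = 0" if "x \<notin> cbox c d" for x
        using that fun_supp_bump not_in_fun_supp[of x "\<lambda>x. complex_of_real (bump c d x)"] by auto
    qed (use sub that in \<open>auto intro!: smooth_mult smooth_bump\<close>)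
    have h: "integrable lborel h"
      using int[OF test[OF smooth_const[of 1]]] by (simp add: h_def[abs_def])
    have "(LINT x:box a b|lborel. h x) = 0" for a b
    proof -
      define g where "g k x = 1 - (1 - complex_of_real (bump a b x)) ^ k" for k x
      have g_real: "g k x = complex_of_real (1 - (1 - bump a b x) ^ k)" for k x
        by (simp add: g_def)
      have "smooth (g k)" for k
        unfolding g_def by (intro smooth_diff smooth_const smooth_power smooth_bump)
      then have "(LINT x|lborel. h x * g k x) = 0" for k
        using zero[OF test[of "g k"]] by (simp add: h_def g_real mult_ac)
      moreover have "(\<lambda>k. LINT x|lborel. h x * g k x) \<longlonglongrightarrow> (LINT x|lborel. indicator (box a b) x *\<^sub>R h x)"
      proof (rule integral_dominated_convergence[where w = "\<lambda>x. norm (h x)"])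
        show "AE x in lborel. norm (h x * g k x) \<le> norm (h x)" for k
        proof (rule AE_I2)
          fix x
          have "0 \<le> (1 - bump a b x) ^ k" "(1 - bump a b x) ^ k \<le> 1"
            using bump_range[of a b x] by (auto intro: power_le_one)
          then have "norm (g k x) \<le> 1" unfolding g_real norm_of_real by simp
          then show "norm (h x * g k x) \<le> norm (h x)"
            using mult_left_mono[of "norm (g k x)" 1 "norm (h x)"] by (simp add: norm_mult)
        qed
        show "AE x in lborel. (\<lambda>k. h x * g k x) \<longlonglongrightarrow> indicator (box a b) x *\<^sub>R h x"
        proof (rule AE_I2)
          fix x
          have "(\<lambda>k. (1 - bump a b x) ^ k) \<longlonglongrightarrow> (if x \<in> box a b then 0 else 1)"
            using bump_range[of a b x] bump_pos_iff[of a b x]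
            by (auto intro!: LIMSEQ_power_zero)
          then have "(\<lambda>k. g k x) \<longlonglongrightarrow> complex_of_real (1 - (if x \<in> box a b then 0 else 1))"
            unfolding g_real by (intro tendsto_intros)
          from tendsto_mult[OF tendsto_const[of "h x"] this]
          show "(\<lambda>k. h x * g k x) \<longlonglongrightarrow> indicator (box a b) x *\<^sub>R h x"
            by (auto split: if_splits)
        qed
        show "(\<lambda>x. h x * g k x) \<in> borel_measurable lborel" for k
          using h smooth_borel[OF \<open>smooth (g k)\<close>] by measurable
      qed (use h in \<open>auto\<close>)
      ultimately show ?thesis
        by (simp add: set_lebesgue_integral_def LIMSEQ_const_iff)
    qed
    from AE_zero_if_box_integrals_zero[OF h this]
    have "AE x in lborel. h x = 0" .
    \<comment> \<open>The bump vanishes on the faces of the box, so these are discarded as a null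
      set.\<close>
    moreover have "AE x in lborel. x \<notin> cbox c d - box c d"
      using null_sets_cbox_Diff_box by (rule AE_not_in)
    ultimately show ?thesis
    proof eventually_elim
      case (elim x)
      then show ?case using bump_pos_iff[of c d x] by (auto simp: h_def)
    qed
  qed
  obtain \<D> where \<D>: "countable \<D>" "\<D> \<subseteq> Pow \<Omega>" "\<And>X. X \<in> \<D> \<Longrightarrow> \<exists>a b. X = cbox a b" "\<Union>\<D> = \<Omega>"
    using open_countable_Union_open_cbox[OF \<Omega>] by metis
  have "AE x in lborel. \<forall>X\<in>\<D>. x \<in> X \<longrightarrow> f x = 0"
    unfolding AE_ball_countable[OF \<D>(1)]
  proof
    fix X assume "X \<in> \<D>"
    then obtain a b where "X = cbox a b" "X \<subseteq> \<Omega>" using \<D> by blast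
    then show "AE x in lborel. x \<in> X \<longrightarrow> f x = 0" using on_box by simp
  qed
  then show ?thesis by eventually_elim (use \<D>(4) in blast)
qed

section \<open>Antilinear functionals and their supports, by a partition of unity\<close>

lemma antilinear_onD:
  assumes "antilinear_on X u" "\<phi> \<in> X" "\<psi> \<in> X"
  shows "u (\<lambda>x. a * \<phi> x + b * \<psi> x) = cnj a * u \<phi> + cnj b * u \<psi>"
  using assms by (simp add: antilinear_on_def)

lemma antilinear_on_zero:
  assumes "antilinear_on X u" "(\<lambda>x. 0) \<in> X"
  shows "u (\<lambda>x. 0) = 0"
  using antilinear_onD[OF assms(1,2,2), of 0 0] by simp

lemma antilinear_on_sum:
  assumes u: "antilinear_on schwartz u" and f: "\<And>i. i \<in> I \<Longrightarrow> f i \<in> schwartz"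
  shows "u (\<lambda>x. \<Sum>i\<in>I. f i x) = (\<Sum>i\<in>I. u (f i))"
  using f
proof (induction I rule: infinite_finite_induct)
  case (insert j I)
  have "f j \<in> schwartz" "(\<lambda>x. \<Sum>i\<in>I. f i x) \<in> schwartz"
    using insert.prems by (auto intro: schwartz_sum)
  from antilinear_onD[OF u this, of 1 1]
  show ?case using insert by simp
qed (use antilinear_on_zero[OF u schwartz_zero] in auto)

text \<open>The complement of the support is merely a union of open sets on each of which
  \<open>u\<close> vanishes. To reach test functions of the whole union, \<phi> is cut into finitely
  many pieces, each supported in one of these sets.\<close>

lemma vanishes_off_dist_supp:
  assumes u: "antilinear_on schwartz u" and \<phi>: "\<phi> \<in> test_funs (- dist_supp u)"
  shows "u \<phi> = 0"
proof -
  let ?K = "fun_supp \<phi>"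
  define G where "G = {U. open U \<and> (\<forall>\<phi>\<in>test_funs U. u \<phi> = 0)}"
  have K: "compact ?K" "?K \<subseteq> \<Union>G" "smooth \<phi>"
    using \<phi> by (auto simp: test_funs_def dist_supp_def G_def)
  have "\<exists>p. x \<in> box (fst p) (snd p) \<and> (\<exists>U\<in>G. cbox (fst p) (snd p) \<subseteq> U)" if x: "x \<in> ?K" for x
  proof -
    obtain U where "U \<in> G" "x \<in> U" using x K by auto
    moreover obtain a b where "cbox a b \<subseteq> U" "x \<in> box a b"
      using open_contains_cbox[of U x] \<open>U \<in> G\<close> \<open>x \<in> U\<close> unfolding G_def mem_Collect_eq by metis
    ultimately show ?thesis by (intro exI[of _ "(a, b)"] conjI bexI[of _ U]) simp_all
  qed
  then obtain p where p: "\<And>x. x \<in> ?K \<Longrightarrow> x \<in> box (fst (p x)) (snd (p x))"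
    "\<And>x. x \<in> ?K \<Longrightarrow> \<exists>U\<in>G. cbox (fst (p x)) (snd (p x)) \<subseteq> U"
    by metis
  have "?K \<subseteq> (\<Union>x\<in>?K. box (fst (p x)) (snd (p x)))" using p(1) by blast
  then obtain F where F: "F \<subseteq> ?K" "finite F" "?K \<subseteq> (\<Union>x\<in>F. box (fst (p x)) (snd (p x)))"
    using compactE_image[OF K(1), of ?K "\<lambda>x. box (fst (p x)) (snd (p x))"] by auto
  define b where "b y = (\<lambda>x. complex_of_real (bump (fst (p y)) (snd (p y)) x))" for y
  \<comment> \<open>The pieces are b_y \<phi> / B. As \<open>B\<close> is positive on the support of
    \<phi>, they are smooth and add up to \<phi>, and each of them lives in a single closed
    box.\<close>
  define B where "B x = (\<Sum>y\<in>F. b y x)" for x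
  have B_nz: "B x \<noteq> 0" if x: "x \<in> ?K" for x
  proof -
    obtain y where "y \<in> F" "x \<in> box (fst (p y)) (snd (p y))" using F(3) x by blast
    then have "0 < (\<Sum>y\<in>F. bump (fst (p y)) (snd (p y)) x)"
      using F(2) bump_pos_iff by (intro sum_pos2[of F y]) (auto simp: bump_range)
    then show ?thesis unfolding B_def b_def of_real_sum[symmetric] of_real_eq_0_iff by linarith
  qed
  have sm: "smooth (\<lambda>x. b y x * \<phi> x / B x)" for y
  proof (rule smooth_divide)
    show "smooth (\<lambda>x. b y x * \<phi> x)" unfolding b_def by (intro smooth_mult smooth_bump K)
    show "smooth B" unfolding B_def b_def by (intro smooth_sum smooth_bump)
    show "B x \<noteq> 0" if "x \<in> fun_supp (\<lambda>x. b y x * \<phi> x)" for x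
      using that fun_supp_mono[of \<phi> "\<lambda>x. b y x * \<phi> x"] B_nz by auto
  qed
  have test: "(\<lambda>x. b y x * \<phi> x / B x) \<in> test_funs U" if "cbox (fst (p y)) (snd (p y)) \<subseteq> U" for y U
  proof (rule test_funsI[OF sm])
    show "compact (?K \<inter> cbox (fst (p y)) (snd (p y)))" using K(1) by auto
    show "b y x * \<phi> x / B x = 0" if "x \<notin> ?K \<inter> cbox (fst (p y)) (snd (p y))" for x
      using that fun_supp_bump not_in_fun_supp[of x \<phi>]
        not_in_fun_supp[of x "\<lambda>x. complex_of_real (bump (fst (p y)) (snd (p y)) x)"]
      by (auto simp: b_def)
  qed (use that in auto)
  have eq: "\<phi> x = (\<Sum>y\<in>F. b y x * \<phi> x / B x)" for x
  proof (cases "x \<in> ?K")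
    case True
    have "(\<Sum>y\<in>F. b y x * \<phi> x / B x) = B x * \<phi> x / B x"
      by (simp add: B_def sum_distrib_right sum_divide_distrib)
    then show ?thesis using B_nz[OF True] by simp
  qed (simp add: not_in_fun_supp)
  have "u \<phi> = u (\<lambda>x. \<Sum>y\<in>F. b y x * \<phi> x / B x)" using eq by presburger
  also have "\<dots> = (\<Sum>y\<in>F. u (\<lambda>x. b y x * \<phi> x / B x))"
    by (rule antilinear_on_sum[OF u test_funs_schwartz[OF test[OF subset_UNIV]]])
  also have "\<dots> = 0"
  proof (rule sum.neutral, rule)
    fix y assume "y \<in> F"
    then obtain U where "U \<in> G" "cbox (fst (p y)) (snd (p y)) \<subseteq> U" using p(2) F(1) by blast
    then show "u (\<lambda>x. b y x * \<phi> x / B x) = 0" using test unfolding G_def by blast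
  qed
  finally show ?thesis .
qed

section \<open>The Fourier transform of Schwartz functions\<close>

subsection \<open>Affine substitutions and products\<close>

lemma lborel_integral_affine:
  fixes f :: "'a::euclidean_space \<Rightarrow> complex"
  assumes [measurable]: "f \<in> borel_measurable borel" and "c > 0"
  shows "(LINT x|lborel. f (t + c *\<^sub>R x)) = (LINT x|lborel. f x) / c ^ DIM('a)"
proof -
  have "(LINT x|lborel. f x) = (LINT x|density (distr lborel borel (\<lambda>x. t + c *\<^sub>R x)) (\<lambda>_. ennreal (\<bar>c\<bar> ^ DIM('a))). f x)"
    using lborel_affine[of c t] \<open>c > 0\<close> by simp
  also have "\<dots> = c ^ DIM('a) *\<^sub>R (LINT x|lborel. f (t + c *\<^sub>R x))"
    using \<open>c > 0\<close> by (subst integral_density) (auto simp: integral_distr)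
  finally show ?thesis using \<open>c > 0\<close> by (simp add: scaleR_conv_of_real)
qed

lemma lborel_integrable_affine:
  fixes f :: "'a::euclidean_space \<Rightarrow> 'b::{banach,second_countable_topology}"
  assumes f: "integrable lborel f" and "c > 0"
  shows "integrable lborel (\<lambda>x. f (t + c *\<^sub>R x))"
proof -
  have [measurable]: "f \<in> borel_measurable borel" using f by auto
  have "integrable (density (distr lborel borel (\<lambda>x. t + c *\<^sub>R x)) (\<lambda>_. ennreal (\<bar>c\<bar> ^ DIM('a)))) f"
    using lborel_affine[of c t] \<open>c > 0\<close> f by simp
  then have "integrable lborel (\<lambda>x. c ^ DIM('a) *\<^sub>R f (t + c *\<^sub>R x))"
    using \<open>c > 0\<close> by (subst (asm) integrable_density) (auto simp: integrable_distr_eq)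
  from integrable_scaleR_right[OF this, of "inverse (c ^ DIM('a))"] show ?thesis
    using \<open>c > 0\<close> by simp
qed

lemma lborel_integral_shift:
  fixes f :: "'a::euclidean_space \<Rightarrow> complex"
  assumes "f \<in> borel_measurable borel"
  shows "(LINT x|lborel. f (x + t)) = (LINT x|lborel. f x)"
  using lborel_integral_affine[OF assms, of 1 t] by (simp add: add.commute)

lemma lborel_integrable_shift:
  fixes f :: "'a::euclidean_space \<Rightarrow> 'b::{banach,second_countable_topology}"
  assumes "integrable lborel f"
  shows "integrable lborel (\<lambda>x. f (x + t))"
  using lborel_integrable_affine[OF assms, of 1 t] by (simp add: add.commute)

lemma lborel_distr_uminus_euclidean: "distr lborel borel uminus = (lborel :: 'a::euclidean_space measure)"
proof -
  have "lborel = density (distr lborel borel (\<lambda>x::'a. 0 + (-1) *\<^sub>R x)) (\<lambda>_. ennreal (\<bar>-1\<bar>^DIM('a)))"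
    by (rule lborel_affine) auto
  then show ?thesis by (simp add: density_1)
qed

lemma lborel_integral_uminus:
  fixes f :: "'a::euclidean_space \<Rightarrow> complex"
  assumes [measurable]: "f \<in> borel_measurable borel"
  shows "(LINT x|lborel. f (- x)) = (LINT x|lborel. f x)"
  by (subst lborel_distr_uminus_euclidean[symmetric]) (simp add: integral_distr)

lemma
  fixes f :: "'a::euclidean_space \<Rightarrow> real \<Rightarrow> complex"
  assumes f: "\<And>b. b \<in> Basis \<Longrightarrow> integrable lborel (f b)"
  shows lborel_integrable_basis_prod: "integrable lborel (\<lambda>x. \<Prod>b\<in>Basis. f b (x \<bullet> b))" (is ?A)
    and lborel_integral_basis_prod:
      "(LINT x|lborel. (\<Prod>b\<in>Basis. f b (x \<bullet> b))) = (\<Prod>b\<in>Basis. (LINT x|lborel. f b x))" (is ?B)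
proof -
  interpret product_sigma_finite "\<lambda>_::'a. lborel :: real measure" ..
  have meas[measurable]: "b \<in> Basis \<Longrightarrow> f b \<in> borel_measurable borel" for b using f[of b] by auto
  have *: "(\<lambda>x. \<Prod>b\<in>Basis. f b (x \<bullet> b)) \<in> borel_measurable borel"
    by measurable
  have T: "(\<lambda>g. \<Sum>b\<in>Basis. g b *\<^sub>R b) \<in> Pi\<^sub>M Basis (\<lambda>_. lborel) \<rightarrow>\<^sub>M (borel :: 'a measure)"
    by measurable
  have eq: "(\<Prod>b\<in>Basis. f b ((\<Sum>b\<in>Basis. g b *\<^sub>R b) \<bullet> b)) = (\<Prod>b\<in>Basis. f b (g b))" for g :: "'a \<Rightarrow> real"
    by (rule prod.cong) auto
  have int: "integrable (Pi\<^sub>M Basis (\<lambda>_. lborel)) (\<lambda>g. \<Prod>b\<in>Basis. f b (g b))"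
    by (rule product_integrable_prod) (use f in auto)
  show ?A
    by (subst lborel_eq) (simp add: integrable_distr_eq[OF T *] eq int)
  have "(LINT x|lborel. (\<Prod>b\<in>Basis. f b (x \<bullet> b))) = (LINT g|Pi\<^sub>M Basis (\<lambda>_. lborel). (\<Prod>b\<in>Basis. f b (g b)))"
    by (subst lborel_eq) (simp add: integral_distr[OF T *] eq)
  also have "\<dots> = (\<Prod>b\<in>Basis. (LINT x|lborel. f b x))"
    by (rule product_integral_prod) (use f in auto)
  finally show ?B .
qed

subsection \<open>Schwartz functions are mapped to Schwartz functions\<close>

definition fourier_const :: "'n::finite itself \<Rightarrow> real" where
  "fourier_const _ = (2 * pi) powr (- real CARD('n) / 2)"

lemma fourier_eq:
  fixes u :: "real^'n \<Rightarrow> complex"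
  shows "fourier u \<xi> = complex_of_real (fourier_const TYPE('n)) * (LINT x|lborel. iexp (- (\<xi> \<bullet> x)) * u x)"
  by (simp add: fourier_def fourier_const_def)

lemma fourier_const_pos: "0 < fourier_const TYPE('n::finite)"
  by (simp add: fourier_const_def)

lemma integrable_character_mult:
  fixes u :: "real^'n \<Rightarrow> complex"
  assumes "integrable lborel u"
  shows "integrable lborel (\<lambda>x. iexp (\<xi> \<bullet> x) * u x)" "integrable lborel (\<lambda>x. iexp (- (\<xi> \<bullet> x)) * u x)"
proof -
  have [measurable]: "u \<in> borel_measurable borel" using assms by auto
  show "integrable lborel (\<lambda>x. iexp (\<xi> \<bullet> x) * u x)" "integrable lborel (\<lambda>x. iexp (- (\<xi> \<bullet> x)) * u x)"
    by (auto intro!: Bochner_Integration.integrable_bound[OF assms] simp: norm_mult)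
qed

lemma norm_fourier_le:
  fixes u :: "real^'n \<Rightarrow> complex"
  shows "norm (fourier u \<xi>) \<le> fourier_const TYPE('n) * (LINT x|lborel. norm (u x))"
  unfolding fourier_eq norm_mult norm_of_real using fourier_const_pos[where 'n = 'n]
  by (auto intro!: mult_left_mono order_trans[OF integral_norm_bound] simp: norm_mult)

text \<open>Differentiation under the integral: the first-order remainder of exp (-i h.x) is at most
  |h.x|^2, so the error is bounded by |h|^2 times the integral of |x|^2 |\<phi>|, which is finite
  for Schwartz functions.\<close>

lemma fourier_has_derivative:
  fixes \<phi> :: "real^'n \<Rightarrow> complex"
  assumes \<phi>: "\<phi> \<in> schwartz"
  shows "(fourier \<phi> has_derivative (\<lambda>h. complex_of_real (fourier_const TYPE('n)) *
     (LINT x|lborel. iexp (- (\<xi> \<bullet> x)) * (- \<i> * complex_of_real (h \<bullet> x) * \<phi> x)))) (at \<xi>)"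
proof -
  let ?D = "\<lambda>h. LINT x|lborel. iexp (- (\<xi> \<bullet> x)) * (- \<i> * complex_of_real (h \<bullet> x) * \<phi> x)"
  note [measurable] = schwartz_borel[OF \<phi>]
  have int\<phi>: "integrable lborel \<phi>" by (rule schwartz_integrable[OF \<phi>])
  have w1: "integrable lborel (\<lambda>x. norm x * cmod (\<phi> x))"
    by (rule Bochner_Integration.integrable_bound[OF schwartz_integrable_weighted[OF \<phi>, of 1]])
      (auto intro!: mult_right_mono)
  have w2: "integrable lborel (\<lambda>x. (norm x)\<^sup>2 * cmod (\<phi> x))"
    by (rule Bochner_Integration.integrable_bound[OF schwartz_integrable_weighted[OF \<phi>, of 2]])
      (auto intro!: mult_right_mono power_mono)
  have bound_D: "cmod (iexp (- (\<xi> \<bullet> x)) * (- \<i> * complex_of_real (h \<bullet> x) * \<phi> x)) \<le> norm h * (norm x * cmod (\<phi> x))" for h x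
    using Cauchy_Schwarz_ineq2[of h x] by (simp add: norm_mult mult_right_mono mult.assoc[symmetric])
  have intD: "integrable lborel (\<lambda>x. iexp (- (\<xi> \<bullet> x)) * (- \<i> * complex_of_real (h \<bullet> x) * \<phi> x))" for h
    by (rule Bochner_Integration.integrable_bound[OF integrable_mult_right[OF w1, of "norm h"]])
      (measurable, rule AE_I2, unfold real_norm_def, rule order_trans[OF bound_D abs_ge_self])
  have bl: "bounded_linear ?D"
  proof (rule bounded_linear_intro[where K = "LINT x|lborel. norm x * cmod (\<phi> x)"])
    show "?D (h + k) = ?D h + ?D k" for h k
      unfolding Bochner_Integration.integral_add[OF intD intD, symmetric]
      by (intro Bochner_Integration.integral_cong) (simp_all add: inner_add_left algebra_simps)
    show "?D (r *\<^sub>R h) = r *\<^sub>R ?D h" for r h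
      unfolding integral_scaleR_right[symmetric]
      by (intro Bochner_Integration.integral_cong) (simp_all add: scaleR_conv_of_real[where 'a = complex] mult_ac)
    show "norm (?D h) \<le> norm h * (LINT x|lborel. norm x * cmod (\<phi> x))" for h
      by (subst integral_mult_right_zero[symmetric], rule order_trans[OF integral_norm_bound])
        (intro integral_mono integrable_mult_right w1 integrable_norm intD bound_D)
  qed
  have "((\<lambda>\<xi>. LINT x|lborel. iexp (- (\<xi> \<bullet> x)) * \<phi> x) has_derivative ?D) (at \<xi>)"
  proof (rule has_derivativeI_sandwich[where e = 1 and H = "\<lambda>y. norm (y - \<xi>) * (LINT x|lborel. (norm x)\<^sup>2 * cmod (\<phi> x))"])
    show "((\<lambda>y. norm (y - \<xi>) * (LINT x|lborel. (norm x)\<^sup>2 * cmod (\<phi> x))) \<longlongrightarrow> 0) (at \<xi>)"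
      by (auto intro!: tendsto_eq_intros)
    fix y assume "y \<noteq> \<xi>"
    define h where "h = y - \<xi>"
    have "h \<noteq> 0" using \<open>y \<noteq> \<xi>\<close> by (simp add: h_def)
    have "(LINT x|lborel. iexp (- (y \<bullet> x)) * \<phi> x) - (LINT x|lborel. iexp (- (\<xi> \<bullet> x)) * \<phi> x) - ?D h
      = (LINT x|lborel. iexp (- (y \<bullet> x)) * \<phi> x - iexp (- (\<xi> \<bullet> x)) * \<phi> x
           - iexp (- (\<xi> \<bullet> x)) * (- \<i> * complex_of_real (h \<bullet> x) * \<phi> x))"
      by (subst Bochner_Integration.integral_diff, (intro Bochner_Integration.integrable_diff integrable_character_mult int\<phi> intD)+)
        (subst Bochner_Integration.integral_diff, (intro integrable_character_mult int\<phi>)+, simp)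
    also have "norm \<dots> \<le> (LINT x|lborel. (norm h)\<^sup>2 * ((norm x)\<^sup>2 * cmod (\<phi> x)))"
    proof (rule order_trans[OF integral_norm_bound], rule integral_mono)
      fix x
      have "iexp (- (y \<bullet> x)) = iexp (- (\<xi> \<bullet> x)) * iexp (- (h \<bullet> x))"
        by (simp add: h_def inner_diff_left exp_add[symmetric] algebra_simps)
      then have "iexp (- (y \<bullet> x)) * \<phi> x - iexp (- (\<xi> \<bullet> x)) * \<phi> x
           - iexp (- (\<xi> \<bullet> x)) * (- \<i> * complex_of_real (h \<bullet> x) * \<phi> x)
        = iexp (- (\<xi> \<bullet> x)) * (iexp (- (h \<bullet> x)) - (\<Sum>k\<le>1. (\<i> * complex_of_real (- (h \<bullet> x)))^k / fact k)) * \<phi> x"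
        by (simp add: algebra_simps)
      then have "cmod (iexp (- (y \<bullet> x)) * \<phi> x - iexp (- (\<xi> \<bullet> x)) * \<phi> x
           - iexp (- (\<xi> \<bullet> x)) * (- \<i> * complex_of_real (h \<bullet> x) * \<phi> x))
        = cmod (iexp (- (h \<bullet> x)) - (\<Sum>k\<le>1. (\<i> * complex_of_real (- (h \<bullet> x)))^k / fact k)) * cmod (\<phi> x)"
        by (simp only: norm_mult norm_exp_i_times)
      also have "\<dots> \<le> (h \<bullet> x)\<^sup>2 * cmod (\<phi> x)"
      proof (rule mult_right_mono)
        show "cmod (iexp (- (h \<bullet> x)) - (\<Sum>k\<le>1. (\<i> * complex_of_real (- (h \<bullet> x)))^k / fact k)) \<le> (h \<bullet> x)\<^sup>2"
          using iexp_approx1[of "- (h \<bullet> x)" 1]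
          by (rule order_trans) (simp add: power2_eq_square abs_mult[symmetric])
      qed simp
      also have "\<dots> \<le> (norm h)\<^sup>2 * ((norm x)\<^sup>2 * cmod (\<phi> x))"
      proof -
        have "(h \<bullet> x)\<^sup>2 \<le> (norm h * norm x)\<^sup>2"
          using Cauchy_Schwarz_ineq2[of h x] abs_le_square_iff[of "h \<bullet> x" "norm h * norm x"] by simp
        then show ?thesis
          by (simp add: power_mult_distrib mult.assoc[symmetric] mult_right_mono)
      qed
      finally show "cmod (iexp (- (y \<bullet> x)) * \<phi> x - iexp (- (\<xi> \<bullet> x)) * \<phi> x
           - iexp (- (\<xi> \<bullet> x)) * (- \<i> * complex_of_real (h \<bullet> x) * \<phi> x)) \<le> (norm h)\<^sup>2 * ((norm x)\<^sup>2 * cmod (\<phi> x))" .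
    qed (intro integrable_norm Bochner_Integration.integrable_diff integrable_character_mult int\<phi> intD integrable_mult_right w2)+
    finally show "norm ((LINT x|lborel. iexp (- (y \<bullet> x)) * \<phi> x) - (LINT x|lborel. iexp (- (\<xi> \<bullet> x)) * \<phi> x) - ?D (y - \<xi>)) / norm (y - \<xi>)
        \<le> norm (y - \<xi>) * (LINT x|lborel. (norm x)\<^sup>2 * cmod (\<phi> x))"
      using \<open>h \<noteq> 0\<close> unfolding h_def[symmetric] integral_mult_right_zero
      by (simp add: pos_divide_le_eq power2_eq_square mult_ac)
  qed (use bl in auto)
  then show ?thesis
    unfolding fourier_eq[abs_def] by (rule has_derivative_mult_right)
qed

lemma partial_fourier:
  fixes \<phi> :: "real^'n \<Rightarrow> complex"
  assumes "\<phi> \<in> schwartz"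
  shows "partial i (fourier \<phi>) = fourier (\<lambda>x. - \<i> * (complex_of_real (x $ i) * \<phi> x))"
  by (rule ext, subst partial_eqI[OF fourier_has_derivative[OF assms]])
    (simp add: fourier_eq inner_axis' mult.assoc)

text \<open>By translation invariance every difference quotient has integral 0, and dominated
  convergence passes to the derivative.\<close>

lemma schwartz_integral_partial:
  fixes \<psi> :: "real^'n \<Rightarrow> complex"
  assumes \<psi>: "\<psi> \<in> schwartz"
  shows "(LINT x|lborel. partial i \<psi> x) = 0"
proof -
  let ?e = "axis i 1 :: real^'n"
  define t where "t k = inverse (real (Suc k))" for k
  have t: "0 < t k" "t k \<le> 1" for k by (auto simp: t_def inverse_le_1_iff)
  define q where "q k x = (\<psi> (x + t k *\<^sub>R ?e) - \<psi> x) / complex_of_real (t k)" for k x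
  note [measurable] = schwartz_borel[OF \<psi>] schwartz_borel[OF schwartz_partial[OF \<psi>]]
  obtain C where C: "0 \<le> C" "\<And>x. cmod (partial i \<psi> x) \<le> C * decay x"
    using schwartz_decay_bound[OF schwartz_partial[OF \<psi>], of 0] by (metis mult_1 power_0)
  have D: "((\<lambda>\<tau>. \<psi> (x + \<tau> *\<^sub>R ?e)) has_vector_derivative partial i \<psi> (x + \<tau> *\<^sub>R ?e)) (at \<tau> within S)" for x \<tau> S
  proof -
    have "((\<lambda>\<tau>. x + \<tau> *\<^sub>R ?e) has_derivative (\<lambda>h. h *\<^sub>R ?e)) (at \<tau> within S)"
      by (auto intro!: derivative_eq_intros)
    from has_derivative_compose[OF this smooth_has_derivative[OF schwartz_smooth[OF \<psi>]]]
    show ?thesis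
      using linear_frechet_derivative[OF schwartz_differentiable[OF \<psi>]]
      by (simp add: has_vector_derivative_def partial_def linear_cmul)
  qed
  \<comment> \<open>A shift of length at most 1 changes 1 + |x| by a factor of at most 2. The mean
    value bound, taken at intermediate points, thus yields one integrable majorant for all the
    quotients.\<close>
  have decay_shift: "decay (x + \<tau> *\<^sub>R ?e) \<le> 2 ^ (2 * CARD('n)) * decay x" if "0 \<le> \<tau>" "\<tau> \<le> 1" for x \<tau>
  proof -
    have "norm x \<le> norm (x + \<tau> *\<^sub>R ?e) + norm (\<tau> *\<^sub>R ?e)"
      using norm_triangle_ineq4[of "x + \<tau> *\<^sub>R ?e" "\<tau> *\<^sub>R ?e"] by simp
    then have "1 + norm x \<le> 2 * (1 + norm (x + \<tau> *\<^sub>R ?e))"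
    proof -
      have "norm (\<tau> *\<^sub>R ?e) \<le> 1" using that by simp
      moreover have "1 + a \<le> 2 * (1 + b)" if "a \<le> b + c" "c \<le> 1" "0 \<le> b" for a b c :: real
        using that by (simp add: algebra_simps)
      ultimately show ?thesis using \<open>norm x \<le> _\<close> norm_ge_zero by blast
    qed
    then have "(1 + norm x) ^ (2 * CARD('n)) \<le> (2 * (1 + norm (x + \<tau> *\<^sub>R ?e))) ^ (2 * CARD('n))"
      by (intro power_mono) auto
    then show ?thesis unfolding power_mult_distrib decay_def
      by (simp add: field_simps add_pos_nonneg)
  qed
  have q_bound: "cmod (q k x) \<le> C * 2 ^ (2 * CARD('n)) * decay x" for k x
  proof -
    have "norm (\<psi> (x + t k *\<^sub>R ?e) - \<psi> (x + 0 *\<^sub>R ?e)) \<le> C * 2 ^ (2 * CARD('n)) * decay x * norm (t k - 0)"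
    proof (rule differentiable_bound[where S = "{0..t k}" and f' = "\<lambda>\<tau> h. h *\<^sub>R partial i \<psi> (x + \<tau> *\<^sub>R ?e)"])
      fix \<tau> assume "\<tau> \<in> {0..t k}"
      then have "cmod (partial i \<psi> (x + \<tau> *\<^sub>R ?e)) \<le> C * (2 ^ (2 * CARD('n)) * decay x)"
        using t[of k] by (intro order_trans[OF C(2)] mult_left_mono decay_shift C(1)) auto
      then show "onorm (\<lambda>h. h *\<^sub>R partial i \<psi> (x + \<tau> *\<^sub>R ?e)) \<le> C * 2 ^ (2 * CARD('n)) * decay x"
        using C(1) less_imp_le[OF decay_pos[of x]]
        by (intro onorm_bound) (auto simp: mult.assoc mult.commute[of _ "\<bar>_\<bar>"] intro!: mult_left_mono)
    qed (use t[of k] D in \<open>auto simp: has_vector_derivative_def intro!: less_imp_le\<close>)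
    then show ?thesis using t[of k] by (simp add: q_def norm_divide field_simps)
  qed
  have "(\<lambda>k. LINT x|lborel. q k x) \<longlonglongrightarrow> (LINT x|lborel. partial i \<psi> x)"
  proof (rule integral_dominated_convergence[where w = "\<lambda>x. C * 2 ^ (2 * CARD('n)) * decay x"])
    show "AE x in lborel. (\<lambda>k. q k x) \<longlonglongrightarrow> partial i \<psi> x"
    proof (rule AE_I2)
      fix x
      have "((\<lambda>h. cmod (\<psi> (x + h *\<^sub>R ?e) - \<psi> x - h *\<^sub>R partial i \<psi> x) / \<bar>h\<bar>) \<longlongrightarrow> 0) (at 0)"
        using D[of x 0 UNIV] unfolding has_vector_derivative_def has_derivative_at by simp
      then have "((\<lambda>h. (\<psi> (x + h *\<^sub>R ?e) - \<psi> x) /\<^sub>R h - partial i \<psi> x) \<longlongrightarrow> 0) (at 0)"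
      proof (rule Lim_transform_bound[rotated])
        have "norm ((\<psi> (x + h *\<^sub>R ?e) - \<psi> x) /\<^sub>R h - partial i \<psi> x)
          = cmod (\<psi> (x + h *\<^sub>R ?e) - \<psi> x - h *\<^sub>R partial i \<psi> x) / \<bar>h\<bar>" if "h \<noteq> 0" for h
        proof -
          have "(\<psi> (x + h *\<^sub>R ?e) - \<psi> x) /\<^sub>R h - partial i \<psi> x
            = (\<psi> (x + h *\<^sub>R ?e) - \<psi> x - h *\<^sub>R partial i \<psi> x) /\<^sub>R h"
            using that by (simp add: scaleR_diff_right)
          then show ?thesis by (simp add: divide_inverse)
        qed
        then show "\<forall>\<^sub>F h in at 0. norm ((\<psi> (x + h *\<^sub>R ?e) - \<psi> x) /\<^sub>R h - partial i \<psi> x)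
          \<le> norm (cmod (\<psi> (x + h *\<^sub>R ?e) - \<psi> x - h *\<^sub>R partial i \<psi> x) / \<bar>h\<bar>)"
          by (auto simp: eventually_at_filter)
      qed
      then have "((\<lambda>h. (\<psi> (x + h *\<^sub>R ?e) - \<psi> x) /\<^sub>R h) \<longlongrightarrow> partial i \<psi> x) (at 0)"
        by (rule LIM_zero_cancel)
      moreover have "filterlim t (at 0) sequentially"
        unfolding filterlim_at t_def using LIMSEQ_inverse_real_of_nat by auto
      ultimately have "(\<lambda>k. (\<psi> (x + t k *\<^sub>R ?e) - \<psi> x) /\<^sub>R t k) \<longlonglongrightarrow> partial i \<psi> x"
        by (rule filterlim_compose)
      then show "(\<lambda>k. q k x) \<longlonglongrightarrow> partial i \<psi> x"
        by (simp add: q_def scaleR_conv_of_real divide_inverse mult.commute)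
    qed
  qed (use q_bound in \<open>auto intro: integrable_decay simp: q_def[abs_def]\<close>)
  moreover have "(LINT x|lborel. q k x) = 0" for k
    unfolding q_def using schwartz_integrable[OF \<psi>]
    by (simp add: lborel_integral_shift lborel_integrable_shift)
  ultimately show ?thesis by (simp add: LIMSEQ_const_iff)
qed

text \<open>Integration by parts: the derivative of the character times \<phi> has integral 0, and
  differentiating the character brings down the factor -i \<xi>_i.\<close>

lemma component_mult_fourier:
  fixes \<phi> :: "real^'n \<Rightarrow> complex"
  assumes \<phi>: "\<phi> \<in> schwartz"
  shows "complex_of_real (\<xi> $ i) * fourier \<phi> \<xi> = fourier (\<lambda>x. - \<i> * partial i \<phi> x) \<xi>"
proof -
  define e where "e x = iexp ((- \<xi>) \<bullet> x)" for x
  have e: "smooth e" using slowly_growing_character[of "- \<xi>"] unfolding slowly_growing_def e_def by blast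
  have D: "(e has_derivative (\<lambda>v. \<i> * complex_of_real ((- \<xi>) \<bullet> v) * e x)) (at x)" for x
  proof -
    have "((\<lambda>x. \<i> * complex_of_real ((- \<xi>) \<bullet> x)) has_derivative (\<lambda>v. \<i> * complex_of_real ((- \<xi>) \<bullet> v))) (at x)"
      by (auto intro!: derivative_eq_intros)
    from has_derivative_compose[OF this DERIV_exp[unfolded has_field_derivative_def]]
    show ?thesis unfolding e_def by (simp add: mult_ac)
  qed
  have pe: "partial i e x = - \<i> * complex_of_real (\<xi> $ i) * e x" for x
    by (subst partial_eqI[OF D]) (simp add: inner_axis)
  have e\<phi>: "(\<lambda>x. e x * \<phi> x) \<in> schwartz"
    unfolding e_def by (rule schwartz_mult_character[OF \<phi>])
  have "partial i (\<lambda>x. e x * \<phi> x) x = e x * partial i \<phi> x - \<i> * complex_of_real (\<xi> $ i) * (e x * \<phi> x)" for x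
    by (subst partial_mult[OF smooth_differentiable[OF e] schwartz_differentiable[OF \<phi>]]) (simp add: pe mult_ac)
  with schwartz_integral_partial[OF e\<phi>, of i]
  have "0 = (LINT x|lborel. e x * partial i \<phi> x - \<i> * complex_of_real (\<xi> $ i) * (e x * \<phi> x))" by simp
  also have "\<dots> = (LINT x|lborel. e x * partial i \<phi> x) - \<i> * complex_of_real (\<xi> $ i) * (LINT x|lborel. e x * \<phi> x)"
    using integrable_character_mult(1)[OF schwartz_integrable[OF schwartz_partial[OF \<phi>]], of "- \<xi>"]
      schwartz_integrable[OF e\<phi>]
    by (subst Bochner_Integration.integral_diff) (auto simp: e_def)
  finally have "\<i> * (complex_of_real (\<xi> $ i) * (LINT x|lborel. e x * \<phi> x)) = (LINT x|lborel. e x * partial i \<phi> x)"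
    by (simp add: mult.assoc)
  from arg_cong[OF this, of "\<lambda>z. - \<i> * z"]
  have "complex_of_real (\<xi> $ i) * (LINT x|lborel. e x * \<phi> x) = - \<i> * (LINT x|lborel. e x * partial i \<phi> x)"
    by simp
  then show ?thesis
    unfolding fourier_eq e_def by (simp add: mult_ac)
qed

text \<open>One factor 1 + |\<xi>| is at most 1 plus the sum of the |\<xi>_i|, and each \<xi>_i is
  absorbed by a derivative of the function; hence the induction runs over all Schwartz functions at
  once.\<close>

lemma fourier_weighted_bounded:
  fixes \<phi> :: "real^'n \<Rightarrow> complex"
  assumes "\<phi> \<in> schwartz"
  shows "\<exists>C. \<forall>\<xi>. (1 + norm \<xi>) ^ k * cmod (fourier \<phi> \<xi>) \<le> C"
  using assms
proof (induction k arbitrary: \<phi>)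
  case 0
  show ?case using norm_fourier_le[of \<phi>] by auto
next
  case (Suc k)
  obtain C where C: "\<And>\<xi>. (1 + norm \<xi>) ^ k * cmod (fourier \<phi> \<xi>) \<le> C" using Suc by blast
  have "(\<lambda>x. - \<i> * partial i \<phi> x) \<in> schwartz" for i
    by (intro schwartz_cmult schwartz_partial Suc.prems)
  with Suc.IH have "\<exists>C. \<forall>\<xi>. (1 + norm \<xi>) ^ k * cmod (fourier (\<lambda>x. - \<i> * partial i \<phi> x) \<xi>) \<le> C" for i by blast
  then obtain D where D: "\<And>i \<xi>. (1 + norm \<xi>) ^ k * cmod (fourier (\<lambda>x. - \<i> * partial i \<phi> x) \<xi>) \<le> D i" by metis
  have "(1 + norm \<xi>) ^ Suc k * cmod (fourier \<phi> \<xi>) \<le> C + (\<Sum>i\<in>UNIV. D i)" for \<xi>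
  proof -
    have "(1 + norm \<xi>) ^ Suc k * cmod (fourier \<phi> \<xi>)
      \<le> (1 + norm \<xi>) ^ k * (1 + (\<Sum>i\<in>UNIV. \<bar>\<xi> $ i\<bar>)) * cmod (fourier \<phi> \<xi>)"
      unfolding power_Suc2 using norm_le_l1_cart[of \<xi>] by (intro mult_right_mono mult_left_mono) auto
    also have "\<dots> = (1 + norm \<xi>) ^ k * cmod (fourier \<phi> \<xi>)
       + (\<Sum>i\<in>UNIV. (1 + norm \<xi>) ^ k * cmod (complex_of_real (\<xi> $ i) * fourier \<phi> \<xi>))"
      by (simp add: algebra_simps sum_distrib_left norm_mult)
    also have "\<dots> \<le> C + (\<Sum>i\<in>UNIV. D i)"
      unfolding component_mult_fourier[OF Suc.prems] by (intro add_mono sum_mono C D)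
    finally show ?thesis .
  qed
  then show ?case by blast
qed

lemma fourier_schwartz:
  fixes \<phi> :: "real^'n \<Rightarrow> complex"
  assumes "\<phi> \<in> schwartz"
  shows "fourier \<phi> \<in> schwartz"
proof (rule schwartz_coinduct[where B = "fourier ` schwartz"])
  show "fourier \<phi> \<in> sum_closure (fourier ` schwartz)"
    using assms by (auto intro: sum_closure.base)
  fix h :: "real^'n \<Rightarrow> complex" assume "h \<in> fourier ` schwartz"
  then obtain \<psi> where h: "h = fourier \<psi>" "\<psi> \<in> schwartz" by auto
  show "h differentiable at x" for x
    using fourier_has_derivative[OF h(2)] h(1) differentiable_def by blast
  have "(\<lambda>x. - \<i> * (complex_of_real (x $ i) * \<psi> x)) \<in> schwartz" for i
    by (intro schwartz_cmult schwartz_mult_component h)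
  then show "partial i h \<in> sum_closure (fourier ` schwartz)" for i
    unfolding h(1) partial_fourier[OF h(2)] by (auto intro: sum_closure.base)
  show "bounded (range (\<lambda>x. (1 + norm x) ^ k *\<^sub>R h x))" for k
    unfolding bounded_range_weighted h(1) by (rule fourier_weighted_bounded[OF h(2)])
qed

lemma fourier_inv_eq_fourier_uminus: "fourier_inv \<phi> = fourier (\<lambda>x. \<phi> (- x))"
  if "\<phi> \<in> borel_measurable borel" for \<phi> :: "real^'n \<Rightarrow> complex"
proof
  fix x
  have [measurable]: "\<phi> \<in> borel_measurable borel" by fact
  have "(LINT y|lborel. iexp (- (- x \<bullet> y)) * \<phi> y) = (LINT y|lborel. iexp (- (- x \<bullet> - y)) * \<phi> (- y))"
    by (rule lborel_integral_uminus[symmetric]) measurable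
  then show "fourier_inv \<phi> x = fourier (\<lambda>x. \<phi> (- x)) x"
    by (simp add: fourier_inv_def fourier_eq)
qed

lemma fourier_inv_schwartz: "\<phi> \<in> schwartz \<Longrightarrow> fourier_inv \<phi> \<in> schwartz"
  by (simp add: fourier_inv_eq_fourier_uminus fourier_schwartz schwartz_uminus schwartz_borel)

subsection \<open>Fourier inversion\<close>

text \<open>Fubini, with a kernel that is symmetric in its two variables.\<close>

lemma fourier_multiplication:
  fixes f g :: "real^'n \<Rightarrow> complex"
  assumes f: "integrable lborel f" and g: "integrable lborel g"
  shows "(LINT \<xi>|lborel. fourier f \<xi> * g \<xi>) = (LINT x|lborel. f x * fourier g x)"
proof -
  have [measurable]: "f \<in> borel_measurable borel" "g \<in> borel_measurable borel" using f g by auto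
  have "integrable (lborel \<Otimes>\<^sub>M lborel) (\<lambda>(x, \<xi>). iexp (- (\<xi> \<bullet> x)) * f x * g \<xi>)"
  proof (rule lborel_pair.Fubini_integrable)
    show "(\<lambda>(x, \<xi>). iexp (- (\<xi> \<bullet> x)) * f x * g \<xi>) \<in> borel_measurable (lborel \<Otimes>\<^sub>M lborel)"
      by measurable
    show "integrable lborel (\<lambda>x. (LINT \<xi>|lborel. norm (case (x, \<xi>) of (x, \<xi>) \<Rightarrow> iexp (- (\<xi> \<bullet> x)) * f x * g \<xi>)))"
      using f by (simp add: norm_mult)
    show "AE x in lborel. integrable lborel (\<lambda>\<xi>. case (x, \<xi>) of (x, \<xi>) \<Rightarrow> iexp (- (\<xi> \<bullet> x)) * f x * g \<xi>)"
    proof (rule AE_I2)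
      fix x
      have "integrable lborel (\<lambda>\<xi>. iexp (- (x \<bullet> \<xi>)) * g \<xi> * f x)"
        by (intro integrable_mult_left integrable_character_mult g)
      then show "integrable lborel (\<lambda>\<xi>. case (x, \<xi>) of (x, \<xi>) \<Rightarrow> iexp (- (\<xi> \<bullet> x)) * f x * g \<xi>)"
        by (simp add: mult_ac inner_commute)
    qed
  qed
  from lborel_pair.Fubini_integral[OF this]
  have "(LINT \<xi>|lborel. (LINT x|lborel. iexp (- (\<xi> \<bullet> x)) * f x * g \<xi>))
      = (LINT x|lborel. (LINT \<xi>|lborel. iexp (- (\<xi> \<bullet> x)) * f x * g \<xi>))" .
  then have "(LINT \<xi>|lborel. (LINT x|lborel. iexp (- (\<xi> \<bullet> x)) * f x) * g \<xi>)
      = (LINT x|lborel. f x * (LINT \<xi>|lborel. iexp (- (x \<bullet> \<xi>)) * g \<xi>))"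
    unfolding integral_mult_left_zero[symmetric] integral_mult_right_zero[symmetric]
    by (simp add: mult_ac inner_commute)
  then show ?thesis
    unfolding fourier_eq by (simp add: mult.assoc mult.left_commute[of _ "complex_of_real _"])
qed

text \<open>This is (2 pi)^(-n/2) exp (-|x|^2 / 2), written as a product so that its transform
  reduces to the characteristic function of the standard normal distribution on the line. The
  normalization of \<open>fourier\<close> makes it a fixed point.\<close>

definition gauss :: "real^'n \<Rightarrow> real" where
  "gauss x = (\<Prod>b\<in>Basis. std_normal_density (x \<bullet> b))"

lemma fourier_const_eq: "fourier_const TYPE('n::finite) = (\<Prod>b\<in>(Basis::(real^'n) set). 1 / sqrt (2 * pi))"
proof -
  have "(2 * pi) powr (- real CARD('n) / 2) = ((2 * pi) powr (- 1 / 2)) powr real CARD('n)"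
    by (simp add: powr_powr)
  also have "\<dots> = ((2 * pi) powr (- 1 / 2)) ^ CARD('n)"
    by (rule powr_realpow) simp
  also have "(2 * pi) powr (- 1 / 2) = 1 / sqrt (2 * pi)"
    using powr_minus_divide[of "2 * pi" "1/2"] by (simp add: powr_half_sqrt)
  finally show ?thesis by (simp add: fourier_const_def)
qed

lemma std_normal_fourier: "(LINT x|lborel. iexp (t * x) * complex_of_real (std_normal_density x)) = exp (- t\<^sup>2 / 2)"
proof -
  have "char std_normal_distribution t = (LINT x|lborel. std_normal_density x *\<^sub>R iexp (t * x))"
    unfolding char_def by (subst integral_density) auto
  then show ?thesis
    by (simp add: char_std_normal_distribution scaleR_conv_of_real mult.commute)
qed

lemma integrable_gauss: "integrable lborel (gauss :: real^'n \<Rightarrow> real)"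
proof -
  have "integrable lborel (\<lambda>x::real^'n. \<Prod>b\<in>Basis. complex_of_real (std_normal_density (x \<bullet> b)))"
    by (rule lborel_integrable_basis_prod) auto
  then have "integrable lborel (\<lambda>x::real^'n. complex_of_real (gauss x))"
    by (simp add: gauss_def)
  then show ?thesis unfolding complex_of_real_integrable_eq .
qed

lemma integral_gauss: "(LINT x|lborel. complex_of_real (gauss (x::real^'n))) = 1"
  unfolding gauss_def of_real_prod by (subst lborel_integral_basis_prod) auto

lemma fourier_gauss: "fourier (\<lambda>x. complex_of_real (gauss x)) \<xi> = complex_of_real (gauss (\<xi>::real^'n))"
proof -
  have "(LINT x|lborel. iexp (- (\<xi> \<bullet> x)) * complex_of_real (gauss x))
    = (LINT x|lborel. (\<Prod>b\<in>Basis. iexp ((- \<xi> \<bullet> b) * (x \<bullet> b)) * complex_of_real (std_normal_density (x \<bullet> b))))"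
  proof (rule Bochner_Integration.integral_cong)
    fix x
    have "iexp (- (\<xi> \<bullet> x)) = exp (\<Sum>b\<in>Basis. \<i> * complex_of_real ((- \<xi> \<bullet> b) * (x \<bullet> b)))"
      by (subst euclidean_inner) (simp add: sum_negf sum_distrib_left)
    then show "iexp (- (\<xi> \<bullet> x)) * complex_of_real (gauss x)
       = (\<Prod>b\<in>Basis. iexp ((- \<xi> \<bullet> b) * (x \<bullet> b)) * complex_of_real (std_normal_density (x \<bullet> b)))"
      by (simp only: exp_sum[OF finite_Basis] gauss_def of_real_prod prod.distrib)
  qed simp
  also have "\<dots> = (\<Prod>b\<in>Basis. (LINT x|lborel. iexp ((- \<xi> \<bullet> b) * x) * complex_of_real (std_normal_density x)))"
  proof (rule lborel_integral_basis_prod)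
    show "integrable lborel (\<lambda>x. iexp ((- \<xi> \<bullet> b) * x) * complex_of_real (std_normal_density x))" for b
      by (rule Bochner_Integration.integrable_bound[OF integrable_normal_density[of 1 0]])
        (auto simp: norm_mult)
  qed
  also have "\<dots> = (\<Prod>b\<in>Basis. complex_of_real (exp (- (\<xi> \<bullet> b)\<^sup>2 / 2)))"
    unfolding std_normal_fourier by simp
  finally have "fourier (\<lambda>x. complex_of_real (gauss x)) \<xi>
    = complex_of_real ((\<Prod>b\<in>(Basis::(real^'n) set). 1 / sqrt (2 * pi)) * (\<Prod>b\<in>Basis. exp (- (\<xi> \<bullet> b)\<^sup>2 / 2)))"
    unfolding fourier_eq fourier_const_eq of_real_mult of_real_prod by (simp only:)
  also have "\<dots> = complex_of_real (gauss \<xi>)"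
    unfolding gauss_def std_normal_density_def prod.distrib ..
  finally show ?thesis .
qed

lemma gauss_continuous: "continuous_on UNIV (gauss :: real^'n \<Rightarrow> real)"
  unfolding gauss_def std_normal_density_def by (intro continuous_intros) auto

lemma gauss_nonneg: "0 \<le> gauss x"
  by (simp add: gauss_def prod_nonneg)

lemma gauss_zero: "gauss (0::real^'n) = fourier_const TYPE('n)"
  by (simp add: gauss_def fourier_const_eq std_normal_density_def)

lemma gauss_le: "gauss (x::real^'n) \<le> fourier_const TYPE('n)"
  unfolding gauss_def fourier_const_eq
  by (intro prod_mono) (auto simp: std_normal_density_def field_simps)

text \<open>Since \<open>gauss\<close> is its own Fourier transform, the multiplication formula for
  \<open>z \<mapsto> \<phi> (x + \<epsilon> z)\<close> against \<open>gauss\<close> gives the inversion formula as \<open>\<epsilon> \<rightarrow> 0\<close>.\<close>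

theorem fourier_inversion:
  fixes \<phi> :: "real^'n \<Rightarrow> complex"
  assumes \<phi>: "\<phi> \<in> schwartz"
  shows "fourier_inv (fourier \<phi>) = \<phi>"
proof
  fix x
  let ?c = "fourier_const TYPE('n)"
  note [measurable] = schwartz_borel[OF \<phi>] schwartz_borel[OF fourier_schwartz[OF \<phi>]]
  have [measurable]: "(gauss :: real^'n \<Rightarrow> real) \<in> borel_measurable borel"
    using gauss_continuous by (rule borel_measurable_continuous_onI)
  define \<epsilon> where "\<epsilon> k = inverse (real (Suc k))" for k
  have \<epsilon>: "0 < \<epsilon> k" for k by (simp add: \<epsilon>_def)
  have \<epsilon>_lim: "\<epsilon> \<longlonglongrightarrow> 0" unfolding \<epsilon>_def by (rule LIMSEQ_inverse_real_of_nat)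
  have int\<phi>: "integrable lborel \<phi>" and intF: "integrable lborel (fourier \<phi>)"
    using \<phi> by (auto intro!: schwartz_integrable fourier_schwartz)
  have intg: "integrable lborel (\<lambda>z::real^'n. complex_of_real (gauss z))"
    using integrable_gauss by (simp add: complex_of_real_integrable_eq)
  obtain C where C: "\<And>x. cmod (\<phi> x) \<le> C"
    using schwartz_bound[OF \<phi>, of 0] by (metis mult_1 power_0)
  \<comment> \<open>The transform of \<open>z \<mapsto> \<phi> (x + \<epsilon> z)\<close> carries a
    factor \<epsilon>^(-n), which the substitution \<xi> = \<epsilon> \<eta> cancels; afterwards
    \<epsilon> occurs only inside the Gaussian.\<close>
  have step: "(LINT z|lborel. \<phi> (x + \<epsilon> k *\<^sub>R z) * complex_of_real (gauss z))
    = (LINT \<eta>|lborel. iexp (\<eta> \<bullet> x) * fourier \<phi> \<eta> * complex_of_real (gauss (\<epsilon> k *\<^sub>R \<eta>)))" for k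
  proof -
    let ?e = "\<epsilon> k" and ?\<Phi> = "\<lambda>z. \<phi> (x + \<epsilon> k *\<^sub>R z)"
    have int\<Phi>: "integrable lborel ?\<Phi>" by (rule lborel_integrable_affine[OF int\<phi> \<epsilon>])
    have F\<Phi>: "fourier ?\<Phi> \<xi> = iexp ((\<xi> /\<^sub>R ?e) \<bullet> x) * fourier \<phi> (\<xi> /\<^sub>R ?e) / ?e ^ CARD('n)" for \<xi>
    proof -
      have "(LINT y|lborel. iexp (- ((\<xi> /\<^sub>R ?e) \<bullet> (y - x))) * \<phi> y) / ?e ^ DIM(real^'n)
        = (LINT z|lborel. iexp (- ((\<xi> /\<^sub>R ?e) \<bullet> (x + ?e *\<^sub>R z - x))) * \<phi> (x + ?e *\<^sub>R z))"
        by (rule lborel_integral_affine[symmetric, OF _ \<epsilon>]) measurable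
      also have "\<dots> = (LINT z|lborel. iexp (- (\<xi> \<bullet> z)) * ?\<Phi> z)"
      proof -
        have "(\<xi> /\<^sub>R ?e) \<bullet> (x + ?e *\<^sub>R z - x) = \<xi> \<bullet> z" for z
          using \<epsilon>[of k] by simp
        then show ?thesis by (simp only:)
      qed
      also have "(LINT y|lborel. iexp (- ((\<xi> /\<^sub>R ?e) \<bullet> (y - x))) * \<phi> y)
        = (LINT y|lborel. iexp ((\<xi> /\<^sub>R ?e) \<bullet> x) * (iexp (- ((\<xi> /\<^sub>R ?e) \<bullet> y)) * \<phi> y))"
      proof (rule Bochner_Integration.integral_cong)
        fix y
        have "iexp (- ((\<xi> /\<^sub>R ?e) \<bullet> (y - x))) = iexp ((\<xi> /\<^sub>R ?e) \<bullet> x) * iexp (- ((\<xi> /\<^sub>R ?e) \<bullet> y))"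
          unfolding exp_add[symmetric] inner_diff_right by (simp add: right_diff_distrib)
        then show "iexp (- ((\<xi> /\<^sub>R ?e) \<bullet> (y - x))) * \<phi> y
          = iexp ((\<xi> /\<^sub>R ?e) \<bullet> x) * (iexp (- ((\<xi> /\<^sub>R ?e) \<bullet> y)) * \<phi> y)"
          by (simp only: mult.assoc)
      qed simp
      also have "\<dots> = iexp ((\<xi> /\<^sub>R ?e) \<bullet> x) * (LINT y|lborel. iexp (- ((\<xi> /\<^sub>R ?e) \<bullet> y)) * \<phi> y)"
        by (rule integral_mult_right_zero)
      finally have "(LINT z|lborel. iexp (- (\<xi> \<bullet> z)) * ?\<Phi> z)
        = iexp ((\<xi> /\<^sub>R ?e) \<bullet> x) * (LINT y|lborel. iexp (- ((\<xi> /\<^sub>R ?e) \<bullet> y)) * \<phi> y) / ?e ^ CARD('n)"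
        by simp
      then show ?thesis unfolding fourier_eq by (simp only: times_divide_eq_right mult.left_commute)
    qed
    have "(LINT z|lborel. ?\<Phi> z * complex_of_real (gauss z)) = (LINT \<xi>|lborel. fourier ?\<Phi> \<xi> * complex_of_real (gauss \<xi>))"
      unfolding fourier_multiplication[OF int\<Phi> intg] by (simp add: fourier_gauss)
    also have "\<dots> = (LINT \<xi>|lborel. iexp ((0 + (1 / ?e) *\<^sub>R \<xi>) \<bullet> x) * fourier \<phi> (0 + (1 / ?e) *\<^sub>R \<xi>)
        * complex_of_real (gauss (?e *\<^sub>R (0 + (1 / ?e) *\<^sub>R \<xi>))) / ?e ^ CARD('n))"
      using \<epsilon>[of k] unfolding F\<Phi> by (simp add: divide_inverse mult_ac)
    also have "\<dots> = (LINT \<xi>|lborel. iexp ((0 + (1 / ?e) *\<^sub>R \<xi>) \<bullet> x) * fourier \<phi> (0 + (1 / ?e) *\<^sub>R \<xi>)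
        * complex_of_real (gauss (?e *\<^sub>R (0 + (1 / ?e) *\<^sub>R \<xi>)))) / ?e ^ CARD('n)"
      by (rule integral_divide_zero)
    also have "\<dots> = (LINT \<eta>|lborel. iexp (\<eta> \<bullet> x) * fourier \<phi> \<eta> * complex_of_real (gauss (?e *\<^sub>R \<eta>)))"
      using \<epsilon>[of k] by (subst lborel_integral_affine[where f = "\<lambda>\<eta>. iexp (\<eta> \<bullet> x) * fourier \<phi> \<eta> * complex_of_real (gauss (?e *\<^sub>R \<eta>))"])
        (auto simp: power_divide)
    finally show ?thesis .
  qed
  have "(\<lambda>k. LINT z|lborel. \<phi> (x + \<epsilon> k *\<^sub>R z) * complex_of_real (gauss z))
     \<longlonglongrightarrow> (LINT z|lborel. \<phi> x * complex_of_real (gauss (z::real^'n)))"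
  proof (rule integral_dominated_convergence[where w = "\<lambda>z::real^'n. C * gauss z"])
    show "AE z in lborel. (\<lambda>k. \<phi> (x + \<epsilon> k *\<^sub>R z) * complex_of_real (gauss z)) \<longlonglongrightarrow> \<phi> x * complex_of_real (gauss z)"
    proof (intro AE_I2 tendsto_mult tendsto_const)
      fix z
      have "(\<lambda>k. x + \<epsilon> k *\<^sub>R z) \<longlonglongrightarrow> x + 0 *\<^sub>R z" by (intro tendsto_intros \<epsilon>_lim)
      with smooth_continuous_on[OF schwartz_smooth[OF \<phi>], of UNIV]
      show "(\<lambda>k. \<phi> (x + \<epsilon> k *\<^sub>R z)) \<longlonglongrightarrow> \<phi> x"
        using continuous_on_tendsto_compose[of UNIV \<phi> "\<lambda>k. x + \<epsilon> k *\<^sub>R z" x sequentially] by simp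
    qed
    show "AE z in lborel. cmod (\<phi> (x + \<epsilon> k *\<^sub>R z) * complex_of_real (gauss z)) \<le> C * gauss z" for k
      by (intro AE_I2) (simp add: norm_mult mult_right_mono gauss_nonneg C)
  qed (use integrable_gauss in auto)
  then have lim1: "(\<lambda>k. LINT z|lborel. \<phi> (x + \<epsilon> k *\<^sub>R z) * complex_of_real (gauss z)) \<longlonglongrightarrow> \<phi> x"
    unfolding integral_mult_right_zero integral_gauss by simp
  have lim2: "(\<lambda>k. LINT \<eta>|lborel. iexp (\<eta> \<bullet> x) * fourier \<phi> \<eta> * complex_of_real (gauss (\<epsilon> k *\<^sub>R \<eta>)))
     \<longlonglongrightarrow> (LINT \<eta>|lborel. iexp (\<eta> \<bullet> x) * fourier \<phi> \<eta> * complex_of_real (gauss (0::real^'n)))"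
  proof (rule integral_dominated_convergence[where w = "\<lambda>\<eta>. ?c * cmod (fourier \<phi> \<eta>)"])
    show "AE \<eta> in lborel. (\<lambda>k. iexp (\<eta> \<bullet> x) * fourier \<phi> \<eta> * complex_of_real (gauss (\<epsilon> k *\<^sub>R \<eta>)))
       \<longlonglongrightarrow> iexp (\<eta> \<bullet> x) * fourier \<phi> \<eta> * complex_of_real (gauss (0::real^'n))"
    proof (intro AE_I2 tendsto_mult tendsto_const tendsto_of_real)
      fix \<eta> :: "real^'n"
      have "(\<lambda>k. \<epsilon> k *\<^sub>R \<eta>) \<longlonglongrightarrow> 0 *\<^sub>R \<eta>" by (intro tendsto_intros \<epsilon>_lim)
      then show "(\<lambda>k. gauss (\<epsilon> k *\<^sub>R \<eta>)) \<longlonglongrightarrow> gauss (0::real^'n)"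
        using continuous_on_tendsto_compose[OF gauss_continuous, of "\<lambda>k. \<epsilon> k *\<^sub>R \<eta>" 0 sequentially] by simp
    qed
    show "AE \<eta> in lborel. cmod (iexp (\<eta> \<bullet> x) * fourier \<phi> \<eta> * complex_of_real (gauss (\<epsilon> k *\<^sub>R \<eta>))) \<le> ?c * cmod (fourier \<phi> \<eta>)" for k
      by (intro AE_I2, simp add: norm_mult gauss_nonneg, subst mult.commute, intro mult_right_mono gauss_le) simp
  qed (use intF in auto)
  \<comment> \<open>The value of \<open>gauss\<close> at 0 is exactly the normalizing constant, so
    the second limit is the inverse transform of \<open>fourier \<phi>\<close>.\<close>
  from LIMSEQ_unique[OF lim1 lim2[folded step]]
  show "fourier_inv (fourier \<phi>) x = \<phi> x"
    by (simp add: fourier_inv_def fourier_eq gauss_zero inner_commute mult.commute)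
qed

lemma fourier_fourier_inv:
  fixes \<psi> :: "real^'n \<Rightarrow> complex"
  assumes "\<psi> \<in> schwartz"
  shows "fourier (fourier_inv \<psi>) = \<psi>"
proof
  fix \<xi>
  have "fourier (fourier_inv \<psi>) \<xi> = fourier_inv (fourier (\<lambda>x. \<psi> (- x))) (- \<xi>)"
    using assms by (simp add: fourier_inv_eq_fourier_uminus schwartz_borel) (simp add: fourier_inv_def)
  then show "fourier (fourier_inv \<psi>) \<xi> = \<psi> \<xi>"
    by (simp add: fourier_inversion schwartz_uminus assms)
qed

lemma cnj_fourier_inv:
  fixes \<psi> :: "real^'n \<Rightarrow> complex"
  shows "cnj (fourier_inv \<psi> x) = fourier (\<lambda>\<xi>. cnj (\<psi> \<xi>)) x"
proof -
  have "cnj (LINT y|lborel. iexp (- (- x \<bullet> y)) * \<psi> y) = (LINT y|lborel. cnj (iexp (- (- x \<bullet> y)) * \<psi> y))"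
    by (rule Bochner_Integration.integral_cnj[symmetric])
  then show ?thesis by (simp add: fourier_inv_def fourier_eq exp_cnj)
qed

lemma fourier_duality:
  fixes \<phi> \<psi> :: "real^'n \<Rightarrow> complex"
  assumes "\<phi> \<in> schwartz" "\<psi> \<in> schwartz"
  shows "(LINT \<xi>|lborel. fourier \<phi> \<xi> * cnj (\<psi> \<xi>)) = (LINT x|lborel. \<phi> x * cnj (fourier_inv \<psi> x))"
  unfolding cnj_fourier_inv using assms
  by (intro fourier_multiplication schwartz_integrable schwartz_cnj)

theorem fourier_parseval:
  fixes \<phi> \<psi> :: "real^'n \<Rightarrow> complex"
  assumes "\<phi> \<in> schwartz" "\<psi> \<in> schwartz"
  shows "(LINT \<xi>|lborel. fourier \<phi> \<xi> * cnj (fourier \<psi> \<xi>)) = (LINT x|lborel. \<phi> x * cnj (\<psi> x))"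
  using fourier_duality[OF assms(1) fourier_schwartz[OF assms(2)]] by (simp add: fourier_inversion assms)

section \<open>Square integrable functions\<close>

lemma borel_measurable_cnj [measurable]:
  "f \<in> borel_measurable M \<Longrightarrow> (\<lambda>x. cnj (f x)) \<in> borel_measurable M"
  by (rule measurable_compose[of f M borel cnj borel])
    (auto intro!: borel_measurable_continuous_onI continuous_intros)

definition L2 :: "'a measure \<Rightarrow> ('a \<Rightarrow> complex) set" where
  "L2 M = {f \<in> borel_measurable M. integrable M (\<lambda>x. (cmod (f x))\<^sup>2)}"

text \<open>Squared norms serve instead of norms: convergence to 0 and the Cauchy property are the
  same, and a version with factors 2 replaces the triangle inequality.\<close>

definition L2_sq :: "'a measure \<Rightarrow> ('a \<Rightarrow> complex) \<Rightarrow> real" where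
  "L2_sq M f = (LINT x|M. (cmod (f x))\<^sup>2)"

lemma L2_measurable [measurable_dest]: "f \<in> L2 M \<Longrightarrow> f \<in> borel_measurable M"
  by (simp add: L2_def)

lemma L2_integrable: "f \<in> L2 M \<Longrightarrow> integrable M (\<lambda>x. (cmod (f x))\<^sup>2)"
  by (simp add: L2_def)

lemma L2_sq_nonneg [simp]: "0 \<le> L2_sq M f"
  by (simp add: L2_sq_def)

lemma L2_bound:
  assumes "f \<in> borel_measurable M" "g \<in> L2 M" "AE x in M. cmod (f x) \<le> C * cmod (g x)"
  shows "f \<in> L2 M"
proof -
  note [measurable] = assms(1) L2_measurable[OF assms(2)]
  have "integrable M (\<lambda>x. (cmod (f x))\<^sup>2)"
  proof (rule Bochner_Integration.integrable_bound)
    show "integrable M (\<lambda>x. C\<^sup>2 * (cmod (g x))\<^sup>2)" using L2_integrable[OF assms(2)] by simp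
    show "AE x in M. norm ((cmod (f x))\<^sup>2) \<le> norm (C\<^sup>2 * (cmod (g x))\<^sup>2)"
      using assms(3)
    proof eventually_elim
      case (elim x)
      then have "(cmod (f x))\<^sup>2 \<le> (C * cmod (g x))\<^sup>2" by (intro power_mono) auto
      then show ?case by (simp add: power_mult_distrib)
    qed
  qed measurable
  then show ?thesis using assms(1) by (simp add: L2_def)
qed

lemma L2_cmult: "f \<in> L2 M \<Longrightarrow> (\<lambda>x. c * f x) \<in> L2 M"
  by (rule L2_bound[of _ _ f "cmod c"]) (auto simp: norm_mult L2_measurable)

lemma L2_zero: "(\<lambda>x. 0) \<in> L2 M"
  by (simp add: L2_def)

lemma L2_cong_AE:
  assumes "f \<in> L2 M" "g \<in> borel_measurable M" "AE x in M. f x = g x"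
  shows "g \<in> L2 M"
  by (rule L2_bound[OF assms(2,1), of 1]) (use assms(3) in auto)

lemma L2_sq_cong_AE:
  assumes "f \<in> borel_measurable M" "g \<in> borel_measurable M" "AE x in M. f x = g x"
  shows "L2_sq M f = L2_sq M g"
  unfolding L2_sq_def by (rule integral_cong_AE) (use assms in auto)

lemma norm_add_sq_le: "(cmod (a + b))\<^sup>2 \<le> 2 * (cmod a)\<^sup>2 + 2 * (cmod b)\<^sup>2"
proof -
  have "(cmod (a + b))\<^sup>2 \<le> (cmod a + cmod b)\<^sup>2"
    by (intro power_mono norm_triangle_ineq) auto
  also have "\<dots> \<le> 2 * (cmod a)\<^sup>2 + 2 * (cmod b)\<^sup>2"
    using zero_le_power2[of "cmod a - cmod b"] unfolding power2_sum power2_diff by linarith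
  finally show ?thesis .
qed

lemma
  assumes f: "f \<in> L2 M" and g: "g \<in> L2 M"
  shows L2_add: "(\<lambda>x. f x + g x) \<in> L2 M"
    and L2_sq_add_le: "L2_sq M (\<lambda>x. f x + g x) \<le> 2 * L2_sq M f + 2 * L2_sq M g"
proof -
  note [measurable] = L2_measurable[OF f] L2_measurable[OF g]
  have int: "integrable M (\<lambda>x. 2 * (cmod (f x))\<^sup>2 + 2 * (cmod (g x))\<^sup>2)"
    using L2_integrable[OF f] L2_integrable[OF g] by simp
  have int': "integrable M (\<lambda>x. (cmod (f x + g x))\<^sup>2)"
    by (rule Bochner_Integration.integrable_bound[OF int]) (auto simp: norm_add_sq_le)
  then show "(\<lambda>x. f x + g x) \<in> L2 M" by (simp add: L2_def)
  have "L2_sq M (\<lambda>x. f x + g x) \<le> (LINT x|M. 2 * (cmod (f x))\<^sup>2 + 2 * (cmod (g x))\<^sup>2)"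
    unfolding L2_sq_def by (intro integral_mono int int' norm_add_sq_le)
  also have "\<dots> = 2 * L2_sq M f + 2 * L2_sq M g"
    using L2_integrable[OF f] L2_integrable[OF g] by (simp add: L2_sq_def)
  finally show "L2_sq M (\<lambda>x. f x + g x) \<le> 2 * L2_sq M f + 2 * L2_sq M g" .
qed

lemma L2_linear: "f \<in> L2 M \<Longrightarrow> g \<in> L2 M \<Longrightarrow> (\<lambda>x. a * f x + b * g x) \<in> L2 M"
  by (intro L2_add L2_cmult)

lemma L2_diff: "f \<in> L2 M \<Longrightarrow> g \<in> L2 M \<Longrightarrow> (\<lambda>x. f x - g x) \<in> L2 M"
  using L2_linear[of f M g 1 "-1"] by simp

lemma L2_sq_cmult: "L2_sq M (\<lambda>x. c * f x) = (cmod c)\<^sup>2 * L2_sq M f"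
  by (simp add: L2_sq_def norm_mult power_mult_distrib)

lemma L2_sq_minus_commute: "L2_sq M (\<lambda>x. f x - g x) = L2_sq M (\<lambda>x. g x - f x)"
  by (simp add: L2_sq_def norm_minus_commute)

lemma L2_sq_diff_le:
  assumes "f \<in> L2 M" "g \<in> L2 M"
  shows "L2_sq M (\<lambda>x. f x - g x) \<le> 2 * L2_sq M f + 2 * L2_sq M g"
  using L2_sq_add_le[OF assms(1) L2_cmult[OF assms(2), of "-1"]] L2_sq_cmult[of M "-1" g] by simp

lemma L2_sq_triangle:
  assumes "f \<in> L2 M" "g \<in> L2 M" "h \<in> L2 M"
  shows "L2_sq M (\<lambda>x. f x - h x) \<le> 2 * L2_sq M (\<lambda>x. f x - g x) + 2 * L2_sq M (\<lambda>x. g x - h x)"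
  using L2_sq_add_le[OF L2_diff[OF assms(1,2)] L2_diff[OF assms(2,3)]] by simp

lemma L2_sq_eq_0_iff: "f \<in> L2 M \<Longrightarrow> L2_sq M f = 0 \<longleftrightarrow> (AE x in M. f x = 0)"
  unfolding L2_sq_def by (subst integral_nonneg_eq_0_iff_AE) (auto simp: L2_integrable)

text \<open>The weighted inequality between arithmetic and geometric mean, integrated. The choice
  \<open>t = 1\<close> gives integrability; the quotient of the norms is the optimal
  \<open>t\<close> and leads to Cauchy-Schwarz.\<close>

lemma
  assumes f: "f \<in> L2 M" and g: "g \<in> L2 M"
  shows L2_integrable_inner: "integrable M (\<lambda>x. f x * cnj (g x))"
    and L2_inner_weighted: "t > 0 \<Longrightarrow> cmod (LINT x|M. f x * cnj (g x)) \<le> (t * L2_sq M f + L2_sq M g / t) / 2"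
proof -
  note [measurable] = L2_measurable[OF f] L2_measurable[OF g]
  have le: "cmod a * cmod b \<le> (t * (cmod a)\<^sup>2 + (cmod b)\<^sup>2 / t) / 2" if "t > 0" for t a b
  proof -
    have "0 \<le> (t * cmod a - cmod b)\<^sup>2 / t" using that by simp
    also have "\<dots> = t * (cmod a)\<^sup>2 + (cmod b)\<^sup>2 / t - 2 * (cmod a * cmod b)"
      using that by (simp add: power2_eq_square field_simps)
    finally show ?thesis by simp
  qed
  have int: "integrable M (\<lambda>x. (t * (cmod (f x))\<^sup>2 + (cmod (g x))\<^sup>2 / t) / 2)" for t
    using L2_integrable[OF f] L2_integrable[OF g] by simp
  show int1: "integrable M (\<lambda>x. f x * cnj (g x))"
    by (rule Bochner_Integration.integrable_bound[OF int[of 1]])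
      (measurable, rule AE_I2, unfold real_norm_def, rule order_trans[OF _ abs_ge_self],
        use le[of 1] in \<open>simp add: norm_mult\<close>)
  assume "t > 0"
  have "cmod (LINT x|M. f x * cnj (g x)) \<le> (LINT x|M. (t * (cmod (f x))\<^sup>2 + (cmod (g x))\<^sup>2 / t) / 2)"
    by (rule order_trans[OF integral_norm_bound], rule integral_mono[OF integrable_norm[OF int1] int])
      (use le[OF \<open>t > 0\<close>] in \<open>simp add: norm_mult\<close>)
  also have "\<dots> = (t * L2_sq M f + L2_sq M g / t) / 2"
    using L2_integrable[OF f] L2_integrable[OF g] by (simp add: L2_sq_def)
  finally show "cmod (LINT x|M. f x * cnj (g x)) \<le> (t * L2_sq M f + L2_sq M g / t) / 2" .
qed

lemma L2_Cauchy_Schwarz: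
  assumes f: "f \<in> L2 M" and g: "g \<in> L2 M"
  shows "cmod (LINT x|M. f x * cnj (g x)) \<le> sqrt (L2_sq M f) * sqrt (L2_sq M g)"
proof -
  consider "L2_sq M f = 0" | "L2_sq M g = 0" | "L2_sq M f > 0" "L2_sq M g > 0"
    using L2_sq_nonneg less_le by metis
  then show ?thesis
  proof cases
    case 1
    then have "AE x in M. f x * cnj (g x) = 0" using L2_sq_eq_0_iff[OF f] by auto
    then show ?thesis by (simp add: integral_eq_zero_AE)
  next
    case 2
    then have "AE x in M. f x * cnj (g x) = 0" using L2_sq_eq_0_iff[OF g] by auto
    then show ?thesis by (simp add: integral_eq_zero_AE)
  next
    case 3
    define a b where "a = sqrt (L2_sq M f)" and "b = sqrt (L2_sq M g)"
    have ab: "a > 0" "b > 0" "L2_sq M f = a\<^sup>2" "L2_sq M g = b\<^sup>2" using 3 by (auto simp: a_def b_def)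
    have "cmod (LINT x|M. f x * cnj (g x)) \<le> (b / a * a\<^sup>2 + b\<^sup>2 / (b / a)) / 2"
      using L2_inner_weighted[OF f g, of "b / a"] ab by simp
    also have "\<dots> = a * b" using ab by (simp add: field_simps power2_eq_square)
    finally show ?thesis by (simp add: a_def b_def)
  qed
qed

lemma L2_inner_tendsto:
  assumes "\<And>j. f j \<in> L2 M" "g \<in> L2 M" "h \<in> L2 M"
    and lim: "((\<lambda>j. L2_sq M (\<lambda>x. f j x - g x)) \<longlongrightarrow> 0) F"
  shows "((\<lambda>j. LINT x|M. f j x * cnj (h x)) \<longlongrightarrow> (LINT x|M. g x * cnj (h x))) F"
proof (rule LIM_zero_cancel, rule Lim_null_comparison)
  show "\<forall>\<^sub>F j in F. norm ((LINT x|M. f j x * cnj (h x)) - (LINT x|M. g x * cnj (h x)))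
     \<le> sqrt (L2_sq M (\<lambda>x. f j x - g x)) * sqrt (L2_sq M h)"
  proof (rule always_eventually, rule)
    fix j
    have "(LINT x|M. f j x * cnj (h x)) - (LINT x|M. g x * cnj (h x)) = (LINT x|M. (f j x - g x) * cnj (h x))"
      using Bochner_Integration.integral_diff[OF L2_integrable_inner[OF assms(1)[of j] assms(3)]
          L2_integrable_inner[OF assms(2,3)]]
      by (simp add: left_diff_distrib)
    then show "norm ((LINT x|M. f j x * cnj (h x)) - (LINT x|M. g x * cnj (h x)))
     \<le> sqrt (L2_sq M (\<lambda>x. f j x - g x)) * sqrt (L2_sq M h)"
      using L2_Cauchy_Schwarz[OF L2_diff[OF assms(1,2)] assms(3)] by simp
  qed
  show "((\<lambda>j. sqrt (L2_sq M (\<lambda>x. f j x - g x)) * sqrt (L2_sq M h)) \<longlongrightarrow> 0) F"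
    using tendsto_mult[OF tendsto_real_sqrt[OF lim] tendsto_const] by simp
qed

lemma L2_sq_diff:
  assumes f: "f \<in> L2 M" and g: "g \<in> L2 M"
  shows "L2_sq M (\<lambda>x. f x - g x) = L2_sq M f + L2_sq M g - 2 * Re (LINT x|M. f x * cnj (g x))"
proof -
  have e: "(cmod (a - b))\<^sup>2 = (cmod a)\<^sup>2 + (cmod b)\<^sup>2 - 2 * Re (a * cnj b)" for a b
    unfolding cmod_power2 by (simp add: power2_eq_square algebra_simps)
  have "Re (LINT x|M. f x * cnj (g x)) = (LINT x|M. Re (f x * cnj (g x)))"
    by (rule integral_Re[symmetric]) (rule L2_integrable_inner[OF f g])
  moreover have "(LINT x|M. A x + B x - 2 * C x) = (LINT x|M. A x) + (LINT x|M. B x) - 2 * (LINT x|M. C x)"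
    if "integrable M A" "integrable M B" "integrable M C" for A B C :: "'a \<Rightarrow> real"
    using that by simp
  moreover note this[OF L2_integrable[OF f] L2_integrable[OF g] integrable_Re[OF L2_integrable_inner[OF f g]]]
  ultimately show ?thesis unfolding L2_sq_def e by simp
qed

text \<open>Expanding the square of the distance expresses the norm of \<open>f j\<close> through
  that distance and an inner product with the fixed \<open>g\<close>, and both converge.\<close>

lemma L2_sq_tendsto:
  assumes f: "\<And>j. f j \<in> L2 M" and g: "g \<in> L2 M"
    and lim: "((\<lambda>j. L2_sq M (\<lambda>x. f j x - g x)) \<longlongrightarrow> 0) F"
  shows "((\<lambda>j. L2_sq M (f j)) \<longlongrightarrow> L2_sq M g) F"
proof -
  have "L2_sq M (f j) = L2_sq M (\<lambda>x. f j x - g x) - L2_sq M g + 2 * Re (LINT x|M. f j x * cnj (g x))" for j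
    using L2_sq_diff[OF f[of j] g] by simp
  moreover have "((\<lambda>j. L2_sq M (\<lambda>x. f j x - g x) - L2_sq M g + 2 * Re (LINT x|M. f j x * cnj (g x)))
     \<longlongrightarrow> 0 - L2_sq M g + 2 * Re (LINT x|M. g x * cnj (g x))) F"
    by (intro tendsto_intros lim L2_inner_tendsto f g)
  moreover have "(LINT x|M. g x * cnj (g x)) = complex_of_real (L2_sq M g)"
    by (simp only: L2_sq_def complex_norm_square[symmetric] integral_complex_of_real)
  ultimately show ?thesis by simp
qed

text \<open>Almost everywhere convergence with bounded norms suffices for the limit, without a
  majorant. This serves completeness as well as the vanishing of derivatives on zero sets.\<close>

lemma L2_Fatou:
  assumes h: "\<And>k. h k \<in> L2 M" and g[measurable]: "g \<in> borel_measurable M"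
    and lim: "AE x in M. (\<lambda>k. h k x) \<longlonglongrightarrow> g x"
    and le: "\<forall>\<^sub>F k in sequentially. L2_sq M (h k) \<le> e"
  shows "g \<in> L2 M" "L2_sq M g \<le> e"
proof -
  note [measurable] = L2_measurable[OF h]
  have "0 \<le> e" using eventually_happens[OF le] L2_sq_nonneg order_trans by (metis trivial_limit_sequentially)
  have "(\<integral>\<^sup>+x. ennreal ((cmod (g x))\<^sup>2) \<partial>M) = (\<integral>\<^sup>+x. liminf (\<lambda>k. ennreal ((cmod (h k x))\<^sup>2)) \<partial>M)"
  proof (rule nn_integral_cong_AE)
    show "AE x in M. ennreal ((cmod (g x))\<^sup>2) = liminf (\<lambda>k. ennreal ((cmod (h k x))\<^sup>2))"
      using lim
    proof eventually_elim
      case (elim x)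
      have "(\<lambda>k. ennreal ((cmod (h k x))\<^sup>2)) \<longlonglongrightarrow> ennreal ((cmod (g x))\<^sup>2)"
        by (intro tendsto_intros elim)
      from lim_imp_Liminf[OF sequentially_bot this] show ?case by simp
    qed
  qed
  also have "\<dots> \<le> liminf (\<lambda>k. \<integral>\<^sup>+x. ennreal ((cmod (h k x))\<^sup>2) \<partial>M)"
    by (rule nn_integral_liminf) measurable
  also have "\<dots> \<le> limsup (\<lambda>k. \<integral>\<^sup>+x. ennreal ((cmod (h k x))\<^sup>2) \<partial>M)"
    by (rule Liminf_le_Limsup) simp
  also have "\<dots> \<le> ennreal e"
  proof (rule Limsup_bounded)
    show "\<forall>\<^sub>F k in sequentially. (\<integral>\<^sup>+x. ennreal ((cmod (h k x))\<^sup>2) \<partial>M) \<le> ennreal e"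
      using le
    proof eventually_elim
      case (elim k)
      then show ?case
        using L2_integrable[OF h[of k]] by (simp add: nn_integral_eq_integral L2_sq_def ennreal_leI)
    qed
  qed
  finally have *: "(\<integral>\<^sup>+x. ennreal ((cmod (g x))\<^sup>2) \<partial>M) \<le> ennreal e" .
  then have int: "integrable M (\<lambda>x. (cmod (g x))\<^sup>2)"
    by (intro integrableI_bounded) (auto simp: less_top[symmetric] top_unique)
  then show "g \<in> L2 M" by (simp add: L2_def)
  show "L2_sq M g \<le> e"
    using * int \<open>0 \<le> e\<close> by (simp add: nn_integral_eq_integral L2_sq_def)
qed

text \<open>A subsequence with \<open>\<parallel>d\<^sub>k\<parallel>\<^sup>2 \<le> 8\<^sup>-\<^sup>k\<close> for its increments \<open>d\<^sub>k\<close> converges almost everywhere, since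
  \<open>\<Sum> 2\<^sup>k |d\<^sub>k|\<^sup>2\<close> is integrable and \<open>|d\<^sub>k| \<le> (2\<^sup>-\<^sup>k + 2\<^sup>k |d\<^sub>k|\<^sup>2) / 2\<close>.\<close>

theorem L2_complete:
  assumes f: "\<And>j. f j \<in> L2 M"
    and Cauchy: "\<And>e. e > 0 \<Longrightarrow> \<exists>N. \<forall>i\<ge>N. \<forall>j\<ge>N. L2_sq M (\<lambda>x. f i x - f j x) < e"
  obtains g where "g \<in> L2 M" "(\<lambda>j. L2_sq M (\<lambda>x. f j x - g x)) \<longlonglongrightarrow> 0"
proof -
  note [measurable] = L2_measurable[OF f]
  have "\<exists>N. \<forall>i\<ge>N. \<forall>j\<ge>N. L2_sq M (\<lambda>x. f i x - f j x) < 1 / 8 ^ k" for k by (rule Cauchy) simp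
  then obtain N where N: "\<And>k i j. i \<ge> N k \<Longrightarrow> j \<ge> N k \<Longrightarrow> L2_sq M (\<lambda>x. f i x - f j x) < 1 / 8 ^ k" by metis
  \<comment> \<open>Summing all the indices makes \<open>r k\<close> at least \<open>N k\<close> and
    at least \<open>k\<close>, and \<open>r (Suc k)\<close> at least \<open>N k\<close> too, so the
    increment \<open>d k\<close> falls under the bound belonging to \<open>N k\<close>.\<close>
  define r where "r k = k + (\<Sum>i\<le>k. N i)" for k
  have r: "N k \<le> r k" "k \<le> r k" "N k \<le> r (Suc k)" for k
    using member_le_sum[of k "{..k}" N] member_le_sum[of k "{..Suc k}" N] by (auto simp: r_def intro: trans_le_add2)
  define d where "d k x = f (r (Suc k)) x - f (r k) x" for k x
  have dL: "d k \<in> L2 M" for k unfolding d_def by (intro L2_diff f)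
  note [measurable] = L2_measurable[OF dL]
  have d: "L2_sq M (d k) < 1 / 8 ^ k" for k unfolding d_def by (intro N r)
  have "(\<integral>\<^sup>+x. (\<Sum>k. ennreal (2 ^ k * (cmod (d k x))\<^sup>2)) \<partial>M) = (\<Sum>k. \<integral>\<^sup>+x. ennreal (2 ^ k * (cmod (d k x))\<^sup>2) \<partial>M)"
    by (rule nn_integral_suminf) measurable
  also have "\<dots> = (\<Sum>k. ennreal (2 ^ k * L2_sq M (d k)))"
    using L2_integrable[OF dL] by (simp add: nn_integral_eq_integral L2_sq_def)
  also have "\<dots> \<le> (\<Sum>k. ennreal ((1 / 4) ^ k))"
  proof (intro suminf_le ennreal_leI)
    fix k
    have "2 ^ k * L2_sq M (d k) \<le> 2 ^ k * (1 / 8 ^ k)" using d[of k] by (intro mult_left_mono) auto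
    also have "\<dots> = (1 / 4) ^ k" by (simp add: power_divide power_mult_distrib[symmetric] field_simps)
    finally show "2 ^ k * L2_sq M (d k) \<le> (1 / 4) ^ k" .
  qed auto
  also have "\<dots> = ennreal (\<Sum>k. (1 / 4) ^ k)"
    by (rule suminf_ennreal2) (auto intro: summable_geometric)
  finally have "(\<integral>\<^sup>+x. (\<Sum>k. ennreal (2 ^ k * (cmod (d k x))\<^sup>2)) \<partial>M) \<noteq> \<infinity>"
    by (auto simp: top_unique)
  then have "AE x in M. (\<Sum>k. ennreal (2 ^ k * (cmod (d k x))\<^sup>2)) \<noteq> \<infinity>"
    by (intro nn_integral_PInf_AE) auto
  then have conv: "AE x in M. convergent (\<lambda>k. f (r k) x)"
  proof eventually_elim
    case (elim x)
    then have s: "summable (\<lambda>k. 2 ^ k * (cmod (d k x))\<^sup>2)"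
      by (intro summable_suminf_not_top) auto
    have "summable (\<lambda>k. ((1 / 2) ^ k + 2 ^ k * (cmod (d k x))\<^sup>2) / 2)"
      by (intro summable_divide summable_add s summable_geometric) simp
    then have "summable (\<lambda>k. d k x)"
    proof (rule summable_comparison_test'[where N = 0])
      fix k
      have "0 \<le> 2 ^ k * ((1 / 2) ^ k - cmod (d k x))\<^sup>2" by simp
      also have "\<dots> = (1 / 2) ^ k + 2 ^ k * (cmod (d k x))\<^sup>2 - 2 * cmod (d k x)"
        by (simp add: power2_eq_square algebra_simps power_divide)
      finally show "norm (d k x) \<le> ((1 / 2) ^ k + 2 ^ k * (cmod (d k x))\<^sup>2) / 2" by simp
    qed
    then have "convergent (\<lambda>n. \<Sum>k<n. d k x)" by (simp add: summable_iff_convergent)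
    moreover have "(\<Sum>k<n. d k x) = f (r n) x - f (r 0) x" for n
      unfolding d_def by (rule sum_lessThan_telescope)
    ultimately have "convergent (\<lambda>n. (f (r n) x - f (r 0) x) + f (r 0) x)"
      by (intro convergent_add convergent_const) simp
    then show ?case by simp
  qed
  define g where "g x = lim (\<lambda>k. f (r k) x)" for x
  have [measurable]: "g \<in> borel_measurable M" unfolding g_def by measurable
  have lim: "AE x in M. (\<lambda>k. f (r k) x) \<longlonglongrightarrow> g x"
    using conv by eventually_elim (simp add: g_def convergent_LIMSEQ_iff)
  \<comment> \<open>With \<open>j\<close> fixed, Fatou along the subsequence carries the Cauchy
    bound over to the limit; hence the whole sequence converges, not just the subsequence.\<close>
  have close: "(\<lambda>x. g x - f j x) \<in> L2 M \<and> L2_sq M (\<lambda>x. g x - f j x) \<le> e"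
    if j: "\<And>i. i \<ge> n \<Longrightarrow> L2_sq M (\<lambda>x. f i x - f j x) < e" for n j e
  proof -
    have "AE x in M. (\<lambda>k. f (r k) x - f j x) \<longlonglongrightarrow> g x - f j x"
      using lim by eventually_elim (intro tendsto_intros)
    moreover have "\<forall>\<^sub>F k in sequentially. L2_sq M (\<lambda>x. f (r k) x - f j x) \<le> e"
      using eventually_ge_at_top[of n]
      by eventually_elim (rule less_imp_le[OF j], use r(2) order_trans in blast)
    ultimately show ?thesis
      using L2_Fatou[of "\<lambda>k x. f (r k) x - f j x" M "\<lambda>x. g x - f j x" e] L2_diff[OF f f] by simp
  qed
  obtain n where "\<And>i. i \<ge> n \<Longrightarrow> L2_sq M (\<lambda>x. f i x - f n x) < 1" using Cauchy[of 1] by auto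
  from L2_add[OF conjunct1[OF close[OF this]] f[of n]] have g: "g \<in> L2 M" by simp
  moreover have "(\<lambda>j. L2_sq M (\<lambda>x. f j x - g x)) \<longlonglongrightarrow> 0"
  proof (rule LIMSEQ_I)
    fix e :: real assume "e > 0"
    then obtain n where n: "\<And>i j. i \<ge> n \<Longrightarrow> j \<ge> n \<Longrightarrow> L2_sq M (\<lambda>x. f i x - f j x) < e / 2"
      using Cauchy[of "e / 2"] by (auto simp: half_gt_zero)
    have "norm (L2_sq M (\<lambda>x. f j x - g x) - 0) < e" if "j \<ge> n" for j
    proof -
      have "L2_sq M (\<lambda>x. g x - f j x) \<le> e / 2" using close[of n j "e / 2"] n that by auto
      then show ?thesis using \<open>e > 0\<close> by (simp add: L2_sq_minus_commute[of M "f j"])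
    qed
    then show "\<exists>n. \<forall>j\<ge>n. norm (L2_sq M (\<lambda>x. f j x - g x) - 0) < e" by blast
  qed
  ultimately show ?thesis using that by blast
qed

text \<open>The orthogonal projection onto the closure of \<open>T\<close>, obtained from a minimizing sequence.\<close>

lemma L2_dense:
  assumes T: "T \<subseteq> L2 M" "T \<noteq> {}"
    and lin: "\<And>\<phi> \<psi> a b. \<phi> \<in> T \<Longrightarrow> \<psi> \<in> T \<Longrightarrow> (\<lambda>x. a * \<phi> x + b * \<psi> x) \<in> T"
    and orth: "\<And>q. q \<in> L2 M \<Longrightarrow> (\<And>\<phi>. \<phi> \<in> T \<Longrightarrow> (LINT x|M. q x * cnj (\<phi> x)) = 0) \<Longrightarrow> AE x in M. q x = 0"
    and g: "g \<in> L2 M"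
  obtains \<phi>s where "\<And>j. \<phi>s j \<in> T" "(\<lambda>j. L2_sq M (\<lambda>x. \<phi>s j x - g x)) \<longlonglongrightarrow> 0"
proof -
  define d where "d = Inf ((\<lambda>\<phi>. L2_sq M (\<lambda>x. g x - \<phi> x)) ` T)"
  have bdd: "bdd_below ((\<lambda>\<phi>. L2_sq M (\<lambda>x. g x - \<phi> x)) ` T)" by (auto intro!: bdd_belowI[of _ 0])
  have d_le: "d \<le> L2_sq M (\<lambda>x. g x - \<phi> x)" if "\<phi> \<in> T" for \<phi>
    unfolding d_def by (rule cInf_lower[OF _ bdd]) (use that in auto)
  have "\<exists>\<phi>\<in>T. L2_sq M (\<lambda>x. g x - \<phi> x) < d + inverse (real (Suc j))" for j
    using cInf_lessD[of "(\<lambda>\<phi>. L2_sq M (\<lambda>x. g x - \<phi> x)) ` T" "d + inverse (real (Suc j))"] T(2)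
    by (auto simp: d_def)
  then obtain \<phi>s where \<phi>s: "\<And>j. \<phi>s j \<in> T" "\<And>j. L2_sq M (\<lambda>x. g x - \<phi>s j x) < d + inverse (real (Suc j))" by metis
  have \<phi>L: "\<phi>s j \<in> L2 M" for j using \<phi>s T by auto
  \<comment> \<open>Parallelogram identity: the midpoint lies in \<open>T\<close>, so its squared
    distance from \<open>g\<close> is at least \<open>d\<close>, which forces a minimizing sequence
    to be Cauchy.\<close>
  have par: "L2_sq M (\<lambda>x. \<phi>s i x - \<phi>s j x) \<le> 2 * inverse (real (Suc i)) + 2 * inverse (real (Suc j))" for i j
  proof -
    let ?m = "\<lambda>x. (1/2) * \<phi>s i x + (1/2) * \<phi>s j x"
    have m: "?m \<in> T" by (intro lin \<phi>s)
    have e: "(cmod (b - a))\<^sup>2 = 2 * (cmod (c - a))\<^sup>2 + 2 * (cmod (c - b))\<^sup>2 - 4 * (cmod (c - ((1/2) * a + (1/2) * b)))\<^sup>2" for a b c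
      unfolding cmod_power2 by (simp add: power2_eq_square field_simps)
    have "L2_sq M (\<lambda>x. \<phi>s j x - \<phi>s i x)
       = 2 * L2_sq M (\<lambda>x. g x - \<phi>s i x) + 2 * L2_sq M (\<lambda>x. g x - \<phi>s j x) - 4 * L2_sq M (\<lambda>x. g x - ?m x)"
    proof -
      have "L2_sq M (\<lambda>x. \<phi>s j x - \<phi>s i x) = (LINT x|M. 2 * (cmod (g x - \<phi>s i x))\<^sup>2
          + 2 * (cmod (g x - \<phi>s j x))\<^sup>2 - 4 * (cmod (g x - ?m x))\<^sup>2)"
        unfolding L2_sq_def by (intro Bochner_Integration.integral_cong e refl)
      moreover have "(LINT x|M. 2 * A x + 2 * B x - 4 * C x) = 2 * (LINT x|M. A x) + 2 * (LINT x|M. B x) - 4 * (LINT x|M. C x)"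
        if "integrable M A" "integrable M B" "integrable M C" for A B C :: "'a \<Rightarrow> real"
        using that by simp
      moreover note this[OF L2_integrable[OF L2_diff[OF g \<phi>L]] L2_integrable[OF L2_diff[OF g \<phi>L]] L2_integrable[OF L2_diff[OF g subsetD[OF T(1) m]]]]
      ultimately show ?thesis by (simp only: L2_sq_def)
    qed
    also have "\<dots> \<le> 2 * (d + inverse (real (Suc i))) + 2 * (d + inverse (real (Suc j))) - 4 * d"
      by (intro diff_mono add_mono mult_left_mono d_le[OF m] less_imp_le[OF \<phi>s(2)]) auto
    also have "\<dots> = 2 * inverse (real (Suc i)) + 2 * inverse (real (Suc j))"
      by (simp only: distrib_left)
    finally show ?thesis unfolding L2_sq_minus_commute[of M "\<phi>s j"] .
  qed
  obtain p where p: "p \<in> L2 M" "(\<lambda>j. L2_sq M (\<lambda>x. \<phi>s j x - p x)) \<longlonglongrightarrow> 0"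
  proof (rule L2_complete[OF \<phi>L])
    fix e :: real assume "e > 0"
    then obtain N where N: "inverse (real (Suc N)) < e / 4"
      using reals_Archimedean[of "e / 4"] by auto
    have "inverse (real (Suc i)) < e / 4" if "i \<ge> N" for i
      by (rule le_less_trans[OF _ N]) (use that in \<open>simp add: field_simps\<close>)
    then show "\<exists>N. \<forall>i\<ge>N. \<forall>j\<ge>N. L2_sq M (\<lambda>x. \<phi>s i x - \<phi>s j x) < e"
    proof (intro exI[of _ N] allI impI)
      fix i j assume "N \<le> i" "N \<le> j"
      with \<open>\<And>i. N \<le> i \<Longrightarrow> _\<close> have "inverse (real (Suc i)) < e / 4" "inverse (real (Suc j)) < e / 4" by blast+
      with par[of i j] show "L2_sq M (\<lambda>x. \<phi>s i x - \<phi>s j x) < e" by linarith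
    qed
  qed
  define q where "q x = g x - p x" for x
  have q: "q \<in> L2 M" unfolding q_def by (intro L2_diff g p)
  have ge: "d \<le> L2_sq M (\<lambda>x. q x - t * \<phi> x)" if \<phi>: "\<phi> \<in> T" for \<phi> t
  proof (rule LIMSEQ_le_const)
    have \<phi>': "\<phi> \<in> L2 M" using \<phi> T by auto
    show "(\<lambda>j. L2_sq M (\<lambda>x. g x - (1 * \<phi>s j x + t * \<phi> x))) \<longlonglongrightarrow> L2_sq M (\<lambda>x. q x - t * \<phi> x)"
    proof (rule L2_sq_tendsto)
      have "L2_sq M (\<lambda>x. g x - (1 * \<phi>s j x + t * \<phi> x) - (q x - t * \<phi> x)) = L2_sq M (\<lambda>x. \<phi>s j x - p x)" for j
        unfolding q_def by (subst L2_sq_minus_commute[of M "\<phi>s j"]) (simp add: algebra_simps)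
      then show "(\<lambda>j. L2_sq M (\<lambda>x. g x - (1 * \<phi>s j x + t * \<phi> x) - (q x - t * \<phi> x))) \<longlonglongrightarrow> 0"
        using p(2) by simp
    qed (intro L2_diff L2_linear L2_cmult g \<phi>L \<phi>' q)+
    show "\<exists>N. \<forall>j\<ge>N. d \<le> L2_sq M (\<lambda>x. g x - (1 * \<phi>s j x + t * \<phi> x))"
      by (intro exI[of _ 0] allI impI d_le lin \<phi>s \<phi>)
  qed
  have "L2_sq M q \<le> d"
  proof (rule LIMSEQ_le)
    have "(\<lambda>j. d + inverse (real (Suc j))) \<longlonglongrightarrow> d + 0"
      by (intro tendsto_intros LIMSEQ_inverse_real_of_nat)
    then show "(\<lambda>j. d + inverse (real (Suc j))) \<longlonglongrightarrow> d" by simp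
    show "(\<lambda>j. L2_sq M (\<lambda>x. g x - \<phi>s j x)) \<longlonglongrightarrow> L2_sq M q"
    proof (rule L2_sq_tendsto)
      have "L2_sq M (\<lambda>x. g x - \<phi>s j x - q x) = L2_sq M (\<lambda>x. \<phi>s j x - p x)" for j
        unfolding q_def by (subst L2_sq_minus_commute[of M "\<phi>s j"]) (simp add: algebra_simps)
      then show "(\<lambda>j. L2_sq M (\<lambda>x. g x - \<phi>s j x - q x)) \<longlonglongrightarrow> 0" using p(2) by simp
    qed (intro L2_diff g \<phi>L q)+
    show "\<exists>N. \<forall>n\<ge>N. L2_sq M (\<lambda>x. g x - \<phi>s n x) \<le> d + inverse (real (Suc n))"
      using less_imp_le[OF \<phi>s(2)] by blast
  qed
  have "AE x in M. q x = 0"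
  proof (rule orth[OF q])
    fix \<phi> assume \<phi>: "\<phi> \<in> T"
    then have \<phi>': "\<phi> \<in> L2 M" using T by auto
    define I where "I = (LINT x|M. q x * cnj (\<phi> x))"
    \<comment> \<open>Moving by \<open>s * I\<close> along \<phi> changes the squared norm of
      \<open>q\<close> by s |I|^2 (s |\<phi>|^2 - 2), with |\<phi>| the L^2 norm. This is negative
      for the present \<open>s\<close> unless \<open>I = 0\<close>; the added 1 covers a \<phi> of
      norm 0.\<close>
    define s where "s = 1 / (L2_sq M \<phi> + 1)"
    have "0 < 1 / (l + 1) \<and> 1 / (l + 1) * l < 2" if "0 \<le> l" for l :: real
      using that by (simp add: divide_less_eq)
    from this[OF L2_sq_nonneg] have s: "s > 0" "s * L2_sq M \<phi> < 2"
      unfolding s_def by blast+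
    have "L2_sq M q \<le> L2_sq M (\<lambda>x. q x - (complex_of_real s * I) * \<phi> x)"
      using \<open>L2_sq M q \<le> d\<close> ge[OF \<phi>] by (rule order_trans)
    also have "\<dots> = L2_sq M q + (cmod (complex_of_real s * I))\<^sup>2 * L2_sq M \<phi>
        - 2 * Re (LINT x|M. q x * cnj ((complex_of_real s * I) * \<phi> x))"
      by (simp only: L2_sq_diff[OF q L2_cmult[OF \<phi>']] L2_sq_cmult)
    also have "(LINT x|M. q x * cnj ((complex_of_real s * I) * \<phi> x)) = cnj (complex_of_real s * I) * I"
      unfolding I_def by (simp add: mult.left_commute[of "q _"] mult.assoc)
    also have "Re (cnj (complex_of_real s * I) * I) = s * (cmod I)\<^sup>2"
      unfolding cmod_power2 by (simp add: power2_eq_square algebra_simps)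
    finally have "s * (cmod I)\<^sup>2 * 2 \<le> s * (cmod I)\<^sup>2 * (s * L2_sq M \<phi>)"
      using s by (simp add: norm_mult power_mult_distrib power2_eq_square mult_ac)
    moreover have "0 < s * (cmod I)\<^sup>2" if "I \<noteq> 0" using that s(1) by simp
    ultimately show "I = 0" using s(2) mult_le_cancel_left_pos by fastforce
  qed
  then have "AE x in M. p x = g x" by eventually_elim (simp add: q_def)
  then have "L2_sq M (\<lambda>x. \<phi>s j x - p x) = L2_sq M (\<lambda>x. \<phi>s j x - g x)" for j
    using \<phi>L p g by (intro L2_sq_cong_AE) (auto intro!: borel_measurable_diff L2_measurable)
  with p(2) have "(\<lambda>j. L2_sq M (\<lambda>x. \<phi>s j x - g x)) \<longlonglongrightarrow> 0" by simp
  with \<phi>s(1) show ?thesis by (rule that)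
qed

lemma schwartz_L2: "\<phi> \<in> schwartz \<Longrightarrow> \<phi> \<in> L2 lborel"
proof -
  assume \<phi>: "\<phi> \<in> schwartz"
  then obtain C where C: "\<And>x. cmod (\<phi> x) \<le> C"
    using schwartz_bound[OF \<phi>, of 0] by (metis mult_1 power_0)
  note [measurable] = schwartz_borel[OF \<phi>]
  have "integrable lborel (\<lambda>x. (cmod (\<phi> x))\<^sup>2)"
    by (rule Bochner_Integration.integrable_bound[OF integrable_mult_right[OF integrable_norm[OF schwartz_integrable[OF \<phi>]], of C]])
      (measurable, rule AE_I2, unfold real_norm_def, rule order_trans[OF _ abs_ge_self],
        use C in \<open>simp add: power2_eq_square mult_right_mono\<close>)
  then show ?thesis by (simp add: L2_def)
qed

text \<open>By the fundamental lemma nothing but 0 is orthogonal to all test functions, and a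
  trivial orthogonal complement means density.\<close>

lemma test_funs_dense_L2:
  fixes g :: "real^'n \<Rightarrow> complex"
  assumes "g \<in> L2 lborel"
  obtains \<phi>s where "\<And>j. \<phi>s j \<in> test_funs UNIV" "(\<lambda>j. L2_sq lborel (\<lambda>x. \<phi>s j x - g x)) \<longlonglongrightarrow> 0"
proof (rule L2_dense[where T = "test_funs UNIV"])
  show "test_funs UNIV \<subseteq> L2 (lborel :: (real^'n) measure)"
    using schwartz_L2 test_funs_schwartz by blast
  show "test_funs UNIV \<noteq> ({} :: (real^'n \<Rightarrow> complex) set)" using test_funs_zero by blast
  fix q :: "real^'n \<Rightarrow> complex"
  assume "q \<in> L2 lborel" "\<And>\<phi>. \<phi> \<in> test_funs UNIV \<Longrightarrow> (LINT x|lborel. q x * cnj (\<phi> x)) = 0"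
  then have "AE x in lborel. x \<in> UNIV \<longrightarrow> q x = 0"
    by (intro fundamental_lemma) (auto intro: L2_integrable_inner schwartz_L2 test_funs_schwartz)
  then show "AE x in lborel. q x = 0" by simp
qed (use assms test_funs_linear that in auto)

section \<open>The Fourier transform of square integrable functions\<close>

text \<open>A relation rather than a function, as transforms are fixed only up to null sets. The
  identity is the one behind \<open>fourier_dist\<close>, so a related pair represents a tempered
  distribution and its transform.\<close>

definition L2_fourier :: "(real^'n \<Rightarrow> complex) \<Rightarrow> (real^'n \<Rightarrow> complex) \<Rightarrow> bool" where
  "L2_fourier f g \<longleftrightarrow> f \<in> L2 lborel \<and> g \<in> L2 lborel \<and>
     (\<forall>\<psi>\<in>schwartz. (LINT \<xi>|lborel. g \<xi> * cnj (\<psi> \<xi>)) = (LINT x|lborel. f x * cnj (fourier_inv \<psi> x)))"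

lemma L2_fourierD:
  assumes "L2_fourier f g"
  shows "f \<in> L2 lborel" "g \<in> L2 lborel"
    and "\<psi> \<in> schwartz \<Longrightarrow> (LINT \<xi>|lborel. g \<xi> * cnj (\<psi> \<xi>)) = (LINT x|lborel. f x * cnj (fourier_inv \<psi> x))"
  using assms by (auto simp: L2_fourier_def)

lemma L2_fourier_schwartz: "\<phi> \<in> schwartz \<Longrightarrow> L2_fourier \<phi> (fourier \<phi>)"
  by (simp add: L2_fourier_def schwartz_L2 fourier_schwartz fourier_duality)

lemma L2_inner_linear_left:
  assumes "f \<in> L2 M" "g \<in> L2 M" "h \<in> L2 M"
  shows "(LINT x|M. (a * f x + b * g x) * cnj (h x)) = a * (LINT x|M. f x * cnj (h x)) + b * (LINT x|M. g x * cnj (h x))"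
  using L2_integrable_inner[OF assms(1,3)] L2_integrable_inner[OF assms(2,3)]
  by (simp add: distrib_right mult.assoc)

lemma L2_fourier_linear:
  assumes "L2_fourier f g" "L2_fourier f' g'"
  shows "L2_fourier (\<lambda>x. a * f x + b * f' x) (\<lambda>\<xi>. a * g \<xi> + b * g' \<xi>)"
  using assms
  by (simp add: L2_fourier_def L2_linear L2_inner_linear_left schwartz_L2 fourier_inv_schwartz)

lemma schwartz_orthogonal_AE_zero:
  fixes q :: "real^'n \<Rightarrow> complex"
  assumes "\<And>\<psi>. \<psi> \<in> schwartz \<Longrightarrow> integrable lborel (\<lambda>x. q x * cnj (\<psi> x))"
    and "\<And>\<psi>. \<psi> \<in> schwartz \<Longrightarrow> (LINT x|lborel. q x * cnj (\<psi> x)) = 0"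
  shows "AE x in lborel. q x = 0"
proof -
  have "AE x in lborel. x \<in> UNIV \<longrightarrow> q x = 0"
    by (intro fundamental_lemma) (auto intro: assms test_funs_schwartz)
  then show ?thesis by simp
qed

lemma L2_eq_AE_if_schwartz:
  fixes f g :: "real^'n \<Rightarrow> complex"
  assumes f: "f \<in> L2 lborel" and g: "g \<in> L2 lborel"
    and eq: "\<And>\<psi>. \<psi> \<in> schwartz \<Longrightarrow> (LINT x|lborel. f x * cnj (\<psi> x)) = (LINT x|lborel. g x * cnj (\<psi> x))"
  shows "AE x in lborel. f x = g x"
proof -
  have "AE x in lborel. f x - g x = 0"
  proof (rule schwartz_orthogonal_AE_zero)
    fix \<psi> :: "real^'n \<Rightarrow> complex" assume "\<psi> \<in> schwartz"
    then have \<psi>: "\<psi> \<in> L2 lborel" by (rule schwartz_L2)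
    show "integrable lborel (\<lambda>x. (f x - g x) * cnj (\<psi> x))"
      by (intro L2_integrable_inner[OF L2_diff] f g \<psi>)
    show "(LINT x|lborel. (f x - g x) * cnj (\<psi> x)) = 0"
      using L2_inner_linear_left[OF f g \<psi>, of 1 "-1"] eq[OF \<open>\<psi> \<in> schwartz\<close>] by simp
  qed
  then show ?thesis by simp
qed

lemma L2_fourier_inverse_unique:
  assumes "L2_fourier f g" "L2_fourier f' g"
  shows "AE x in lborel. f x = f' x"
proof (rule L2_eq_AE_if_schwartz)
  fix \<psi> :: "real^'a \<Rightarrow> complex" assume "\<psi> \<in> schwartz"
  then show "(LINT x|lborel. f x * cnj (\<psi> x)) = (LINT x|lborel. f' x * cnj (\<psi> x))"
    using L2_fourierD(3)[OF assms(1) fourier_schwartz] L2_fourierD(3)[OF assms(2) fourier_schwartz]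
    by (simp add: fourier_inversion)
qed (use assms in \<open>auto simp: L2_fourier_def\<close>)

lemma L2_sq_fourier_schwartz: "\<phi> \<in> schwartz \<Longrightarrow> L2_sq lborel (fourier \<phi>) = L2_sq lborel \<phi>"
  using fourier_parseval[of \<phi> \<phi>]
  by (simp only: L2_sq_def complex_norm_square[symmetric] integral_complex_of_real of_real_eq_iff)

lemma fourier_diff:
  assumes "\<phi> \<in> schwartz" "\<psi> \<in> schwartz"
  shows "fourier (\<lambda>x. \<phi> x - \<psi> x) = (\<lambda>\<xi>. fourier \<phi> \<xi> - fourier \<psi> \<xi>)"
  using integrable_character_mult(2)[OF schwartz_integrable[OF assms(1)]]
    integrable_character_mult(2)[OF schwartz_integrable[OF assms(2)]]
  by (intro ext) (simp add: fourier_eq right_diff_distrib)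

lemma schwartz_diff: "\<phi> \<in> schwartz \<Longrightarrow> \<psi> \<in> schwartz \<Longrightarrow> (\<lambda>x. \<phi> x - \<psi> x) \<in> schwartz"
  using schwartz_linear[of \<phi> \<psi> 1 "-1"] by simp

lemma L2_sq_fourier_diff:
  assumes "\<phi> \<in> schwartz" "\<psi> \<in> schwartz"
  shows "L2_sq lborel (\<lambda>\<xi>. fourier \<phi> \<xi> - fourier \<psi> \<xi>) = L2_sq lborel (\<lambda>x. \<phi> x - \<psi> x)"
  by (simp add: L2_sq_fourier_schwartz[OF schwartz_diff[OF assms], symmetric] fourier_diff[OF assms])

lemma L2_convergent_Cauchy:
  assumes f: "\<And>j. f j \<in> L2 M" and g: "g \<in> L2 M"
    and lim: "(\<lambda>j. L2_sq M (\<lambda>x. f j x - g x)) \<longlonglongrightarrow> 0" and "e > 0"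
  shows "\<exists>N. \<forall>i\<ge>N. \<forall>j\<ge>N. L2_sq M (\<lambda>x. f i x - f j x) < e"
proof -
  from \<open>e > 0\<close> have "e / 4 > 0" by simp
  from LIMSEQ_D[OF lim this] obtain N where "\<forall>n\<ge>N. norm (L2_sq M (\<lambda>x. f n x - g x) - 0) < e / 4" ..
  then have N: "L2_sq M (\<lambda>x. f n x - g x) < e / 4" if "n \<ge> N" for n using that by auto
  have "L2_sq M (\<lambda>x. f i x - f j x) < e" if "i \<ge> N" "j \<ge> N" for i j
    using L2_sq_triangle[OF f[of i] g f[of j]] N[OF that(1)] N[OF that(2)]
    by (simp add: L2_sq_minus_commute[of M g])
  then show ?thesis by blast
qed

text \<open>Both sides of the defining identity are continuous in L^2, so the graph is closed; in
  this way the transform extends from Schwartz functions.\<close>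

lemma L2_fourier_limit:
  assumes \<phi>: "\<And>j. L2_fourier (\<phi> j) (\<gamma> j)"
    and f: "f \<in> L2 lborel" "(\<lambda>j. L2_sq lborel (\<lambda>x. \<phi> j x - f x)) \<longlonglongrightarrow> 0"
    and g: "g \<in> L2 lborel" "(\<lambda>j. L2_sq lborel (\<lambda>x. \<gamma> j x - g x)) \<longlonglongrightarrow> 0"
  shows "L2_fourier f g"
  unfolding L2_fourier_def
proof (intro conjI ballI f(1) g(1))
  fix \<psi> :: "real^'a \<Rightarrow> complex" assume \<psi>: "\<psi> \<in> schwartz"
  note D = L2_fourierD[OF \<phi>]
  have "(\<lambda>j. LINT \<xi>|lborel. \<gamma> j \<xi> * cnj (\<psi> \<xi>)) \<longlonglongrightarrow> (LINT \<xi>|lborel. g \<xi> * cnj (\<psi> \<xi>))"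
    by (intro L2_inner_tendsto D g schwartz_L2 \<psi>)
  moreover have "(\<lambda>j. LINT x|lborel. \<phi> j x * cnj (fourier_inv \<psi> x)) \<longlonglongrightarrow> (LINT x|lborel. f x * cnj (fourier_inv \<psi> x))"
    by (intro L2_inner_tendsto D f schwartz_L2 fourier_inv_schwartz \<psi>)
  ultimately show "(LINT \<xi>|lborel. g \<xi> * cnj (\<psi> \<xi>)) = (LINT x|lborel. f x * cnj (fourier_inv \<psi> x))"
    unfolding D(3)[OF \<psi>] by (rule LIMSEQ_unique)
qed

lemma L2_fourier_exists_inverse:
  fixes g :: "real^'n \<Rightarrow> complex"
  assumes g: "g \<in> L2 lborel"
  obtains f where "L2_fourier f g" "L2_sq lborel f = L2_sq lborel g"
proof -
  obtain \<psi> where \<psi>: "\<And>j. \<psi> j \<in> test_funs UNIV" and lim: "(\<lambda>j. L2_sq lborel (\<lambda>x. \<psi> j x - g x)) \<longlonglongrightarrow> 0"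
    using test_funs_dense_L2[OF g] by blast
  have S: "\<psi> j \<in> schwartz" "fourier_inv (\<psi> j) \<in> schwartz" for j
    using \<psi> test_funs_schwartz fourier_inv_schwartz by blast+
  note L = schwartz_L2[OF S(1)] schwartz_L2[OF S(2)]
  have eq: "L2_sq lborel (\<lambda>x. fourier_inv (\<psi> i) x - fourier_inv (\<psi> j) x) = L2_sq lborel (\<lambda>x. \<psi> i x - \<psi> j x)" for i j
    using L2_sq_fourier_diff[OF S(2) S(2)] by (simp add: fourier_fourier_inv S)
  obtain f where f: "f \<in> L2 lborel" "(\<lambda>j. L2_sq lborel (\<lambda>x. fourier_inv (\<psi> j) x - f x)) \<longlonglongrightarrow> 0"
    by (rule L2_complete[OF L(2)]) (use L2_convergent_Cauchy[OF L(1) g lim] in \<open>auto simp: eq\<close>)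
  have F: "L2_fourier (fourier_inv (\<psi> j)) (\<psi> j)" for j
    using L2_fourier_schwartz[OF S(2)] by (simp add: fourier_fourier_inv S)
  have "L2_sq lborel f = L2_sq lborel g"
  proof (rule LIMSEQ_unique)
    show "(\<lambda>j. L2_sq lborel (fourier_inv (\<psi> j))) \<longlonglongrightarrow> L2_sq lborel f"
      by (intro L2_sq_tendsto L f)
    have "L2_sq lborel (fourier_inv (\<psi> j)) = L2_sq lborel (\<psi> j)" for j
      using L2_sq_fourier_schwartz[OF S(2)] by (simp add: fourier_fourier_inv S)
    then show "(\<lambda>j. L2_sq lborel (fourier_inv (\<psi> j))) \<longlonglongrightarrow> L2_sq lborel g"
      using L2_sq_tendsto[OF L(1) g lim] by simp
  qed
  with L2_fourier_limit[OF F f g lim] that show ?thesis by blast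
qed

lemma L2_fourier_exists:
  fixes f :: "real^'n \<Rightarrow> complex"
  assumes f: "f \<in> L2 lborel"
  obtains g where "L2_fourier f g"
proof -
  obtain \<phi> where \<phi>: "\<And>j. \<phi> j \<in> test_funs UNIV" and lim: "(\<lambda>j. L2_sq lborel (\<lambda>x. \<phi> j x - f x)) \<longlonglongrightarrow> 0"
    using test_funs_dense_L2[OF f] by blast
  have S: "\<phi> j \<in> schwartz" "fourier (\<phi> j) \<in> schwartz" for j
    using \<phi> test_funs_schwartz fourier_schwartz by blast+
  note L = schwartz_L2[OF S(1)] schwartz_L2[OF S(2)]
  obtain g where g: "g \<in> L2 lborel" "(\<lambda>j. L2_sq lborel (\<lambda>x. fourier (\<phi> j) x - g x)) \<longlonglongrightarrow> 0"
    by (rule L2_complete[OF L(2)])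
      (use L2_convergent_Cauchy[OF L(1) f lim] in \<open>auto simp: L2_sq_fourier_diff[OF S(1) S(1)]\<close>)
  from L2_fourier_limit[OF L2_fourier_schwartz[OF S(1)] f lim g] that show ?thesis by blast
qed

text \<open>The construction of an inverse transform supplies equality of norms for one particular
  preimage; uniqueness of the preimage carries it over to every related pair.\<close>

theorem L2_fourier_isometry:
  assumes "L2_fourier f g"
  shows "L2_sq lborel f = L2_sq lborel g"
proof -
  obtain f' where f': "L2_fourier f' g" "L2_sq lborel f' = L2_sq lborel g"
    using L2_fourier_exists_inverse[OF L2_fourierD(2)[OF assms]] by blast
  then show ?thesis
    using L2_sq_cong_AE[OF L2_measurable[OF L2_fourierD(1)[OF assms]] L2_measurable[OF L2_fourierD(1)[OF f'(1)]]
        L2_fourier_inverse_unique[OF assms f'(1)]] by simp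
qed

text \<open>Polarization: the isometry applied to f - f' gives the real parts, and replacing f' by i
  f' gives the imaginary parts.\<close>

lemma L2_fourier_inner:
  assumes "L2_fourier f g" "L2_fourier f' g'"
  shows "(LINT x|lborel. f x * cnj (f' x)) = (LINT \<xi>|lborel. g \<xi> * cnj (g' \<xi>))"
proof -
  have re: "Re (LINT x|lborel. f x * cnj (f' x)) = Re (LINT \<xi>|lborel. g \<xi> * cnj (g' \<xi>))"
    if "L2_fourier f g" "L2_fourier f' g'" for f g f' g' :: "real^'a \<Rightarrow> complex"
  proof -
    have "L2_sq lborel (\<lambda>x. f x - f' x) = L2_sq lborel (\<lambda>\<xi>. g \<xi> - g' \<xi>)"
      using L2_fourier_isometry[OF L2_fourier_linear[OF that, of 1 "-1"]] by simp
    then show ?thesis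
      using L2_sq_diff[OF L2_fourierD(1)[OF that(1)] L2_fourierD(1)[OF that(2)]]
        L2_sq_diff[OF L2_fourierD(2)[OF that(1)] L2_fourierD(2)[OF that(2)]]
        L2_fourier_isometry[OF that(1)] L2_fourier_isometry[OF that(2)] by simp
  qed
  have im: "Im z = Re (- \<i> * z)" for z by simp
  have "L2_fourier (\<lambda>x. \<i> * f' x) (\<lambda>\<xi>. \<i> * g' \<xi>)"
    using L2_fourier_linear[OF assms(2,2), of \<i> 0] by simp
  from re[OF assms(1) this]
  have "Re (- \<i> * (LINT x|lborel. f x * cnj (f' x))) = Re (- \<i> * (LINT \<xi>|lborel. g \<xi> * cnj (g' \<xi>)))"
    unfolding integral_mult_right_zero[symmetric] by (simp add: mult_ac)
  with re[OF assms] show ?thesis by (simp add: complex_eq_iff)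
qed

lemma L2_shift:
  fixes f :: "'a::euclidean_space \<Rightarrow> complex"
  assumes "f \<in> L2 lborel"
  shows "(\<lambda>x. f (x + a)) \<in> L2 lborel"
proof -
  have [measurable]: "f \<in> borel_measurable borel" using L2_measurable[OF assms] by simp
  show ?thesis using lborel_integrable_shift[OF L2_integrable[OF assms]] by (simp add: L2_def)
qed

text \<open>A substitution moves the shift onto the inverse transform of the Schwartz function,
  where it is the inverse transform of a modulated Schwartz function.\<close>

lemma L2_fourier_translate:
  fixes f g :: "real^'n \<Rightarrow> complex"
  assumes fg: "L2_fourier f g"
  shows "L2_fourier (\<lambda>x. f (x + a)) (\<lambda>\<xi>. iexp (a \<bullet> \<xi>) * g \<xi>)"
  unfolding L2_fourier_def
proof (intro conjI ballI)
  note [measurable] = L2_measurable[OF L2_fourierD(1)[OF fg], simplified] L2_measurable[OF L2_fourierD(2)[OF fg], simplified]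
  show "(\<lambda>x. f (x + a)) \<in> L2 lborel" by (rule L2_shift[OF L2_fourierD(1)[OF fg]])
  show "(\<lambda>\<xi>. iexp (a \<bullet> \<xi>) * g \<xi>) \<in> L2 lborel"
    by (rule L2_bound[OF _ L2_fourierD(2)[OF fg], of _ 1]) (auto simp: norm_mult)
  fix \<psi> :: "real^'n \<Rightarrow> complex" assume \<psi>: "\<psi> \<in> schwartz"
  note [measurable] = schwartz_borel[OF fourier_inv_schwartz[OF \<psi>]]
  have \<psi>a: "(\<lambda>\<xi>. iexp (- a \<bullet> \<xi>) * \<psi> \<xi>) \<in> schwartz" by (rule schwartz_mult_character[OF \<psi>])
  have shift: "fourier_inv \<psi> (x - a) = fourier_inv (\<lambda>\<xi>. iexp (- a \<bullet> \<xi>) * \<psi> \<xi>) x" for x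
  proof -
    have "iexp (- (- (x - a) \<bullet> \<xi>)) * \<psi> \<xi> = iexp (- (- x \<bullet> \<xi>)) * (iexp (- a \<bullet> \<xi>) * \<psi> \<xi>)" for \<xi>
      unfolding mult.assoc[symmetric] exp_add[symmetric]
      by (simp add: inner_diff_left right_diff_distrib)
    then show ?thesis unfolding fourier_inv_def fourier_eq by (simp only:)
  qed
  have "(LINT x|lborel. f (x + a) * cnj (fourier_inv \<psi> (x + a - a))) = (LINT x|lborel. f x * cnj (fourier_inv \<psi> (x - a)))"
    by (rule lborel_integral_shift) measurable
  also have "\<dots> = (LINT \<xi>|lborel. g \<xi> * cnj (iexp (- a \<bullet> \<xi>) * \<psi> \<xi>))"
    unfolding shift by (rule L2_fourierD(3)[OF fg \<psi>a, symmetric])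
  also have "\<dots> = (LINT \<xi>|lborel. iexp (a \<bullet> \<xi>) * g \<xi> * cnj (\<psi> \<xi>))"
    by (simp add: exp_cnj mult_ac)
  finally show "(LINT \<xi>|lborel. iexp (a \<bullet> \<xi>) * g \<xi> * cnj (\<psi> \<xi>)) = (LINT x|lborel. f (x + a) * cnj (fourier_inv \<psi> x))"
    by simp
qed

section \<open>Weak derivatives vanish almost everywhere on zero sets\<close>

lemma AE_lborel_shift:
  fixes a :: "'a::euclidean_space"
  assumes [measurable]: "Measurable.pred borel P" and "AE x in lborel. P x"
  shows "AE x in lborel. P (x + a)"
proof -
  have "AE x in distr lborel borel ((+) a). P x" using assms(2) unfolding lborel_distr_plus .
  then show ?thesis by (subst (asm) AE_distr_iff) (auto simp: add.commute)
qed

text \<open>Dominated convergence on the Fourier side; translations and difference quotients are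
  treated alike once both are written as multipliers.\<close>

lemma L2_sq_multiplier_tendsto:
  fixes g :: "real^'n \<Rightarrow> complex"
  assumes m: "\<And>k. m k \<in> borel_measurable borel" and g: "g \<in> borel_measurable borel"
    and w: "w \<in> L2 lborel"
    and bound: "\<And>k \<xi>. cmod (m k \<xi> * g \<xi>) \<le> cmod (w \<xi>)"
    and lim: "\<And>\<xi>. (\<lambda>k. m k \<xi>) \<longlonglongrightarrow> 0"
  shows "(\<lambda>k. L2_sq lborel (\<lambda>\<xi>. m k \<xi> * g \<xi>)) \<longlonglongrightarrow> 0"
proof -
  note [measurable] = m g L2_measurable[OF w, simplified]
  have "(\<lambda>k. LINT \<xi>|lborel. (cmod (m k \<xi> * g \<xi>))\<^sup>2) \<longlonglongrightarrow> (LINT (\<xi>::real^'n)|lborel. 0)"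
  proof (rule integral_dominated_convergence[where w = "\<lambda>\<xi>. (cmod (w \<xi>))\<^sup>2"])
    show "AE \<xi> in lborel. (\<lambda>k. (cmod (m k \<xi> * g \<xi>))\<^sup>2) \<longlonglongrightarrow> 0"
    proof (rule AE_I2)
      fix \<xi>
      have "(\<lambda>k. (cmod (m k \<xi> * g \<xi>))\<^sup>2) \<longlonglongrightarrow> (cmod (0 * g \<xi>))\<^sup>2"
        by (intro tendsto_intros lim)
      then show "(\<lambda>k. (cmod (m k \<xi> * g \<xi>))\<^sup>2) \<longlonglongrightarrow> 0" by simp
    qed
    show "AE \<xi> in lborel. norm ((cmod (m k \<xi> * g \<xi>))\<^sup>2) \<le> (cmod (w \<xi>))\<^sup>2" for k
      using bound by (intro AE_I2) (simp add: power_mono del: norm_mult)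
  qed (use L2_integrable[OF w] in \<open>auto\<close>)
  then show ?thesis by (simp add: L2_sq_def)
qed

lemma norm_iexp_minus_1_le: "cmod (iexp x - 1) \<le> \<bar>x\<bar>"
  using iexp_approx1[of x 0] by simp

text \<open>By the isometry the difference becomes multiplication by exp (i t e.\<xi>) - 1, which is
  bounded by 2 and tends to 0 pointwise.\<close>

lemma L2_translation_continuous:
  fixes f :: "real^'n \<Rightarrow> complex"
  assumes f: "f \<in> L2 lborel" and t: "t \<longlonglongrightarrow> 0"
  shows "(\<lambda>k. L2_sq lborel (\<lambda>x. f (x + t k *\<^sub>R e) - f x)) \<longlonglongrightarrow> 0"
proof -
  obtain g where fg: "L2_fourier f g" using L2_fourier_exists[OF f] .
  have "L2_sq lborel (\<lambda>x. f (x + t k *\<^sub>R e) - f x) = L2_sq lborel (\<lambda>\<xi>. (iexp (t k *\<^sub>R e \<bullet> \<xi>) - 1) * g \<xi>)" for k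
    using L2_fourier_isometry[OF L2_fourier_linear[OF L2_fourier_translate[OF fg] fg, of 1 "t k *\<^sub>R e" "-1"]]
    by (simp add: left_diff_distrib)
  moreover have "(\<lambda>k. L2_sq lborel (\<lambda>\<xi>. (iexp (t k *\<^sub>R e \<bullet> \<xi>) - 1) * g \<xi>)) \<longlonglongrightarrow> 0"
  proof (rule L2_sq_multiplier_tendsto)
    show "g \<in> borel_measurable borel" using L2_measurable[OF L2_fourierD(2)[OF fg]] by simp
    show "(\<lambda>\<xi>. 2 * g \<xi>) \<in> L2 lborel" by (intro L2_cmult L2_fourierD(2)[OF fg])
    show "cmod ((iexp (t k *\<^sub>R e \<bullet> \<xi>) - 1) * g \<xi>) \<le> cmod (2 * g \<xi>)" for k \<xi>
    proof -
      have "cmod (iexp (t k *\<^sub>R e \<bullet> \<xi>) - 1) \<le> 2"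
        using norm_triangle_ineq4[of "iexp (t k *\<^sub>R e \<bullet> \<xi>)" 1] by (simp only: norm_exp_i_times norm_one)
      then show ?thesis by (simp only: norm_mult norm_numeral mult_right_mono norm_ge_zero)
    qed
    show "(\<lambda>k. iexp (t k *\<^sub>R e \<bullet> \<xi>) - 1) \<longlonglongrightarrow> 0" for \<xi>
    proof (rule Lim_null_comparison)
      show "\<forall>\<^sub>F k in sequentially. norm (iexp (t k *\<^sub>R e \<bullet> \<xi>) - 1) \<le> \<bar>t k\<bar> * \<bar>e \<bullet> \<xi>\<bar>"
        using norm_iexp_minus_1_le[of "t _ *\<^sub>R e \<bullet> \<xi>"] by (auto simp: abs_mult)
      show "(\<lambda>k. \<bar>t k\<bar> * \<bar>e \<bullet> \<xi>\<bar>) \<longlonglongrightarrow> 0"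
        using tendsto_mult[OF tendsto_rabs[OF t] tendsto_const] by simp
    qed
  qed measurable
  ultimately show ?thesis by simp
qed

text \<open>Almost every point of \<open>A\<close> stays in \<open>A\<close> under the small translations of a suitable sequence, because
  translations act continuously on the indicator function in \<open>L\<^sup>2\<close>.\<close>

lemma AE_eventually_translate_mem:
  fixes A :: "(real^'n) set"
  assumes A [measurable]: "A \<in> sets borel" and fin: "emeasure lborel A < \<infinity>" and t: "t \<longlonglongrightarrow> 0"
  obtains r where "strict_mono (r :: nat \<Rightarrow> nat)"
    "AE x in lborel. x \<in> A \<longrightarrow> (\<forall>\<^sub>F k in sequentially. x + t (r k) *\<^sub>R e \<in> A)"
proof -
  define c where "c x = complex_of_real (indicator A x)" for x
  have [measurable]: "c \<in> borel_measurable borel" unfolding c_def by measurable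
  have sq: "(cmod (c x))\<^sup>2 = indicator A x" for x by (simp add: c_def indicator_def)
  have c: "c \<in> L2 lborel"
    unfolding L2_def using fin A by (simp add: sq)
  \<comment> \<open>\<open>u k\<close> takes only the values 0 and 1, with 1 where exactly one of
    the two points lies in \<open>A\<close>; a value below 1 therefore decides membership.\<close>
  define u where "u k x = (cmod (c (x + t k *\<^sub>R e) - c x))\<^sup>2" for k x
  have "\<exists>r::nat\<Rightarrow>nat. strict_mono r \<and> (AE x in lborel. (\<lambda>k. u (r k) x) \<longlonglongrightarrow> 0)"
  proof (rule tendsto_L1_AE_subseq)
    show "integrable lborel (u k)" for k
      unfolding u_def by (intro L2_integrable L2_diff L2_shift c)
    show "(\<lambda>k. LINT x|lborel. norm (u k x)) \<longlonglongrightarrow> 0"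
      using L2_translation_continuous[OF c t, of e] by (simp add: u_def L2_sq_def)
  qed
  then obtain r :: "nat \<Rightarrow> nat" where r: "strict_mono r" "AE x in lborel. (\<lambda>k. u (r k) x) \<longlonglongrightarrow> 0" by blast
  from r(2) have "AE x in lborel. x \<in> A \<longrightarrow> (\<forall>\<^sub>F k in sequentially. x + t (r k) *\<^sub>R e \<in> A)"
  proof eventually_elim
    case (elim x)
    then have "\<forall>\<^sub>F k in sequentially. u (r k) x < 1" by (rule order_tendstoD) simp
    then show ?case
    proof (intro impI, elim eventually_mono)
      fix k assume x: "x \<in> A" "u (r k) x < 1"
      show "x + t (r k) *\<^sub>R e \<in> A"
      proof (rule ccontr)
        assume "x + t (r k) *\<^sub>R e \<notin> A"
        with x show False by (simp add: u_def c_def)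
      qed
    qed
  qed
  with r(1) that show ?thesis by blast
qed

text \<open>The difference quotients of \<open>f\<close> converge to \<open>f'\<close> in L^2. Along
  a suitable sequence of steps almost every \<open>x\<close> in \<open>A\<close> has its translates
  eventually in \<open>A\<close>, where \<open>f\<close> vanishes; so the quotients at
  \<open>x\<close> are eventually 0, and Fatou's lemma forces \<open>f'\<close> to vanish
  there.\<close>

lemma L2_derivative_zero:
  fixes f f' g :: "real^'n \<Rightarrow> complex"
  assumes fg: "L2_fourier f g" and f'g: "L2_fourier f' (\<lambda>\<xi>. \<i> * complex_of_real (\<xi> $ j) * g \<xi>)"
    and A [measurable]: "A \<in> sets borel" and zero: "AE x in lborel. x \<in> A \<longrightarrow> f x = 0"
  shows "AE x in lborel. x \<in> A \<longrightarrow> f' x = 0"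
proof -
  let ?e = "axis j 1 :: real^'n"
  define t where "t k = inverse (real (Suc k))" for k
  have t_pos: "0 < t k" for k by (simp add: t_def)
  have t_lim: "t \<longlonglongrightarrow> 0" unfolding t_def by (rule LIMSEQ_inverse_real_of_nat)
  note L = L2_fourierD(1,2)[OF fg] L2_fourierD(1,2)[OF f'g]
  have [measurable]: "f \<in> borel_measurable borel" "f' \<in> borel_measurable borel" "g \<in> borel_measurable borel"
    using L by (auto dest: L2_measurable)
  define D where "D k x = complex_of_real (1 / t k) * f (x + t k *\<^sub>R ?e) + complex_of_real (- 1 / t k) * f x" for k x
  \<comment> \<open>The symbol of the \<open>k\<close>-th difference quotient minus that of the
    derivative. It is at most 2 |\<xi>_j| uniformly in \<open>k\<close>, and at most
    \<open>t k\<close> times \<xi>_j^2 for fixed \<xi>.\<close>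
  define m where "m k \<xi> = (iexp (t k * \<xi> $ j) - 1) / complex_of_real (t k) - \<i> * complex_of_real (\<xi> $ j)" for k and \<xi> :: "real^'n"
  have D: "L2_fourier (\<lambda>x. 1 * D k x + (-1) * f' x) (\<lambda>\<xi>. m k \<xi> * g \<xi>)" for k
  proof -
    have "L2_fourier (D k) (\<lambda>\<xi>. complex_of_real (1 / t k) * (iexp (t k *\<^sub>R ?e \<bullet> \<xi>) * g \<xi>) + complex_of_real (- 1 / t k) * g \<xi>)"
      unfolding D_def by (intro L2_fourier_linear L2_fourier_translate fg)
    from L2_fourier_linear[OF this f'g, of 1 "-1"]
    have "L2_fourier (\<lambda>x. 1 * D k x + (-1) * f' x) (\<lambda>\<xi>. 1 * (complex_of_real (1 / t k) * (iexp (t k *\<^sub>R ?e \<bullet> \<xi>) * g \<xi>)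
       + complex_of_real (- 1 / t k) * g \<xi>) + (-1) * (\<i> * complex_of_real (\<xi> $ j) * g \<xi>))" .
    moreover have "1 * (complex_of_real (1 / t k) * (iexp (t k *\<^sub>R ?e \<bullet> \<xi>) * g \<xi>)
       + complex_of_real (- 1 / t k) * g \<xi>) + (-1) * (\<i> * complex_of_real (\<xi> $ j) * g \<xi>) = m k \<xi> * g \<xi>" for \<xi>
      unfolding m_def by (simp add: inner_axis' field_simps diff_divide_distrib)
    ultimately show ?thesis by (simp only:)
  qed
  have m_lim: "(\<lambda>k. m k \<xi>) \<longlonglongrightarrow> 0" for \<xi>
  proof (rule Lim_null_comparison)
    show "\<forall>\<^sub>F k in sequentially. norm (m k \<xi>) \<le> t k * (\<xi> $ j)\<^sup>2"
    proof (rule always_eventually, rule)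
      fix k
      have "m k \<xi> = (iexp (t k * \<xi> $ j) - (\<Sum>i\<le>1. (\<i> * complex_of_real (t k * \<xi> $ j)) ^ i / fact i)) / complex_of_real (t k)"
        unfolding m_def using t_pos[of k] by (simp add: field_simps)
      then have "norm (m k \<xi>) = norm (iexp (t k * \<xi> $ j) - (\<Sum>i\<le>1. (\<i> * complex_of_real (t k * \<xi> $ j)) ^ i / fact i)) / t k"
        using t_pos[of k] by (simp only: norm_divide norm_of_real abs_of_pos)
      also have "\<dots> \<le> (\<bar>t k * \<xi> $ j\<bar> ^ Suc 1 / fact (Suc 1)) / t k"
        using t_pos[of k] by (intro divide_right_mono iexp_approx1) auto
      also have "\<dots> \<le> t k * (\<xi> $ j)\<^sup>2"
        using t_pos[of k] by (simp add: field_simps power2_eq_square abs_mult)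
      finally show "norm (m k \<xi>) \<le> t k * (\<xi> $ j)\<^sup>2" .
    qed
    show "(\<lambda>k. t k * (\<xi> $ j)\<^sup>2) \<longlonglongrightarrow> 0"
      using tendsto_mult[OF t_lim tendsto_const] by simp
  qed
  have "(\<lambda>k. L2_sq lborel (\<lambda>\<xi>. m k \<xi> * g \<xi>)) \<longlonglongrightarrow> 0"
  proof (rule L2_sq_multiplier_tendsto[OF _ _ _ _ m_lim])
    show "(\<lambda>\<xi>. 2 * (\<i> * complex_of_real (\<xi> $ j) * g \<xi>)) \<in> L2 lborel" by (intro L2_cmult L)
    show "cmod (m k \<xi> * g \<xi>) \<le> cmod (2 * (\<i> * complex_of_real (\<xi> $ j) * g \<xi>))" for k \<xi>
    proof -
      have "cmod (m k \<xi>) \<le> cmod (iexp (t k * \<xi> $ j) - 1) / t k + \<bar>\<xi> $ j\<bar>"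
        unfolding m_def using t_pos[of k]
        by (intro order_trans[OF norm_triangle_ineq4]) (simp add: norm_divide norm_mult)
      also have "\<dots> \<le> \<bar>t k * \<xi> $ j\<bar> / t k + \<bar>\<xi> $ j\<bar>"
        using t_pos[of k] by (intro add_right_mono divide_right_mono norm_iexp_minus_1_le) auto
      also have "\<dots> = 2 * \<bar>\<xi> $ j\<bar>" using t_pos[of k] by (simp add: abs_mult)
      finally have "cmod (m k \<xi>) * cmod (g \<xi>) \<le> 2 * \<bar>\<xi> $ j\<bar> * cmod (g \<xi>)"
        by (rule mult_right_mono) simp
      then show ?thesis by (simp add: norm_mult)
    qed
    show "m k \<in> borel_measurable borel" for k unfolding m_def by measurable
  qed measurable
  then have lim: "(\<lambda>k. L2_sq lborel (\<lambda>x. D k x - f' x)) \<longlonglongrightarrow> 0"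
    using L2_fourier_isometry[OF D] by simp
  have DL: "(\<lambda>x. D k x - f' x) \<in> L2 lborel" for k using L2_fourierD(1)[OF D] by simp
  have shift_zero: "AE x in lborel. \<forall>k. x + t k *\<^sub>R ?e \<in> A \<longrightarrow> f (x + t k *\<^sub>R ?e) = 0"
    unfolding AE_all_countable
  proof
    fix k
    show "AE x in lborel. x + t k *\<^sub>R ?e \<in> A \<longrightarrow> f (x + t k *\<^sub>R ?e) = 0"
      by (rule AE_lborel_shift[OF _ zero]) measurable
  qed
  \<comment> \<open>Almost every point stays in the set only for sets of finite measure, so
    \<open>A\<close> is cut off by balls.\<close>
  have on_bounded: "AE x in lborel. x \<in> A \<inter> cball 0 (real n) \<longrightarrow> f' x = 0" for n
  proof -
    let ?A = "A \<inter> cball 0 (real n) :: (real^'n) set"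
    have "emeasure lborel ?A \<le> emeasure lborel (cball 0 (real n) :: (real^'n) set)"
      by (intro emeasure_mono) auto
    then have "emeasure lborel ?A < \<infinity>"
      using emeasure_lborel_cball_finite le_less_trans by blast
    then obtain r where r: "strict_mono (r :: nat \<Rightarrow> nat)"
      "AE x in lborel. x \<in> ?A \<longrightarrow> (\<forall>\<^sub>F k in sequentially. x + t (r k) *\<^sub>R ?e \<in> ?A)"
      using AE_eventually_translate_mem[OF _ _ t_lim, of ?A ?e] by auto
    have [measurable]: "?A \<in> sets borel" by auto
    \<comment> \<open>The indicator confines the error to \<open>?A\<close>, where it tends to
      \<open>- f'\<close> pointwise, while its L^2 norm is at most that of the full error, which
      tends to 0.\<close>
    define h where "h k x = complex_of_real (indicator ?A x) * (D (r k) x - f' x)" for k x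
    have hL: "h k \<in> L2 lborel" for k
      unfolding h_def
      by (rule L2_bound[OF _ DL, of _ 1]) (auto simp: norm_mult indicator_def D_def)
    have h_le: "L2_sq lborel (h k) \<le> L2_sq lborel (\<lambda>x. D (r k) x - f' x)" for k
      unfolding L2_sq_def
      by (intro integral_mono L2_integrable hL DL) (auto simp: h_def norm_mult indicator_def)
    have h_lim: "AE x in lborel. (\<lambda>k. h k x) \<longlonglongrightarrow> complex_of_real (indicator ?A x) * (0 - f' x)"
      using r(2) shift_zero zero
    proof eventually_elim
      case (elim x)
      show ?case
      proof (cases "x \<in> ?A")
        case True
        with elim have "\<forall>\<^sub>F k in sequentially. x + t (r k) *\<^sub>R ?e \<in> ?A" by blast
        then have "\<forall>\<^sub>F k in sequentially. complex_of_real (indicator ?A x) * (0 - f' x) = h k x"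
        proof eventually_elim
          case (elim k)
          then have "f (x + t (r k) *\<^sub>R ?e) = 0" "f x = 0"
            using \<open>\<forall>k. _\<close> \<open>x \<in> A \<longrightarrow> f x = 0\<close> True by blast+
          then show ?case by (simp add: h_def D_def)
        qed
        then show ?thesis by (rule Lim_transform_eventually[OF tendsto_const])
      qed (simp add: h_def)
    qed
    have h0: "L2_sq lborel (\<lambda>x. complex_of_real (indicator ?A x) * (0 - f' x)) \<le> e"
      "(\<lambda>x. complex_of_real (indicator ?A x) * (0 - f' x)) \<in> L2 lborel" if "e > 0" for e
    proof -
      have "(\<lambda>k. L2_sq lborel (\<lambda>x. D (r k) x - f' x)) \<longlonglongrightarrow> 0"
        using LIMSEQ_subseq_LIMSEQ[OF lim r(1)] by (simp add: o_def)
      then have "\<forall>\<^sub>F k in sequentially. L2_sq lborel (\<lambda>x. D (r k) x - f' x) < e"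
        using \<open>e > 0\<close> by (rule order_tendstoD)
      then have "\<forall>\<^sub>F k in sequentially. L2_sq lborel (h k) \<le> e"
        by eventually_elim (use h_le less_imp_le order_trans in blast)
      moreover have "(\<lambda>x. complex_of_real (indicator ?A x) * (0 - f' x)) \<in> borel_measurable lborel"
        by measurable
      note L2_Fatou[OF hL this h_lim]
      ultimately
      show "L2_sq lborel (\<lambda>x. complex_of_real (indicator ?A x) * (0 - f' x)) \<le> e"
        "(\<lambda>x. complex_of_real (indicator ?A x) * (0 - f' x)) \<in> L2 lborel" by auto
    qed
    have "L2_sq lborel (\<lambda>x. complex_of_real (indicator ?A x) * (0 - f' x)) \<le> 0"
      by (rule field_le_epsilon) (use h0 in simp)
    then have "L2_sq lborel (\<lambda>x. complex_of_real (indicator ?A x) * (0 - f' x)) = 0"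
      using L2_sq_nonneg by (rule order_antisym)
    then have "AE x in lborel. complex_of_real (indicator ?A x) * (0 - f' x) = 0"
      using L2_sq_eq_0_iff[OF h0(2)[of 1]] by simp
    then show ?thesis by eventually_elim (auto simp: indicator_def split: if_splits)
  qed
  then have "AE x in lborel. \<forall>n. x \<in> A \<inter> cball 0 (real n) \<longrightarrow> f' x = 0"
    unfolding AE_all_countable by blast
  then show ?thesis
  proof eventually_elim
    case (elim x)
    obtain n where "norm x \<le> real n" using real_arch_simple by blast
    with elim show ?case by auto
  qed
qed

subsection \<open>Weighted square integrability and orthogonality\<close>

text \<open>Multiplication by the Japanese bracket to the power \<open>s\<close>, hence the halved
  exponent on its square. It turns the inner product of H^s into that of L^2.\<close>

definition japanese :: "real \<Rightarrow> (real^'n \<Rightarrow> complex) \<Rightarrow> (real^'n \<Rightarrow> complex)" where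
  "japanese s g = (\<lambda>\<xi>. complex_of_real ((1 + (norm \<xi>)\<^sup>2) powr (s / 2)) * g \<xi>)"

lemma japanese_pos: "0 < 1 + (norm \<xi>)\<^sup>2"
  by (simp add: add_pos_nonneg)

lemma japanese_measurable [measurable]:
  "g \<in> borel_measurable borel \<Longrightarrow> japanese s g \<in> borel_measurable borel"
  unfolding japanese_def by measurable

lemma cmod_japanese: "(cmod (japanese s g \<xi>))\<^sup>2 = (1 + (norm \<xi>)\<^sup>2) powr s * (cmod (g \<xi>))\<^sup>2"
  by (simp add: japanese_def norm_mult power_mult_distrib power2_eq_square[of "_ powr _"] flip: powr_add)

lemma japanese_mult_cnj:
  "japanese s g \<xi> * cnj (japanese s h \<xi>) = complex_of_real ((1 + (norm \<xi>)\<^sup>2) powr s) * g \<xi> * cnj (h \<xi>)"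
proof -
  have "complex_of_real ((1 + (norm \<xi>)\<^sup>2) powr (s / 2)) * complex_of_real ((1 + (norm \<xi>)\<^sup>2) powr (s / 2))
     = complex_of_real ((1 + (norm \<xi>)\<^sup>2) powr s)"
    unfolding of_real_mult[symmetric] powr_add[symmetric] by simp
  then show ?thesis by (simp add: japanese_def mult_ac)
qed

lemma japanese_zero_exponent: "japanese 0 g = g"
proof
  fix \<xi> :: "real^'a"
  have "1 + (norm \<xi>)\<^sup>2 \<noteq> 0" using japanese_pos[of \<xi>] by simp
  then show "japanese 0 g \<xi> = g \<xi>" by (simp add: japanese_def)
qed

lemma japanese_L2_mono:
  assumes "g \<in> borel_measurable borel" "japanese s g \<in> L2 lborel" "r \<le> s"
  shows "japanese r g \<in> L2 lborel"
proof (rule L2_bound[OF _ assms(2), of _ 1])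
  show "AE \<xi> in lborel. cmod (japanese r g \<xi>) \<le> 1 * cmod (japanese s g \<xi>)"
    using assms(3) by (intro AE_I2) (auto simp: japanese_def norm_mult intro!: mult_right_mono powr_mono)
qed (use assms(1) in measurable)

text \<open>The zero sets \<open>A\<close> and \<open>- A\<close> stay fixed while the induction
  replaces both functions by their \<open>j\<close>-th derivatives, which inherit them; for
  \<open>m = 0\<close> the product of the functions is 0 and Parseval's identity applies.\<close>

lemma orthogonal_of_complementary_zero_sets:
  fixes f\<^sub>1 g\<^sub>1 f\<^sub>2 g\<^sub>2 :: "real^'n \<Rightarrow> complex"
  assumes "L2_fourier f\<^sub>1 g\<^sub>1" "L2_fourier f\<^sub>2 g\<^sub>2"
    and "japanese (real m) g\<^sub>1 \<in> L2 lborel" "japanese (real m) g\<^sub>2 \<in> L2 lborel"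
    and A: "A \<in> sets borel"
    and "AE x in lborel. x \<in> A \<longrightarrow> f\<^sub>1 x = 0" "AE x in lborel. x \<in> - A \<longrightarrow> f\<^sub>2 x = 0"
  shows "(LINT \<xi>|lborel. japanese (real m) g\<^sub>1 \<xi> * cnj (japanese (real m) g\<^sub>2 \<xi>)) = 0"
  using assms(1-4,6,7)
proof (induction m arbitrary: f\<^sub>1 g\<^sub>1 f\<^sub>2 g\<^sub>2)
  case 0
  have "AE x in lborel. f\<^sub>1 x * cnj (f\<^sub>2 x) = 0"
    using 0(5,6) by eventually_elim auto
  then have "(LINT x|lborel. f\<^sub>1 x * cnj (f\<^sub>2 x)) = 0" by (rule integral_eq_zero_AE)
  then show ?case by (simp add: japanese_zero_exponent L2_fourier_inner[OF 0(1,2)])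
next
  case (Suc m)
  have [measurable]: "g\<^sub>1 \<in> borel_measurable borel" "g\<^sub>2 \<in> borel_measurable borel"
    using Suc.prems(1,2) by (auto dest!: L2_fourierD(2) L2_measurable)
  define p where "p j g \<xi> = \<i> * complex_of_real (\<xi> $ j) * g \<xi>" for j and g :: "real^'n \<Rightarrow> complex" and \<xi>
  have p_meas [measurable]: "g \<in> borel_measurable borel \<Longrightarrow> p j g \<in> borel_measurable borel" for j g
    unfolding p_def by measurable
  have pL: "japanese (real m) (p j g) \<in> L2 lborel"
    if g [measurable]: "g \<in> borel_measurable borel" and L: "japanese (real (Suc m)) g \<in> L2 lborel" for j g
  proof (rule L2_bound[OF _ L, of _ 1])
    show "AE \<xi> in lborel. cmod (japanese (real m) (p j g) \<xi>) \<le> 1 * cmod (japanese (real (Suc m)) g \<xi>)"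
    proof (rule AE_I2)
      fix \<xi> :: "real^'n"
      have "(cmod (p j g \<xi>))\<^sup>2 \<le> (1 + (norm \<xi>)\<^sup>2) * (cmod (g \<xi>))\<^sup>2"
      proof -
        have "(\<xi> $ j)\<^sup>2 \<le> (norm \<xi>)\<^sup>2"
          using component_le_norm_cart[of \<xi> j] abs_le_square_iff[of "\<xi> $ j" "norm \<xi>"] by simp
        then show ?thesis by (simp add: p_def norm_mult power_mult_distrib mult_right_mono)
      qed
      then have "(1 + (norm \<xi>)\<^sup>2) powr real m * (cmod (p j g \<xi>))\<^sup>2
         \<le> (1 + (norm \<xi>)\<^sup>2) powr real m * ((1 + (norm \<xi>)\<^sup>2) * (cmod (g \<xi>))\<^sup>2)"
        by (rule mult_left_mono) simp
      also have "\<dots> = (1 + (norm \<xi>)\<^sup>2) powr real (Suc m) * (cmod (g \<xi>))\<^sup>2"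
        using japanese_pos[of \<xi>] by (simp add: powr_add algebra_simps)
      finally have "(cmod (japanese (real m) (p j g) \<xi>))\<^sup>2 \<le> (cmod (japanese (real (Suc m)) g \<xi>))\<^sup>2"
        by (simp only: cmod_japanese)
      then show "cmod (japanese (real m) (p j g) \<xi>) \<le> 1 * cmod (japanese (real (Suc m)) g \<xi>)"
        by (simp add: power2_le_iff_abs_le)
    qed
  qed measurable
  \<comment> \<open>The symbol \<open>p j\<close> costs one order of the weight, so
    \<open>p j g\<close> is still in L^2 and has an inverse transform; this is the weak derivative,
    to which the result on zero sets applies.\<close>
  have derivative: "\<exists>f'. L2_fourier f' (p j g) \<and> (AE x in lborel. x \<in> B \<longrightarrow> f' x = 0)"
    if fg: "L2_fourier f g" and L: "japanese (real (Suc m)) g \<in> L2 lborel" and B: "B \<in> sets borel"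
      and z: "AE x in lborel. x \<in> B \<longrightarrow> f x = 0" for f g j B
  proof -
    have [measurable]: "g \<in> borel_measurable borel" using L2_measurable[OF L2_fourierD(2)[OF fg]] by simp
    have "p j g \<in> L2 lborel"
      using japanese_L2_mono[where r = 0, OF _ pL[OF _ L]] by (simp add: japanese_zero_exponent)
    then obtain f' where f': "L2_fourier f' (p j g)" using L2_fourier_exists_inverse by blast
    then show ?thesis using L2_derivative_zero[OF fg _ B z] unfolding p_def by blast
  qed
  have L': "japanese (real m) g\<^sub>1 \<in> L2 lborel" "japanese (real m) g\<^sub>2 \<in> L2 lborel"
    by (rule japanese_L2_mono[OF _ Suc.prems(3)], auto, rule japanese_L2_mono[OF _ Suc.prems(4)], auto)
  have IH0: "(LINT \<xi>|lborel. japanese (real m) g\<^sub>1 \<xi> * cnj (japanese (real m) g\<^sub>2 \<xi>)) = 0"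
    by (rule Suc.IH[OF Suc.prems(1,2) L' Suc.prems(5,6)])
  have IHj: "(LINT \<xi>|lborel. japanese (real m) (p j g\<^sub>1) \<xi> * cnj (japanese (real m) (p j g\<^sub>2) \<xi>)) = 0" for j
  proof -
    obtain f' where f': "L2_fourier f' (p j g\<^sub>1)" "AE x in lborel. x \<in> A \<longrightarrow> f' x = 0"
      using derivative[OF Suc.prems(1,3) A Suc.prems(5)] by blast
    have "- A \<in> sets borel" using A by auto
    then obtain f'' where f'': "L2_fourier f'' (p j g\<^sub>2)" "AE x in lborel. x \<in> - A \<longrightarrow> f'' x = 0"
      using derivative[OF Suc.prems(2,4) _ Suc.prems(6)] by blast
    show ?thesis
      by (rule Suc.IH[OF f'(1) f''(1) _ _ f'(2) f''(2)]) (auto intro!: pL Suc.prems)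
  qed
  have "japanese (real (Suc m)) g\<^sub>1 \<xi> * cnj (japanese (real (Suc m)) g\<^sub>2 \<xi>)
    = japanese (real m) g\<^sub>1 \<xi> * cnj (japanese (real m) g\<^sub>2 \<xi>)
      + (\<Sum>j\<in>UNIV. japanese (real m) (p j g\<^sub>1) \<xi> * cnj (japanese (real m) (p j g\<^sub>2) \<xi>))" for \<xi>
  proof -
    let ?w = "complex_of_real ((1 + (norm \<xi>)\<^sup>2) powr real m)"
    have "(norm \<xi>)\<^sup>2 = (\<Sum>j\<in>UNIV. \<xi> $ j * \<xi> $ j)"
      unfolding power2_norm_eq_inner inner_vec_def by simp
    then have n: "complex_of_real ((norm \<xi>)\<^sup>2) = (\<Sum>j\<in>UNIV. complex_of_real (\<xi> $ j) * complex_of_real (\<xi> $ j))"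
      by (simp only: of_real_sum of_real_mult)
    have "complex_of_real ((1 + (norm \<xi>)\<^sup>2) powr real (Suc m)) = ?w * (1 + complex_of_real ((norm \<xi>)\<^sup>2))"
      using japanese_pos[of \<xi>] by (simp add: powr_add)
    then have "complex_of_real ((1 + (norm \<xi>)\<^sup>2) powr real (Suc m)) * g\<^sub>1 \<xi> * cnj (g\<^sub>2 \<xi>)
      = ?w * g\<^sub>1 \<xi> * cnj (g\<^sub>2 \<xi>) + ?w * complex_of_real ((norm \<xi>)\<^sup>2) * g\<^sub>1 \<xi> * cnj (g\<^sub>2 \<xi>)"
      by (simp add: algebra_simps)
    also have "?w * complex_of_real ((norm \<xi>)\<^sup>2) * g\<^sub>1 \<xi> * cnj (g\<^sub>2 \<xi>)
      = (\<Sum>j\<in>UNIV. ?w * p j g\<^sub>1 \<xi> * cnj (p j g\<^sub>2 \<xi>))"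
      unfolding n p_def by (simp add: sum_distrib_left sum_distrib_right mult_ac)
    finally show ?thesis unfolding japanese_mult_cnj .
  qed
  then show ?case
    using IH0 IHj L' pL Suc.prems(3,4) by (simp add: L2_integrable_inner)
qed

section \<open>Sobolev spaces\<close>

subsection \<open>Linear structure\<close>

text \<open>This makes the choice in \<open>fourier_fun\<close> harmless: two representatives have
  equal integrals against all Schwartz functions.\<close>

lemma represented_by_unique:
  assumes "represented_by u g" "represented_by u h"
  shows "AE x in lborel. g x = h x"
proof -
  have "AE x in lborel. g x - h x = 0"
  proof (rule schwartz_orthogonal_AE_zero)
    fix \<psi> :: "real^'a \<Rightarrow> complex" assume \<psi>: "\<psi> \<in> schwartz"
    with assms have int: "integrable lborel (\<lambda>x. g x * cnj (\<psi> x))" "integrable lborel (\<lambda>x. h x * cnj (\<psi> x))"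
      by (auto simp: represented_by_def)
    have "of_function g \<psi> = of_function h \<psi>" using assms by (simp add: represented_by_def)
    with int \<psi> show "(LINT x|lborel. (g x - h x) * cnj (\<psi> x)) = 0" "integrable lborel (\<lambda>x. (g x - h x) * cnj (\<psi> x))"
      by (auto simp: of_function_def left_diff_distrib)
  qed
  then show ?thesis by simp
qed

lemma represented_by_linear:
  assumes "represented_by u g" "represented_by v h"
  shows "represented_by (\<lambda>\<phi>. a * u \<phi> + b * v \<phi>) (\<lambda>x. a * g x + b * h x)"
proof -
  have [measurable]: "g \<in> borel_measurable borel" "h \<in> borel_measurable borel"
    using assms by (auto simp: represented_by_def)
  have int: "\<psi> \<in> schwartz \<Longrightarrow> integrable lborel (\<lambda>x. g x * cnj (\<psi> x))" "\<psi> \<in> schwartz \<Longrightarrow> integrable lborel (\<lambda>x. h x * cnj (\<psi> x))" for \<psi>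
    using assms by (auto simp: represented_by_def)
  have u: "u = of_function g" "v = of_function h" using assms by (auto simp: represented_by_def)
  show ?thesis unfolding represented_by_def u
    by (auto simp: of_function_def fun_eq_iff distrib_right mult.assoc int)
qed

lemma tempered_linear:
  assumes u: "u \<in> tempered" and v: "v \<in> tempered"
  shows "(\<lambda>\<phi>. a * u \<phi> + b * v \<phi>) \<in> tempered"
proof -
  have "antilinear_on schwartz (\<lambda>\<phi>. a * u \<phi> + b * v \<phi>)"
    using u v unfolding tempered_def antilinear_on_def by (simp add: algebra_simps)
  moreover have "(\<lambda>j. a * u (\<phi>s j) + b * v (\<phi>s j)) \<longlonglongrightarrow> a * u \<phi> + b * v \<phi>" if "schwartz_conv \<phi>s \<phi>" for \<phi>s \<phi>
    using u v that unfolding tempered_def by (intro tendsto_intros) auto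
  ultimately show ?thesis using u v by (simp add: tempered_def)
qed

lemma Hs_tempered: "u \<in> Hs s \<Longrightarrow> u \<in> tempered"
  by (simp add: Hs_def)

lemma Hs_antilinear: "u \<in> Hs s \<Longrightarrow> antilinear_on schwartz u"
  by (simp add: Hs_def tempered_def)

lemma japanese_L2_iff:
  assumes "g \<in> borel_measurable borel"
  shows "japanese s g \<in> L2 lborel \<longleftrightarrow> integrable lborel (\<lambda>\<xi>. (1 + (norm \<xi>)\<^sup>2) powr s * (cmod (g \<xi>))\<^sup>2)"
  using japanese_measurable[OF assms, of s] by (simp add: L2_def cmod_japanese)

lemma Hs_fourier_fun_represents:
  assumes "u \<in> Hs s"
  shows "represented_by (fourier_dist u) (fourier_fun u)"
  using assms unfolding Hs_def fourier_fun_def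
  by (auto intro: someI[where P = "represented_by (fourier_dist u)"])

lemma fourier_fun_measurable: "u \<in> Hs s \<Longrightarrow> fourier_fun u \<in> borel_measurable borel"
  using Hs_fourier_fun_represents by (auto simp: represented_by_def)

lemma fourier_fun_AE:
  assumes "represented_by (fourier_dist u) g"
  shows "AE \<xi> in lborel. fourier_fun u \<xi> = g \<xi>"
proof (rule represented_by_unique[OF _ assms])
  show "represented_by (fourier_dist u) (fourier_fun u)"
    unfolding fourier_fun_def by (rule someI[where P = "represented_by (fourier_dist u)", OF assms])
qed

lemma japanese_AE_cong:
  "AE \<xi> in lborel. g \<xi> = h \<xi> \<Longrightarrow> AE \<xi> in lborel. japanese s g \<xi> = japanese s h \<xi>"
  by (auto elim!: eventually_mono simp: japanese_def)

lemma HsI: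
  assumes u: "u \<in> tempered" and g: "represented_by (fourier_dist u) g" "japanese s g \<in> L2 lborel"
  shows "u \<in> Hs s"
proof -
  have "g \<in> borel_measurable borel" using g by (simp add: represented_by_def)
  from japanese_L2_iff[OF this] g u show ?thesis unfolding Hs_def by auto
qed

lemma Hs_japanese_L2:
  assumes u: "u \<in> Hs s"
  shows "japanese s (fourier_fun u) \<in> L2 lborel"
proof -
  obtain g where g: "represented_by (fourier_dist u) g"
    and int: "integrable lborel (\<lambda>\<xi>. (1 + (norm \<xi>)\<^sup>2) powr s * (cmod (g \<xi>))\<^sup>2)"
    using u by (auto simp: Hs_def)
  have [measurable]: "g \<in> borel_measurable borel" using g by (simp add: represented_by_def)
  have [measurable]: "fourier_fun u \<in> borel_measurable borel" by (rule fourier_fun_measurable[OF u])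
  have "AE \<xi> in lborel. japanese s g \<xi> = japanese s (fourier_fun u) \<xi>"
    using japanese_AE_cong[OF fourier_fun_AE[OF g], of s] by eventually_elim simp
  moreover have "japanese s g \<in> L2 lborel" using int by (simp add: japanese_L2_iff)
  moreover have "japanese s (fourier_fun u) \<in> borel_measurable lborel" by measurable
  ultimately show ?thesis using L2_cong_AE by blast
qed

lemma fourier_dist_linear:
  "fourier_dist (\<lambda>\<phi>. a * u \<phi> + b * v \<phi>) = (\<lambda>\<phi>. a * fourier_dist u \<phi> + b * fourier_dist v \<phi>)"
  by (simp add: fourier_dist_def fun_eq_iff)

lemma japanese_linear:
  "japanese s (\<lambda>\<xi>. a * g \<xi> + b * h \<xi>) = (\<lambda>\<xi>. a * japanese s g \<xi> + b * japanese s h \<xi>)"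
  by (simp add: japanese_def fun_eq_iff algebra_simps)

lemma
  assumes u: "u \<in> Hs s" and v: "v \<in> Hs s"
  shows Hs_linear: "(\<lambda>\<phi>. a * u \<phi> + b * v \<phi>) \<in> Hs s"
    and fourier_fun_linear: "AE \<xi> in lborel. fourier_fun (\<lambda>\<phi>. a * u \<phi> + b * v \<phi>) \<xi> = a * fourier_fun u \<xi> + b * fourier_fun v \<xi>"
proof -
  have r: "represented_by (fourier_dist (\<lambda>\<phi>. a * u \<phi> + b * v \<phi>)) (\<lambda>\<xi>. a * fourier_fun u \<xi> + b * fourier_fun v \<xi>)"
    unfolding fourier_dist_linear
    by (intro represented_by_linear Hs_fourier_fun_represents[OF u] Hs_fourier_fun_represents[OF v])
  then show "AE \<xi> in lborel. fourier_fun (\<lambda>\<phi>. a * u \<phi> + b * v \<phi>) \<xi> = a * fourier_fun u \<xi> + b * fourier_fun v \<xi>"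
    by (rule fourier_fun_AE)
  show "(\<lambda>\<phi>. a * u \<phi> + b * v \<phi>) \<in> Hs s"
    by (rule HsI[OF tempered_linear r])
      (auto simp: japanese_linear intro: L2_linear Hs_japanese_L2 Hs_tempered u v)
qed

lemma Hs_diff: "u \<in> Hs s \<Longrightarrow> v \<in> Hs s \<Longrightarrow> (\<lambda>\<phi>. u \<phi> - v \<phi>) \<in> Hs s"
  using Hs_linear[of u s v 1 "-1"] by simp

lemma Hs_zero: "(\<lambda>\<phi>. 0) \<in> Hs s"
proof (rule HsI)
  show "(\<lambda>\<phi>. 0) \<in> tempered" by (simp add: tempered_def antilinear_on_def)
  show "represented_by (fourier_dist (\<lambda>\<phi>. 0)) (\<lambda>\<xi>. 0)"
    by (simp add: represented_by_def fourier_dist_def of_function_def fun_eq_iff)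
qed (simp add: japanese_def L2_zero)

lemma Hs_norm_eq: "Hs_norm s u = sqrt (L2_sq lborel (japanese s (fourier_fun u)))"
  by (simp add: Hs_norm_def L2_sq_def cmod_japanese)

lemma Hs_inner_eq:
  "Hs_inner s u v = (LINT \<xi>|lborel. japanese s (fourier_fun u) \<xi> * cnj (japanese s (fourier_fun v) \<xi>))"
  by (simp add: Hs_inner_def japanese_mult_cnj)

lemma Hs_norm_nonneg: "0 \<le> Hs_norm s u"
  by (simp add: Hs_norm_eq)

lemma Hs_norm_sq: "(Hs_norm s u)\<^sup>2 = L2_sq lborel (japanese s (fourier_fun u))"
  by (simp add: Hs_norm_eq)

lemma japanese_fourier_fun_diff:
  assumes "u \<in> Hs s" "v \<in> Hs s"
  shows "AE \<xi> in lborel. japanese s (fourier_fun (\<lambda>\<phi>. u \<phi> - v \<phi>)) \<xi>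
    = japanese s (fourier_fun u) \<xi> - japanese s (fourier_fun v) \<xi>"
  using japanese_AE_cong[OF fourier_fun_linear[OF assms, of 1 "-1"], of s]
  by eventually_elim (simp add: japanese_def right_diff_distrib)

lemma Hs_norm_diff_sq:
  assumes u: "u \<in> Hs s" and v: "v \<in> Hs s"
  shows "(Hs_norm s (\<lambda>\<phi>. u \<phi> - v \<phi>))\<^sup>2 = L2_sq lborel (\<lambda>\<xi>. japanese s (fourier_fun u) \<xi> - japanese s (fourier_fun v) \<xi>)"
  unfolding Hs_norm_sq
  by (rule L2_sq_cong_AE[OF L2_measurable L2_measurable japanese_fourier_fun_diff[OF u v]];
      intro Hs_japanese_L2 Hs_diff L2_diff u v)

lemma Hs_norm_minus_commute:
  assumes "u \<in> Hs s" "v \<in> Hs s"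
  shows "Hs_norm s (\<lambda>\<phi>. u \<phi> - v \<phi>) = Hs_norm s (\<lambda>\<phi>. v \<phi> - u \<phi>)"
  by (rule power2_eq_imp_eq)
    (auto simp: Hs_norm_diff_sq assms Hs_norm_nonneg intro: L2_sq_minus_commute)

lemma Hs_inner_commute: "Hs_inner s v u = cnj (Hs_inner s u v)"
proof -
  have "cnj (Hs_inner s u v) = (LINT \<xi>|lborel. cnj (japanese s (fourier_fun u) \<xi> * cnj (japanese s (fourier_fun v) \<xi>)))"
    unfolding Hs_inner_eq by (rule Bochner_Integration.integral_cnj[symmetric])
  then show ?thesis by (simp add: Hs_inner_eq mult.commute)
qed

lemma Hs_inner_linear_left:
  assumes "u \<in> Hs s" "v \<in> Hs s" "w \<in> Hs s"
  shows "Hs_inner s (\<lambda>\<phi>. a * u \<phi> + b * v \<phi>) w = a * Hs_inner s u w + b * Hs_inner s v w"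
proof -
  note L = Hs_japanese_L2[OF assms(1)] Hs_japanese_L2[OF assms(2)] Hs_japanese_L2[OF assms(3)]
  note M = L[THEN L2_measurable] Hs_japanese_L2[OF Hs_linear[OF assms(1,2)], THEN L2_measurable]
  have "Hs_inner s (\<lambda>\<phi>. a * u \<phi> + b * v \<phi>) w = (LINT \<xi>|lborel.
    (a * japanese s (fourier_fun u) \<xi> + b * japanese s (fourier_fun v) \<xi>) * cnj (japanese s (fourier_fun w) \<xi>))"
    unfolding Hs_inner_eq
  proof (rule integral_cong_AE)
    show "AE \<xi> in lborel. japanese s (fourier_fun (\<lambda>\<phi>. a * u \<phi> + b * v \<phi>)) \<xi> * cnj (japanese s (fourier_fun w) \<xi>)
      = (a * japanese s (fourier_fun u) \<xi> + b * japanese s (fourier_fun v) \<xi>) * cnj (japanese s (fourier_fun w) \<xi>)"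
      using japanese_AE_cong[OF fourier_fun_linear[OF assms(1,2), of a b], of s]
      by eventually_elim (simp add: japanese_linear)
  qed (use M in \<open>auto intro!: borel_measurable_times borel_measurable_cnj borel_measurable_add borel_measurable_const\<close>)
  also have "\<dots> = a * Hs_inner s u w + b * Hs_inner s v w"
    unfolding Hs_inner_eq by (rule L2_inner_linear_left[OF L])
  finally show ?thesis .
qed

lemma Hs_inner_diff_left:
  assumes "u \<in> Hs s" "v \<in> Hs s" "w \<in> Hs s"
  shows "Hs_inner s (\<lambda>\<phi>. u \<phi> - v \<phi>) w = Hs_inner s u w - Hs_inner s v w"
  using Hs_inner_linear_left[OF assms, of 1 "-1"] by simp

lemma Hs_inner_self: "Hs_inner s u u = complex_of_real ((Hs_norm s u)\<^sup>2)"
  unfolding Hs_inner_eq Hs_norm_sq L2_sq_def complex_norm_square[symmetric] integral_complex_of_real ..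

lemma Hs_eq_zero_if_fourier_fun_zero:
  assumes u: "u \<in> Hs s" and z: "AE \<xi> in lborel. fourier_fun u \<xi> = 0"
  shows "u = (\<lambda>\<phi>. 0)"
proof
  fix \<phi> :: "real^'a \<Rightarrow> complex"
  show "u \<phi> = 0"
  proof (cases "\<phi> \<in> schwartz")
    case True
    \<comment> \<open>By inversion \<phi> is \<open>fourier_inv\<close> of its transform, so
      \<open>u\<close> is recovered from its Fourier side.\<close>
    have "u \<phi> = fourier_dist u (fourier \<phi>)"
      using True by (simp add: fourier_dist_def fourier_schwartz fourier_inversion)
    also have "\<dots> = (LINT \<xi>|lborel. fourier_fun u \<xi> * cnj (fourier \<phi> \<xi>))"
      using Hs_fourier_fun_represents[OF u] True
      by (simp add: represented_by_def of_function_def fourier_schwartz)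
    also have "\<dots> = 0"
      by (rule integral_eq_zero_AE) (use z in eventually_elim, simp)
    finally show ?thesis .
  qed (use Hs_tempered[OF u] in \<open>simp add: tempered_def\<close>)
qed

lemma Hs_norm_eq_0_iff:
  assumes u: "u \<in> Hs s"
  shows "Hs_norm s u = 0 \<longleftrightarrow> u = (\<lambda>\<phi>. 0)"
proof
  assume "Hs_norm s u = 0"
  then have "AE \<xi> in lborel. japanese s (fourier_fun u) \<xi> = 0"
    using L2_sq_eq_0_iff[OF Hs_japanese_L2[OF u]] by (simp add: Hs_norm_eq)
  then have "AE \<xi> in lborel. fourier_fun u \<xi> = 0"
  proof eventually_elim
    case (elim \<xi>)
    have "1 + (norm \<xi>)\<^sup>2 \<noteq> 0" using japanese_pos[of \<xi>] by simp
    with elim show ?case by (simp add: japanese_def)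
  qed
  then show "u = (\<lambda>\<phi>. 0)" by (rule Hs_eq_zero_if_fourier_fun_zero[OF u])
next
  assume "u = (\<lambda>\<phi>. 0)"
  then have "Hs_norm s u = Hs_norm s (\<lambda>\<phi>. 0 * u \<phi> + 0 * u \<phi>)" by simp
  also have "\<dots> = 0"
    unfolding Hs_norm_eq using japanese_AE_cong[OF fourier_fun_linear[OF u u, of 0 0], of s]
      L2_sq_eq_0_iff[OF Hs_japanese_L2[OF Hs_linear[OF u u, of 0 0]]]
    by (simp add: japanese_def)
  finally show "Hs_norm s u = 0" .
qed

subsection \<open>Nonnegative orders\<close>

text \<open>The weight of order 2n bounds the difference by a small multiple of
  \<open>decay\<close>, and the square of \<open>decay\<close> is at most \<open>decay\<close>,
  which is integrable.\<close>

lemma schwartz_conv_L2: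
  fixes \<phi> :: "real^'n \<Rightarrow> complex"
  assumes conv: "schwartz_conv \<phi>s \<phi>"
  shows "(\<lambda>j. L2_sq lborel (\<lambda>x. \<phi>s j x - \<phi> x)) \<longlonglongrightarrow> 0"
proof -
  have S: "\<phi>s j \<in> schwartz" "\<phi> \<in> schwartz" for j using conv by (auto simp: schwartz_conv_def)
  let ?N = "2 * CARD('n)"
  have "uniform_limit UNIV (\<lambda>j x. (1 + norm x) ^ ?N *\<^sub>R partials [] (\<phi>s j) x)
      (\<lambda>x. (1 + norm x) ^ ?N *\<^sub>R partials [] \<phi> x) sequentially"
    using conv unfolding schwartz_conv_def by blast
  then have ul: "uniform_limit UNIV (\<lambda>j x. (1 + norm x) ^ ?N *\<^sub>R \<phi>s j x) (\<lambda>x. (1 + norm x) ^ ?N *\<^sub>R \<phi> x) sequentially"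
    by simp
  let ?I = "LINT x|lborel. decay (x :: real^'n)"
  have decay_le_1: "decay x \<le> 1" for x :: "real^'n"
    unfolding decay_def by (intro inverse_le_1_iff[THEN iffD2] disjI2 one_le_power) simp
  have bound: "\<forall>\<^sub>F j in sequentially. L2_sq lborel (\<lambda>x. \<phi>s j x - \<phi> x) \<le> e\<^sup>2 * ?I" if "e > 0" for e
    using uniform_limitD[OF ul \<open>e > 0\<close>]
  proof eventually_elim
    case (elim j)
    have "(cmod (\<phi>s j x - \<phi> x))\<^sup>2 \<le> e\<^sup>2 * decay x" for x
    proof -
      have "(1 + norm x) ^ ?N * cmod (\<phi>s j x - \<phi> x) = norm ((1 + norm x) ^ ?N *\<^sub>R (\<phi>s j x - \<phi> x))"
        by simp
      also have "\<dots> < e"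
        using elim by (simp only: dist_norm scaleR_diff_right UNIV_I Ball_def)
      finally have "cmod (\<phi>s j x - \<phi> x) \<le> e * decay x"
        by (simp add: decay_def field_simps add_pos_nonneg)
      then have "(cmod (\<phi>s j x - \<phi> x))\<^sup>2 \<le> (e * decay x)\<^sup>2" by (intro power_mono) auto
      also have "\<dots> = e\<^sup>2 * (decay x * decay x)" by (simp add: power2_eq_square)
      also have "\<dots> \<le> e\<^sup>2 * (1 * decay x)"
        using decay_pos[of x] decay_le_1 by (intro mult_left_mono mult_right_mono) auto
      finally show ?thesis by simp
    qed
    then have "L2_sq lborel (\<lambda>x. \<phi>s j x - \<phi> x) \<le> (LINT x|lborel. e\<^sup>2 * decay (x :: real^'n))"
      unfolding L2_sq_def
      by (intro integral_mono L2_integrable L2_diff schwartz_L2 S integrable_mult_right integrable_decay)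
    then show ?case by simp
  qed
  have I: "0 \<le> ?I" by (rule integral_nonneg_AE) (auto intro: less_imp_le decay_pos)
  show ?thesis
  proof (rule LIMSEQ_I)
    fix e :: real assume "e > 0"
    \<comment> \<open>Chosen so that d^2 times the integral of \<open>decay\<close> stays below
      \<open>e\<close>; with the added 1, nonnegativity of that integral is enough for a positive
      denominator.\<close>
    define d where "d = sqrt (e / (2 * (?I + 1)))"
    have "d > 0" using \<open>e > 0\<close> I by (simp add: d_def)
    have "d\<^sup>2 * ?I < e"
      using \<open>e > 0\<close> I by (simp add: d_def field_simps add_strict_increasing)
    with bound[OF \<open>d > 0\<close>] have "\<forall>\<^sub>F j in sequentially. L2_sq lborel (\<lambda>x. \<phi>s j x - \<phi> x) < e"
      by (auto elim!: eventually_mono)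
    then show "\<exists>n. \<forall>j\<ge>n. norm (L2_sq lborel (\<lambda>x. \<phi>s j x - \<phi> x) - 0) < e"
      by (simp add: eventually_sequentially)
  qed
qed

lemma L2_represents:
  assumes "f \<in> L2 lborel"
  shows "represented_by (of_function f) f"
  using L2_measurable[OF assms] assms by (auto simp: represented_by_def L2_integrable_inner schwartz_L2)

lemma L2_tempered:
  fixes f :: "real^'n \<Rightarrow> complex"
  assumes f: "f \<in> L2 lborel"
  shows "of_function f \<in> tempered"
proof -
  \<comment> \<open>Read as the conjugate of an inner product with \<phi> on the left, the
    functional falls under the results on linearity and continuity in the left argument.\<close>
  have of: "of_function f \<phi> = cnj (LINT x|lborel. \<phi> x * cnj (f x))" if "\<phi> \<in> schwartz" for \<phi>
  proof -
    have "cnj (LINT x|lborel. \<phi> x * cnj (f x)) = (LINT x|lborel. cnj (\<phi> x * cnj (f x)))"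
      by (rule Bochner_Integration.integral_cnj[symmetric])
    then show ?thesis using that by (simp add: of_function_def mult.commute)
  qed
  have "antilinear_on schwartz (of_function f)"
    unfolding antilinear_on_def
    by (intro ballI allI) (simp add: of schwartz_linear L2_inner_linear_left schwartz_L2 f)
  moreover have "(\<lambda>j. of_function f (\<phi>s j)) \<longlonglongrightarrow> of_function f \<phi>" if conv: "schwartz_conv \<phi>s \<phi>" for \<phi>s \<phi>
  proof -
    have S: "\<phi>s j \<in> schwartz" "\<phi> \<in> schwartz" for j using conv by (auto simp: schwartz_conv_def)
    show ?thesis unfolding of[OF S(1)] of[OF S(2)]
      by (intro tendsto_cnj L2_inner_tendsto schwartz_L2 S f schwartz_conv_L2 conv)
  qed
  ultimately show ?thesis by (auto simp: tempered_def of_function_def)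
qed

lemma
  assumes fg: "L2_fourier f g" and s: "0 \<le> s" and g: "japanese s g \<in> L2 lborel"
  shows L2_fourier_Hs: "of_function f \<in> Hs s"
    and L2_fourier_fourier_fun: "AE \<xi> in lborel. fourier_fun (of_function f) \<xi> = g \<xi>"
proof -
  note L = L2_fourierD(1,2)[OF fg]
  have "fourier_dist (of_function f) = of_function g"
    by (auto simp: fourier_dist_def of_function_def fun_eq_iff fourier_inv_schwartz L2_fourierD(3)[OF fg])
  then have r: "represented_by (fourier_dist (of_function f)) g"
    using L2_represents[OF L(2)] by simp
  then show "AE \<xi> in lborel. fourier_fun (of_function f) \<xi> = g \<xi>" by (rule fourier_fun_AE)
  show "of_function f \<in> Hs s" by (rule HsI[OF L2_tempered[OF L(1)] r g])
qed

text \<open>For \<open>0 \<le> s\<close> the weight is at least 1, so the transform of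
  \<open>u\<close> is itself in L^2 and its inverse transform is a function that represents
  \<open>u\<close>.\<close>

lemma Hs_L2_fourier:
  assumes u: "u \<in> Hs s" and s: "0 \<le> s"
  obtains f where "L2_fourier f (fourier_fun u)" "u = of_function f"
proof -
  have "fourier_fun u \<in> L2 lborel"
    using japanese_L2_mono[OF fourier_fun_measurable[OF u] Hs_japanese_L2[OF u] s]
    by (simp add: japanese_zero_exponent)
  then obtain f where f: "L2_fourier f (fourier_fun u)" using L2_fourier_exists_inverse by blast
  have "u = of_function f"
  proof
    fix \<phi> :: "real^'a \<Rightarrow> complex"
    show "u \<phi> = of_function f \<phi>"
    proof (cases "\<phi> \<in> schwartz")
      case True
      have "u \<phi> = fourier_dist u (fourier \<phi>)"
        using True by (simp add: fourier_dist_def fourier_schwartz fourier_inversion)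
      also have "\<dots> = (LINT \<xi>|lborel. fourier_fun u \<xi> * cnj (fourier \<phi> \<xi>))"
        using Hs_fourier_fun_represents[OF u] True
        by (simp add: represented_by_def of_function_def fourier_schwartz)
      also have "\<dots> = of_function f \<phi>"
        using L2_fourierD(3)[OF f fourier_schwartz[OF True]] True
        by (simp add: fourier_inversion of_function_def)
      finally show ?thesis .
    qed (use Hs_tempered[OF u] in \<open>simp add: tempered_def of_function_def\<close>)
  qed
  with f that show ?thesis by blast
qed

text \<open>In the square of |\<phi>| one factor absorbs the weight, estimated by the 2k-th power of
  1 + |\<xi>| with an integer k \<ge> s, and the other factor keeps integrability.\<close>

lemma schwartz_japanese_L2:
  fixes \<phi> :: "real^'n \<Rightarrow> complex"
  assumes \<phi>: "\<phi> \<in> schwartz"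
  shows "japanese s \<phi> \<in> L2 lborel"
proof -
  obtain k where k: "s \<le> real k" using real_arch_simple by blast
  have [measurable]: "\<phi> \<in> borel_measurable borel" by (rule schwartz_borel[OF \<phi>])
  obtain C where C: "0 \<le> C" "\<And>x. (1 + norm x) ^ (2 * k) * cmod (\<phi> x) \<le> C"
    using schwartz_bound[OF \<phi>] by metis
  have "integrable lborel (\<lambda>\<xi>. (1 + (norm \<xi>)\<^sup>2) powr s * (cmod (\<phi> \<xi>))\<^sup>2)"
  proof (rule Bochner_Integration.integrable_bound)
    show "integrable lborel (\<lambda>\<xi>. C * cmod (\<phi> \<xi>))"
      using schwartz_integrable[OF \<phi>] by simp
    show "AE \<xi> in lborel. norm ((1 + (norm \<xi>)\<^sup>2) powr s * (cmod (\<phi> \<xi>))\<^sup>2) \<le> norm (C * cmod (\<phi> \<xi>))"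
    proof (rule AE_I2)
      fix \<xi> :: "real^'n"
      have "(1 + (norm \<xi>)\<^sup>2) powr s \<le> (1 + (norm \<xi>)\<^sup>2) powr real k"
        using k by (intro powr_mono) auto
      also have "\<dots> = (1 + (norm \<xi>)\<^sup>2) ^ k" by (rule powr_realpow[OF japanese_pos])
      also have "\<dots> \<le> ((1 + norm \<xi>)\<^sup>2) ^ k"
        by (intro power_mono) (auto simp: power2_sum)
      also have "\<dots> = (1 + norm \<xi>) ^ (2 * k)" by (simp add: power_mult)
      finally have "(1 + (norm \<xi>)\<^sup>2) powr s * cmod (\<phi> \<xi>) \<le> C"
        by (rule order_trans[OF mult_right_mono C(2)]) simp
      then have "(1 + (norm \<xi>)\<^sup>2) powr s * cmod (\<phi> \<xi>) * cmod (\<phi> \<xi>) \<le> C * cmod (\<phi> \<xi>)"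
        by (rule mult_right_mono) simp
      then show "norm ((1 + (norm \<xi>)\<^sup>2) powr s * (cmod (\<phi> \<xi>))\<^sup>2) \<le> norm (C * cmod (\<phi> \<xi>))"
        using C(1) by (simp add: power2_eq_square mult.assoc)
    qed
  qed measurable
  then show ?thesis by (simp add: japanese_L2_iff)
qed

lemma schwartz_Hs: "\<phi> \<in> schwartz \<Longrightarrow> 0 \<le> s \<Longrightarrow> of_function \<phi> \<in> Hs s"
  by (rule L2_fourier_Hs[OF L2_fourier_schwartz]) (auto intro: schwartz_japanese_L2 fourier_schwartz)

lemma L2_sq_le_japanese:
  assumes g: "g \<in> borel_measurable borel" and L: "japanese s g \<in> L2 lborel" and s: "0 \<le> s"
  shows "L2_sq lborel g \<le> L2_sq lborel (japanese s g)"
proof -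
  have gL: "g \<in> L2 lborel"
    using japanese_L2_mono[OF g L s] by (simp add: japanese_zero_exponent)
  have "(cmod (g \<xi>))\<^sup>2 \<le> (cmod (japanese s g \<xi>))\<^sup>2" for \<xi>
    using powr_mono[of 0 s "1 + (norm \<xi>)\<^sup>2"] s japanese_pos[of \<xi>]
    by (simp add: cmod_japanese mult_le_cancel_right1)
  then show ?thesis unfolding L2_sq_def by (intro integral_mono L2_integrable gL L)
qed

subsection \<open>Restriction to an open set\<close>

lemma restr_linear: "restr \<Omega> (\<lambda>\<phi>. a * u \<phi> + b * v \<phi>) = (\<lambda>\<phi>. a * restr \<Omega> u \<phi> + b * restr \<Omega> v \<phi>)"
  by (simp add: restr_def fun_eq_iff)

lemma restr_diff: "restr \<Omega> (\<lambda>\<phi>. u \<phi> - v \<phi>) = (\<lambda>\<phi>. restr \<Omega> u \<phi> - restr \<Omega> v \<phi>)"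
  by (simp add: restr_def fun_eq_iff)

lemma restr_HsD: "U \<in> Hs s \<Longrightarrow> restr \<Omega> U \<in> HsD s \<Omega>"
proof -
  assume U: "U \<in> Hs s"
  have "antilinear_on (test_funs \<Omega>) (restr \<Omega> U)"
    unfolding antilinear_on_def
    using antilinear_onD[OF Hs_antilinear[OF U]] by (auto simp: restr_def test_funs_linear test_funs_schwartz)
  moreover have "(\<lambda>j. restr \<Omega> U (\<phi>s j)) \<longlonglongrightarrow> restr \<Omega> U \<phi>" if "test_conv \<Omega> \<phi>s \<phi>" for \<phi>s \<phi>
  proof -
    have "\<phi>s j \<in> test_funs \<Omega>" "\<phi> \<in> test_funs \<Omega>" for j using that by (auto simp: test_conv_def)
    moreover have "(\<lambda>j. U (\<phi>s j)) \<longlonglongrightarrow> U \<phi>"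
      using Hs_tempered[OF U] test_conv_schwartz_conv[OF that] by (simp add: tempered_def)
    ultimately show ?thesis by (simp add: restr_def)
  qed
  ultimately show ?thesis using U by (auto simp: HsD_def distributions_def restr_def)
qed

text \<open>One direction is the partition of unity result; for the other, \<Omega> is itself one of
  the open sets in the definition of \<open>dist_supp\<close>.\<close>

lemma Hs_supp_Compl_iff:
  assumes "open \<Omega>" "u \<in> Hs s"
  shows "u \<in> Hs_supp s (- \<Omega>) \<longleftrightarrow> restr \<Omega> u = (\<lambda>\<phi>. 0)"
proof
  assume "u \<in> Hs_supp s (- \<Omega>)"
  then have "\<Omega> \<subseteq> - dist_supp u" by (auto simp: Hs_supp_def)
  then have "test_funs \<Omega> \<subseteq> test_funs (- dist_supp u)" by (rule test_funs_mono)
  then show "restr \<Omega> u = (\<lambda>\<phi>. 0)"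
    using vanishes_off_dist_supp[OF Hs_antilinear[OF assms(2)]] by (auto simp: restr_def fun_eq_iff)
next
  assume "restr \<Omega> u = (\<lambda>\<phi>. 0)"
  then have "\<forall>\<phi>\<in>test_funs \<Omega>. u \<phi> = 0" by (metis restr_def)
  then have "\<Omega> \<subseteq> - dist_supp u" using assms(1) by (auto simp: dist_supp_def)
  then show "u \<in> Hs_supp s (- \<Omega>)" using assms(2) by (auto simp: Hs_supp_def)
qed

lemma Hs_supp_diff_Compl:
  assumes "open \<Omega>" "u \<in> Hs s" "v \<in> Hs s" "restr \<Omega> u = restr \<Omega> v"
  shows "(\<lambda>\<phi>. u \<phi> - v \<phi>) \<in> Hs_supp s (- \<Omega>)"
  using assms by (simp add: Hs_supp_Compl_iff Hs_diff restr_diff)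

lemma dist_supp_diff: "dist_supp (\<lambda>\<phi>. u \<phi> - v \<phi>) \<subseteq> dist_supp u \<union> dist_supp v"
proof
  fix x assume x: "x \<in> dist_supp (\<lambda>\<phi>. u \<phi> - v \<phi>)"
  show "x \<in> dist_supp u \<union> dist_supp v"
  proof (rule ccontr)
    assume "x \<notin> dist_supp u \<union> dist_supp v"
    then obtain U V where UV: "open U" "x \<in> U" "\<forall>\<phi>\<in>test_funs U. u \<phi> = 0"
      "open V" "x \<in> V" "\<forall>\<phi>\<in>test_funs V. v \<phi> = 0"
      by (auto simp: dist_supp_def)
    have "test_funs (U \<inter> V) \<subseteq> test_funs U" "test_funs (U \<inter> V) \<subseteq> test_funs V"
      by (auto intro!: test_funs_mono)
    then have "\<forall>\<phi>\<in>test_funs (U \<inter> V). u \<phi> - v \<phi> = 0"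
      using UV(3,6) by (metis (no_types) diff_0_right subsetD)
    moreover have "open (U \<inter> V)" "x \<in> U \<inter> V" using UV by auto
    ultimately show False using x by (auto simp: dist_supp_def)
  qed
qed

lemma dist_supp_zero: "dist_supp (\<lambda>\<phi>. 0) = {}"
  by (auto simp: dist_supp_def)

section \<open>Norm and inner product of \<open>HsD\<close>, evaluated at orthogonal
  extensions\<close>

lemma HsD_norm_bdd: "bdd_below {Hs_norm s U | U. U \<in> Hs s \<and> restr \<Omega> U = u}"
  by (rule bdd_belowI[of _ 0]) (auto simp: Hs_norm_nonneg)

lemma HsD_norm_restr_le: "U \<in> Hs s \<Longrightarrow> HsD_norm s \<Omega> (restr \<Omega> U) \<le> Hs_norm s U"
  unfolding HsD_norm_def by (rule cInf_lower[OF _ HsD_norm_bdd]) auto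

lemma HsD_norm_less_extension:
  assumes "U \<in> Hs s" "HsD_norm s \<Omega> (restr \<Omega> U) < e"
  obtains W where "W \<in> Hs s" "restr \<Omega> W = restr \<Omega> U" "Hs_norm s W < e"
proof -
  have "{Hs_norm s W | W. W \<in> Hs s \<and> restr \<Omega> W = restr \<Omega> U} \<noteq> {}" using assms(1) by auto
  from cInf_lessD[OF this assms(2)[unfolded HsD_norm_def]] that show ?thesis by auto
qed

text \<open>For any other extension \<open>U\<close> the difference from \<open>u\<close> vanishes
  on \<Omega> and is orthogonal to \<open>u\<close>, whence <U, u> = |u|^2, and Cauchy-Schwarz gives
  |u| \<le> |U|.\<close>

lemma HsD_norm_orth:
  assumes \<Omega>: "open \<Omega>" and u: "u \<in> Hs_orth s (Hs_supp s (- \<Omega>))"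
  shows "HsD_norm s \<Omega> (restr \<Omega> u) = Hs_norm s u"
proof (rule antisym)
  have uH: "u \<in> Hs s" using u by (simp add: Hs_orth_def)
  then show "HsD_norm s \<Omega> (restr \<Omega> u) \<le> Hs_norm s u" by (rule HsD_norm_restr_le)
  show "Hs_norm s u \<le> HsD_norm s \<Omega> (restr \<Omega> u)"
    unfolding HsD_norm_def
  proof (rule cInf_greatest)
    show "{Hs_norm s U | U. U \<in> Hs s \<and> restr \<Omega> U = restr \<Omega> u} \<noteq> {}" using uH by auto
    fix r assume "r \<in> {Hs_norm s U | U. U \<in> Hs s \<and> restr \<Omega> U = restr \<Omega> u}"
    then obtain U where U: "U \<in> Hs s" "restr \<Omega> U = restr \<Omega> u" "r = Hs_norm s U" by auto
    have "(\<lambda>\<phi>. u \<phi> - U \<phi>) \<in> Hs_supp s (- \<Omega>)"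
      by (rule Hs_supp_diff_Compl[OF \<Omega> uH U(1)]) (simp add: U)
    then have "Hs_inner s u (\<lambda>\<phi>. u \<phi> - U \<phi>) = 0" using u by (simp add: Hs_orth_def)
    then have "Hs_inner s (\<lambda>\<phi>. u \<phi> - U \<phi>) u = 0" by (subst Hs_inner_commute) simp
    then have "Hs_inner s U u = complex_of_real ((Hs_norm s u)\<^sup>2)"
      by (simp add: Hs_inner_diff_left[OF uH U(1) uH] Hs_inner_self)
    moreover have "cmod (Hs_inner s U u) \<le> Hs_norm s U * Hs_norm s u"
      unfolding Hs_inner_eq Hs_norm_eq by (intro L2_Cauchy_Schwarz Hs_japanese_L2 U uH)
    ultimately have "Hs_norm s u * Hs_norm s u \<le> Hs_norm s U * Hs_norm s u"
      by (simp add: power2_eq_square norm_mult Hs_norm_nonneg)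
    then show "Hs_norm s u \<le> r"
      unfolding U(3) using Hs_norm_nonneg[of s u] Hs_norm_nonneg[of s U]
      by (cases "Hs_norm s u = 0") auto
  qed
qed

lemma Hs_orth_diff:
  assumes "u \<in> Hs_orth s M" "v \<in> Hs_orth s M" "M \<subseteq> Hs s"
  shows "(\<lambda>\<phi>. u \<phi> - v \<phi>) \<in> Hs_orth s M"
  using assms by (auto simp: Hs_orth_def Hs_diff Hs_inner_diff_left subset_iff)

text \<open>The description in \<open>Hs_proj\<close> is resolved by exhibiting \<open>u\<close>:
  the difference \<open>U - u\<close> vanishes on \<Omega>, hence is orthogonal to everything that
  is orthogonal to such elements. Two candidates differ by an element orthogonal to itself.\<close>

lemma Qproj_orth:
  assumes \<Omega>: "open \<Omega>" and u: "u \<in> Hs_orth s (Hs_supp s (- \<Omega>))"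
    and U: "U \<in> Hs s" "restr \<Omega> U = restr \<Omega> u"
  shows "Qproj s \<Omega> U = u"
  unfolding Qproj_def Hs_proj_def
proof (rule the_equality)
  let ?N = "Hs_supp s (- \<Omega>)" and ?M = "Hs_orth s (Hs_supp s (- \<Omega>))"
  have sub: "?N \<subseteq> Hs s" "?M \<subseteq> Hs s" by (auto simp: Hs_supp_def Hs_orth_def)
  have d: "(\<lambda>\<phi>. U \<phi> - u \<phi>) \<in> ?N"
    using Hs_supp_diff_Compl[OF \<Omega> U(1) _ U(2)] u sub by auto
  have Uu: "(\<lambda>\<phi>. U \<phi> - u \<phi>) \<in> Hs_orth s ?M"
    unfolding Hs_orth_def[of s ?M]
  proof (intro CollectI conjI ballI)
    show "(\<lambda>\<phi>. U \<phi> - u \<phi>) \<in> Hs s" using d sub by blast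
    fix v assume "v \<in> ?M"
    then have "Hs_inner s v (\<lambda>\<phi>. U \<phi> - u \<phi>) = 0" using d by (simp add: Hs_orth_def)
    then show "Hs_inner s (\<lambda>\<phi>. U \<phi> - u \<phi>) v = 0" by (subst Hs_inner_commute) simp
  qed
  with u show "u \<in> ?M \<and> (\<lambda>\<phi>. U \<phi> - u \<phi>) \<in> Hs_orth s ?M" by simp
  fix p assume p: "p \<in> ?M \<and> (\<lambda>\<phi>. U \<phi> - p \<phi>) \<in> Hs_orth s ?M"
  have "(\<lambda>\<phi>. (U \<phi> - u \<phi>) - (U \<phi> - p \<phi>)) \<in> Hs_orth s ?M"
    by (rule Hs_orth_diff[OF Uu]) (use p sub in auto)
  moreover have pu: "(\<lambda>\<phi>. p \<phi> - u \<phi>) \<in> ?M"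
    by (rule Hs_orth_diff) (use p u sub in auto)
  ultimately have "Hs_inner s (\<lambda>\<phi>. p \<phi> - u \<phi>) (\<lambda>\<phi>. p \<phi> - u \<phi>) = 0"
    by (simp add: Hs_orth_def)
  moreover have "(\<lambda>\<phi>. p \<phi> - u \<phi>) \<in> Hs s" using pu sub by blast
  ultimately have "(\<lambda>\<phi>. p \<phi> - u \<phi>) = (\<lambda>\<phi>. 0)"
    by (simp add: Hs_inner_self Hs_norm_eq_0_iff)
  then show "p = u" by (simp add: fun_eq_iff)
qed

lemma HsD_inner_orth:
  assumes \<Omega>: "open \<Omega>" and u: "u \<in> Hs_orth s (Hs_supp s (- \<Omega>))" and v: "v \<in> Hs_orth s (Hs_supp s (- \<Omega>))"
  shows "HsD_inner s \<Omega> (restr \<Omega> u) (restr \<Omega> v) = Hs_inner s u v"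
proof -
  have "Qproj s \<Omega> (some_ext s \<Omega> (restr \<Omega> w)) = w" if w: "w \<in> Hs_orth s (Hs_supp s (- \<Omega>))" for w
  proof -
    have "w \<in> Hs s \<and> restr \<Omega> w = restr \<Omega> w" using w by (simp add: Hs_orth_def)
    then have "some_ext s \<Omega> (restr \<Omega> w) \<in> Hs s \<and> restr \<Omega> (some_ext s \<Omega> (restr \<Omega> w)) = restr \<Omega> w"
      unfolding some_ext_def by (rule someI[where P = "\<lambda>U. U \<in> Hs s \<and> restr \<Omega> U = restr \<Omega> w"])
    then show ?thesis using Qproj_orth[OF \<Omega> w] by blast
  qed
  with u v show ?thesis by (simp add: HsD_inner_def)
qed

text \<open>Both unitarity claims thus reduce to orthogonality of the domain to the elements
  vanishing on \<Omega> and to finding the image.\<close>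

lemma unitary_iso_restr:
  assumes "open \<Omega>" "V \<subseteq> Hs_orth s (Hs_supp s (- \<Omega>))" "restr \<Omega> ` V = W"
  shows "unitary_iso V (Hs_norm s) (Hs_inner s) W (HsD_norm s \<Omega>) (HsD_inner s \<Omega>) (restr \<Omega>)"
  using assms unfolding unitary_iso_def
  by (auto simp: restr_linear subset_iff HsD_norm_orth HsD_inner_orth)

subsection \<open>The spaces of functions vanishing outside the open set\<close>

lemma Hs_ring_zero_set:
  assumes u: "u \<in> Hs_ring s \<Omega>" and s: "0 \<le> s"
  obtains f where "L2_fourier f (fourier_fun u)" "u = of_function f" "AE x in lborel. x \<in> - \<Omega> \<longrightarrow> f x = 0"
proof -
  obtain g where g: "represented_by u g" "AE x in lborel. x \<in> - \<Omega> \<longrightarrow> g x = 0" and uH: "u \<in> Hs s"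
    using u by (auto simp: Hs_ring_def)
  obtain f where f: "L2_fourier f (fourier_fun u)" "u = of_function f"
    using Hs_L2_fourier[OF uH s] .
  have "AE x in lborel. g x = f x"
    using represented_by_unique[OF g(1)] L2_represents[OF L2_fourierD(1)[OF f(1)]] f(2) by simp
  with g(2) have "AE x in lborel. x \<in> - \<Omega> \<longrightarrow> f x = 0" by eventually_elim auto
  with f that show ?thesis by blast
qed

lemma restr_of_function_eq_AE:
  fixes f g :: "real^'n \<Rightarrow> complex"
  assumes "open \<Omega>" "represented_by u f" "represented_by v g" "restr \<Omega> u = restr \<Omega> v"
  shows "AE x in lborel. x \<in> \<Omega> \<longrightarrow> f x = g x"
proof -
  have "AE x in lborel. x \<in> \<Omega> \<longrightarrow> f x - g x = 0"
  proof (rule fundamental_lemma[OF assms(1)])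
    fix \<phi> :: "real^'n \<Rightarrow> complex" assume \<phi>: "\<phi> \<in> test_funs \<Omega>"
    then have S: "\<phi> \<in> schwartz" by (rule test_funs_schwartz)
    have int: "integrable lborel (\<lambda>x. f x * cnj (\<phi> x))" "integrable lborel (\<lambda>x. g x * cnj (\<phi> x))"
      using assms(2,3) S by (auto simp: represented_by_def)
    have "u \<phi> = v \<phi>" using fun_cong[OF assms(4), of \<phi>] \<phi> by (simp add: restr_def)
    then have "(LINT x|lborel. f x * cnj (\<phi> x)) = (LINT x|lborel. g x * cnj (\<phi> x))"
      using assms(2,3) S by (simp add: represented_by_def of_function_def)
    with int show "integrable lborel (\<lambda>x. (f x - g x) * cnj (\<phi> x))" "(LINT x|lborel. (f x - g x) * cnj (\<phi> x)) = 0"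
      by (auto simp: left_diff_distrib)
  qed
  then show ?thesis by simp
qed

text \<open>The restriction determines the representing function almost everywhere on \<Omega>, and
  the remaining values are 0 almost everywhere.\<close>

lemma Hs_ring_inj:
  assumes \<Omega>: "open \<Omega>"
  shows "inj_on (restr \<Omega>) (Hs_ring s \<Omega>)"
proof (rule inj_onI)
  fix u v assume u: "u \<in> Hs_ring s \<Omega>" and v: "v \<in> Hs_ring s \<Omega>" and eq: "restr \<Omega> u = restr \<Omega> v"
  obtain f where f: "represented_by u f" "AE x in lborel. x \<in> - \<Omega> \<longrightarrow> f x = 0"
    using u by (auto simp: Hs_ring_def)
  obtain g where g: "represented_by v g" "AE x in lborel. x \<in> - \<Omega> \<longrightarrow> g x = 0"
    using v by (auto simp: Hs_ring_def)
  have "AE x in lborel. f x = g x"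
    using restr_of_function_eq_AE[OF \<Omega> f(1) g(1) eq] f(2) g(2) by eventually_elim auto
  moreover have [measurable]: "f \<in> borel_measurable borel" "g \<in> borel_measurable borel"
    using f(1) g(1) by (auto simp: represented_by_def)
  ultimately have "(LINT x|lborel. f x * cnj (\<phi> x)) = (LINT x|lborel. g x * cnj (\<phi> x))" if "\<phi> \<in> schwartz" for \<phi>
    using schwartz_borel[OF that] by (intro integral_cong_AE) (measurable, measurable, auto elim: eventually_mono)
  then have "of_function f = of_function g" by (auto simp: of_function_def)
  then show "u = v" using f(1) g(1) by (simp add: represented_by_def)
qed

text \<open>The complementary zero sets are \<open>- \<Omega>\<close> for \<open>u\<close> and
  \<Omega> for \<open>v\<close>; the boundary counts with the former, whatever its measure.\<close>

lemma Hs_ring_orth: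
  fixes \<Omega> :: "(real^'n) set"
  assumes \<Omega>: "open \<Omega>" and s: "s \<in> \<nat>"
  shows "Hs_ring s \<Omega> \<subseteq> Hs_orth s (Hs_supp s (- \<Omega>))"
proof
  fix u assume u: "u \<in> Hs_ring s \<Omega>"
  obtain m where m: "s = real m" using s by (auto simp: Nats_def)
  then have s0: "0 \<le> s" by simp
  have uH: "u \<in> Hs s" using u by (simp add: Hs_ring_def)
  obtain f where f: "L2_fourier f (fourier_fun u)" "AE x in lborel. x \<in> - \<Omega> \<longrightarrow> f x = 0"
    using Hs_ring_zero_set[OF u s0] by metis
  have "Hs_inner s u v = 0" if v: "v \<in> Hs_supp s (- \<Omega>)" for v
  proof -
    have vH: "v \<in> Hs s" using v by (simp add: Hs_supp_def)
    obtain g where g: "L2_fourier g (fourier_fun v)" "v = of_function g"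
      using Hs_L2_fourier[OF vH s0] .
    \<comment> \<open>Comparison with the zero function turns the vanishing of the distribution on
      \<Omega> into vanishing almost everywhere of the function \<open>g\<close>.\<close>
    have "restr \<Omega> v = restr \<Omega> (of_function (\<lambda>x. 0))"
      using Hs_supp_Compl_iff[OF \<Omega> vH] v by (simp add: restr_def of_function_def fun_eq_iff)
    then have "AE x in lborel. x \<in> \<Omega> \<longrightarrow> g x = 0"
      using restr_of_function_eq_AE[OF \<Omega> L2_represents[OF L2_fourierD(1)[OF g(1)]] L2_represents[OF L2_zero]] g(2)
      by simp
    moreover have "- \<Omega> \<in> sets borel" using \<Omega> by auto
    ultimately show ?thesis
      unfolding Hs_inner_eq m
      using orthogonal_of_complementary_zero_sets[OF f(1) g(1), of m "- \<Omega>"] f(2)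
        Hs_japanese_L2[OF uH] Hs_japanese_L2[OF vH] by (simp add: m)
  qed
  then show "u \<in> Hs_orth s (Hs_supp s (- \<Omega>))" using uH by (simp add: Hs_orth_def)
qed

lemma Hs_tilde_iff:
  "u \<in> Hs_tilde s \<Omega> \<longleftrightarrow> u \<in> Hs s \<and> (\<forall>e>0. \<exists>\<phi>\<in>test_funs \<Omega>. Hs_norm s (\<lambda>\<psi>. u \<psi> - of_function \<phi> \<psi>) < e)"
  by (simp add: Hs_tilde_def norm_closure_def)

lemma test_funs_Hs_tilde:
  assumes "\<phi> \<in> test_funs \<Omega>" "0 \<le> s"
  shows "of_function \<phi> \<in> Hs_tilde s \<Omega>"
  unfolding Hs_tilde_iff
proof (intro conjI allI impI)
  show "of_function \<phi> \<in> Hs s" by (rule schwartz_Hs[OF test_funs_schwartz[OF assms(1)] assms(2)])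
  show "\<exists>\<phi>'\<in>test_funs \<Omega>. Hs_norm s (\<lambda>\<psi>. of_function \<phi> \<psi> - of_function \<phi>' \<psi>) < e" if "0 < e" for e
    using assms(1) that by (intro bexI[of _ \<phi>]) (simp_all add: Hs_norm_eq_0_iff[OF Hs_zero, THEN iffD2, OF refl])
qed

text \<open>Test functions of \<Omega> vanish on its complement, so the part of \<open>f\<close>
  living there is dominated by f - \<phi> for every such \<phi>, whose L^2 norm is at most the H^s
  distance from \<open>u\<close> to \<phi>.\<close>

lemma Hs_tilde_subset_Hs_ring:
  fixes \<Omega> :: "(real^'n) set"
  assumes \<Omega>: "open \<Omega>" and s: "0 \<le> s"
  shows "Hs_tilde s \<Omega> \<subseteq> Hs_ring s \<Omega>"
proof
  fix u assume u: "u \<in> Hs_tilde s \<Omega>"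
  then have uH: "u \<in> Hs s" by (simp add: Hs_tilde_iff)
  obtain f where f: "L2_fourier f (fourier_fun u)" "u = of_function f" using Hs_L2_fourier[OF uH s] .
  have fL: "f \<in> L2 lborel" by (rule L2_fourierD(1)[OF f(1)])
  have [measurable]: "f \<in> borel_measurable borel" "- \<Omega> \<in> sets borel"
    using L2_measurable[OF fL] \<Omega> by auto
  define h where "h x = complex_of_real (indicator (- \<Omega>) x) * f x" for x
  have hL: "h \<in> L2 lborel"
  proof (rule L2_bound[OF _ fL, of _ 1])
    show "h \<in> borel_measurable lborel" unfolding h_def by measurable
  qed (auto simp: h_def norm_mult indicator_def)
  have h_le: "L2_sq lborel h \<le> e\<^sup>2" if "e > 0" for e
  proof -
    obtain \<phi> where \<phi>: "\<phi> \<in> test_funs \<Omega>" "Hs_norm s (\<lambda>\<psi>. u \<psi> - of_function \<phi> \<psi>) < e"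
      using u \<open>e > 0\<close> by (auto simp: Hs_tilde_iff)
    let ?d = "\<lambda>\<psi>. u \<psi> - of_function \<phi> \<psi>"
    have S: "\<phi> \<in> schwartz" by (rule test_funs_schwartz[OF \<phi>(1)])
    note \<phi>H = schwartz_Hs[OF S s]
    have dH: "?d \<in> Hs s" by (rule Hs_diff[OF uH \<phi>H])
    have F: "L2_fourier (\<lambda>x. f x - \<phi> x) (\<lambda>\<xi>. fourier_fun u \<xi> - fourier \<phi> \<xi>)"
      using L2_fourier_linear[OF f(1) L2_fourier_schwartz[OF S], of 1 "-1"] by simp
    have "AE \<xi> in lborel. fourier_fun ?d \<xi> = fourier_fun u \<xi> - fourier_fun (of_function \<phi>) \<xi>"
      using fourier_fun_linear[OF uH \<phi>H, of 1 "-1"] by simp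
    with L2_fourier_fourier_fun[OF L2_fourier_schwartz[OF S] s schwartz_japanese_L2[OF fourier_schwartz[OF S]]]
    have "AE \<xi> in lborel. fourier_fun u \<xi> - fourier \<phi> \<xi> = fourier_fun ?d \<xi>"
      by eventually_elim simp
    then have eq: "L2_sq lborel (\<lambda>\<xi>. fourier_fun u \<xi> - fourier \<phi> \<xi>) = L2_sq lborel (fourier_fun ?d)"
      using L2_measurable[OF L2_fourierD(2)[OF F]] fourier_fun_measurable[OF dH] by (intro L2_sq_cong_AE) auto
    have "cmod (h x) \<le> cmod (f x - \<phi> x)" for x
    proof (cases "x \<in> \<Omega>")
      case False
      then have "\<phi> x = 0" using \<phi>(1) not_in_fun_supp[of x \<phi>] by (auto simp: test_funs_def)
      with False show ?thesis by (simp add: h_def)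
    qed (simp add: h_def)
    then have "L2_sq lborel h \<le> L2_sq lborel (\<lambda>x. f x - \<phi> x)"
      unfolding L2_sq_def by (intro integral_mono L2_integrable hL L2_fourierD(1)[OF F] power_mono) auto
    also have "\<dots> = L2_sq lborel (fourier_fun ?d)"
      using L2_fourier_isometry[OF F] eq by simp
    also have "\<dots> \<le> L2_sq lborel (japanese s (fourier_fun ?d))"
      by (rule L2_sq_le_japanese[OF fourier_fun_measurable[OF dH] Hs_japanese_L2[OF dH] s])
    also have "\<dots> = (Hs_norm s ?d)\<^sup>2" by (simp add: Hs_norm_sq)
    also have "\<dots> \<le> e\<^sup>2" using \<phi>(2) Hs_norm_nonneg by (intro power_mono) auto
    finally show ?thesis .
  qed
  have "L2_sq lborel h \<le> 0"
  proof (rule field_le_epsilon)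
    fix e :: real assume "e > 0"
    then show "L2_sq lborel h \<le> 0 + e" using h_le[of "sqrt e"] by simp
  qed
  then have "AE x in lborel. h x = 0"
    using L2_sq_eq_0_iff[OF hL] L2_sq_nonneg[of lborel h] by simp
  then have "AE x in lborel. x \<in> - \<Omega> \<longrightarrow> f x = 0"
    by eventually_elim (auto simp: h_def)
  then show "u \<in> Hs_ring s \<Omega>"
    using uH L2_represents[OF fL] f(2) by (auto simp: Hs_ring_def)
qed

lemma HsD_0_iff:
  "w \<in> HsD_0 s \<Omega> \<longleftrightarrow> w \<in> HsD s \<Omega> \<and>
    (\<forall>e>0. \<exists>\<phi>\<in>test_funs \<Omega>. HsD_norm s \<Omega> (\<lambda>\<psi>. w \<psi> - restr \<Omega> (of_function \<phi>) \<psi>) < e)"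
  by (simp add: HsD_0_def norm_closure_def)

lemma restr_Hs_tilde_subset:
  assumes s: "0 \<le> s"
  shows "restr \<Omega> ` Hs_tilde s \<Omega> \<subseteq> HsD_0 s \<Omega>"
proof clarify
  fix u assume u: "u \<in> Hs_tilde s \<Omega>"
  then have uH: "u \<in> Hs s" by (simp add: Hs_tilde_iff)
  show "restr \<Omega> u \<in> HsD_0 s \<Omega>"
    unfolding HsD_0_iff
  proof (intro conjI allI impI restr_HsD uH)
    fix e :: real assume "e > 0"
    then obtain \<phi> where \<phi>: "\<phi> \<in> test_funs \<Omega>" "Hs_norm s (\<lambda>\<psi>. u \<psi> - of_function \<phi> \<psi>) < e"
      using u by (auto simp: Hs_tilde_iff)
    have "HsD_norm s \<Omega> (restr \<Omega> (\<lambda>\<psi>. u \<psi> - of_function \<phi> \<psi>)) \<le> Hs_norm s (\<lambda>\<psi>. u \<psi> - of_function \<phi> \<psi>)"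
      by (intro HsD_norm_restr_le Hs_diff uH schwartz_Hs[OF test_funs_schwartz[OF \<phi>(1)] s])
    with \<phi> show "\<exists>\<phi>\<in>test_funs \<Omega>. HsD_norm s \<Omega> (\<lambda>\<psi>. restr \<Omega> u \<psi> - restr \<Omega> (of_function \<phi>) \<psi>) < e"
      unfolding restr_diff by force
  qed
qed

section \<open>Completeness of H^s and surjectivity onto \<open>HsD_0\<close>\<close>

lemma Hs_complete:
  assumes u: "\<And>j. u j \<in> Hs s" and s: "0 \<le> s"
    and Cauchy: "\<And>e. e > 0 \<Longrightarrow> \<exists>N. \<forall>i\<ge>N. \<forall>j\<ge>N. (Hs_norm s (\<lambda>\<phi>. u i \<phi> - u j \<phi>))\<^sup>2 < e"
  obtains v where "v \<in> Hs s" "(\<lambda>j. (Hs_norm s (\<lambda>\<phi>. u j \<phi> - v \<phi>))\<^sup>2) \<longlonglongrightarrow> 0"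
proof -
  define G where "G j = japanese s (fourier_fun (u j))" for j
  have GL: "G j \<in> L2 lborel" for j unfolding G_def by (rule Hs_japanese_L2[OF u])
  obtain g where g: "g \<in> L2 lborel" "(\<lambda>j. L2_sq lborel (\<lambda>\<xi>. G j \<xi> - g \<xi>)) \<longlonglongrightarrow> 0"
    by (rule L2_complete[OF GL]) (use Cauchy in \<open>auto simp: Hs_norm_diff_sq u G_def\<close>)
  \<comment> \<open>The limit \<open>g\<close> lives on the weighted Fourier side; undoing the
    weight by \<open>japanese (- s)\<close> gives the transform of the limit, which is in L^2
    because \<open>0 \<le> s\<close>.\<close>
  have inv: "japanese s (japanese (- s) g) = g"
  proof
    fix \<xi> :: "real^'a"
    have "(1 + (norm \<xi>)\<^sup>2) powr (s / 2) * (1 + (norm \<xi>)\<^sup>2) powr (- s / 2) = 1"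
      using japanese_pos[of \<xi>] by (simp flip: powr_add)
    then have "complex_of_real ((1 + (norm \<xi>)\<^sup>2) powr (s / 2)) * complex_of_real ((1 + (norm \<xi>)\<^sup>2) powr (- s / 2)) = 1"
      unfolding of_real_mult[symmetric] by (simp only: of_real_1)
    then show "japanese s (japanese (- s) g) \<xi> = g \<xi>" by (simp add: japanese_def mult.assoc[symmetric])
  qed
  have "g \<in> borel_measurable borel" using L2_measurable[OF g(1)] by simp
  then have "japanese (- s) g \<in> L2 lborel"
    using japanese_L2_mono[where r = 0 and s = s and g = "japanese (- s) g"] g(1) s
    by (simp add: japanese_zero_exponent inv)
  then obtain f where f: "L2_fourier f (japanese (- s) g)" using L2_fourier_exists_inverse by blast
  have gs: "japanese s (japanese (- s) g) \<in> L2 lborel" using g(1) by (simp add: inv)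
  have vH: "of_function f \<in> Hs s" by (rule L2_fourier_Hs[OF f s gs])
  have "AE \<xi> in lborel. japanese s (fourier_fun (of_function f)) \<xi> = g \<xi>"
    using japanese_AE_cong[OF L2_fourier_fourier_fun[OF f s gs], of s] by (simp add: inv)
  then have "(Hs_norm s (\<lambda>\<phi>. u j \<phi> - of_function f \<phi>))\<^sup>2 = L2_sq lborel (\<lambda>\<xi>. G j \<xi> - g \<xi>)" for j
    unfolding Hs_norm_diff_sq[OF u vH] G_def[symmetric]
    by (intro L2_sq_cong_AE[OF L2_measurable[OF L2_diff[OF GL Hs_japanese_L2[OF vH]]] L2_measurable[OF L2_diff[OF GL g(1)]]])
      (auto elim: eventually_mono)
  with g(2) have "(\<lambda>j. (Hs_norm s (\<lambda>\<phi>. u j \<phi> - of_function f \<phi>))\<^sup>2) \<longlonglongrightarrow> 0" by (simp only:)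
  with vH show ?thesis by (rule that)
qed

text \<open>Evaluation at a fixed Schwartz function is continuous for the H^s norm, so limits taken
  in H^s can be identified as distributions.\<close>

lemma Hs_pairing_le:
  assumes u: "u \<in> Hs s" and s: "0 \<le> s" and \<phi>: "\<phi> \<in> schwartz"
  shows "cmod (u \<phi>) \<le> Hs_norm s u * sqrt (L2_sq lborel \<phi>)"
proof -
  obtain f where f: "L2_fourier f (fourier_fun u)" "u = of_function f" using Hs_L2_fourier[OF u s] .
  have "cmod (u \<phi>) \<le> sqrt (L2_sq lborel f) * sqrt (L2_sq lborel \<phi>)"
    using L2_Cauchy_Schwarz[OF L2_fourierD(1)[OF f(1)] schwartz_L2[OF \<phi>]] \<phi>
    by (simp add: f(2) of_function_def)
  also have "L2_sq lborel f \<le> L2_sq lborel (japanese s (fourier_fun u))"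
    unfolding L2_fourier_isometry[OF f(1)]
    by (rule L2_sq_le_japanese[OF fourier_fun_measurable[OF u] Hs_japanese_L2[OF u] s])
  then have "sqrt (L2_sq lborel f) * sqrt (L2_sq lborel \<phi>) \<le> Hs_norm s u * sqrt (L2_sq lborel \<phi>)"
    unfolding Hs_norm_eq by (intro mult_right_mono) auto
  finally show ?thesis .
qed

lemma Hs_norm_diff_sq_le:
  assumes "u \<in> Hs s" "v \<in> Hs s"
  shows "(Hs_norm s (\<lambda>\<phi>. u \<phi> - v \<phi>))\<^sup>2 \<le> 2 * (Hs_norm s u)\<^sup>2 + 2 * (Hs_norm s v)\<^sup>2"
  using L2_sq_diff_le[OF Hs_japanese_L2[OF assms(1)] Hs_japanese_L2[OF assms(2)]]
  by (subst Hs_norm_diff_sq[OF assms]) (simp only: Hs_norm_sq)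

text \<open>Test functions \<open>\<phi>\<^sub>j\<close> whose restrictions converge to \<open>restr \<Omega> U\<close> are Cauchy in \<open>H\<^sup>s\<close>, as the restriction is
  isometric on them; their limit restricts to the given distribution.\<close>

lemma restr_Hs_tilde_surj:
  fixes \<Omega> :: "(real^'n) set"
  assumes \<Omega>: "open \<Omega>" and s: "s \<in> \<nat>"
  shows "HsD_0 s \<Omega> \<subseteq> restr \<Omega> ` Hs_tilde s \<Omega>"
proof
  fix w assume w: "w \<in> HsD_0 s \<Omega>"
  have s0: "0 \<le> s" using s by (auto simp: Nats_def)
  let ?M = "Hs_orth s (Hs_supp s (- \<Omega>))"
  obtain U where U: "U \<in> Hs s" "w = restr \<Omega> U"
    using w by (auto simp: HsD_0_iff HsD_def)
  define r where "r j = inverse (real (Suc j))" for j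
  have r_pos: "0 < r j" for j by (simp add: r_def)
  have r_lim: "r \<longlonglongrightarrow> 0" unfolding r_def by (rule LIMSEQ_inverse_real_of_nat)
  \<comment> \<open>\<phi> approximates \<open>w\<close> in the norm of \<open>HsD\<close>, and
    \<open>W\<close> extends the error with a norm that comes close enough to the infimum to stay
    below \<open>r j\<close>.\<close>
  have "\<exists>\<phi> W. \<phi> \<in> test_funs \<Omega> \<and> W \<in> Hs s \<and> restr \<Omega> W = restr \<Omega> (\<lambda>\<psi>. U \<psi> - of_function \<phi> \<psi>) \<and> Hs_norm s W < r j" for j
  proof -
    obtain \<phi> where \<phi>: "\<phi> \<in> test_funs \<Omega>" "HsD_norm s \<Omega> (\<lambda>\<psi>. w \<psi> - restr \<Omega> (of_function \<phi>) \<psi>) < r j"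
      using w r_pos[of j] by (auto simp: HsD_0_iff)
    have "(\<lambda>\<psi>. U \<psi> - of_function \<phi> \<psi>) \<in> Hs s"
      by (intro Hs_diff U schwartz_Hs test_funs_schwartz[OF \<phi>(1)] s0)
    moreover have "HsD_norm s \<Omega> (restr \<Omega> (\<lambda>\<psi>. U \<psi> - of_function \<phi> \<psi>)) < r j"
      using \<phi>(2) by (simp add: restr_diff U(2))
    ultimately obtain W where "W \<in> Hs s" "restr \<Omega> W = restr \<Omega> (\<lambda>\<psi>. U \<psi> - of_function \<phi> \<psi>)" "Hs_norm s W < r j"
      by (rule HsD_norm_less_extension)
    with \<phi>(1) show ?thesis by blast
  qed
  then obtain \<phi> W where \<phi>: "\<And>j. \<phi> j \<in> test_funs \<Omega>" and W: "\<And>j. W j \<in> Hs s" "\<And>j. Hs_norm s (W j) < r j"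
    and rW: "\<And>j. restr \<Omega> (W j) = restr \<Omega> (\<lambda>\<psi>. U \<psi> - of_function (\<phi> j) \<psi>)" by metis
  define u where "u j = of_function (\<phi> j)" for j
  have uT: "u j \<in> Hs_tilde s \<Omega>" for j unfolding u_def by (rule test_funs_Hs_tilde[OF \<phi> s0])
  then have uM: "u j \<in> ?M" for j
    using Hs_tilde_subset_Hs_ring[OF \<Omega> s0] Hs_ring_orth[OF \<Omega> s] by blast
  then have uH: "u j \<in> Hs s" for j by (simp add: Hs_orth_def)
  have W_sq: "(Hs_norm s (W j))\<^sup>2 \<le> (r j)\<^sup>2" for j
    using W(2)[of j] Hs_norm_nonneg by (intro power_mono) auto
  have u_diff: "(Hs_norm s (\<lambda>\<psi>. u i \<psi> - u j \<psi>))\<^sup>2 \<le> 2 * (r i)\<^sup>2 + 2 * (r j)\<^sup>2" for i j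
  proof -
    have "(\<lambda>\<psi>. u i \<psi> - u j \<psi>) \<in> ?M" by (rule Hs_orth_diff[OF uM uM]) (auto simp: Hs_supp_def)
    then have "Hs_norm s (\<lambda>\<psi>. u i \<psi> - u j \<psi>) = HsD_norm s \<Omega> (restr \<Omega> (\<lambda>\<psi>. u i \<psi> - u j \<psi>))"
      using HsD_norm_orth[OF \<Omega>] by simp
    \<comment> \<open>\<open>u i - u j\<close> is the error \<open>U - u j\<close> minus the error
      \<open>U - u i\<close>, so on \<Omega> it is also extended by \<open>W j - W i\<close>, which
      is small.\<close>
    also have "restr \<Omega> (\<lambda>\<psi>. u i \<psi> - u j \<psi>) = restr \<Omega> (\<lambda>\<psi>. W j \<psi> - W i \<psi>)"
      by (simp add: restr_diff rW u_def)
    also have "HsD_norm s \<Omega> \<dots> \<le> Hs_norm s (\<lambda>\<psi>. W j \<psi> - W i \<psi>)"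
      by (intro HsD_norm_restr_le Hs_diff W)
    finally have "(Hs_norm s (\<lambda>\<psi>. u i \<psi> - u j \<psi>))\<^sup>2 \<le> (Hs_norm s (\<lambda>\<psi>. W j \<psi> - W i \<psi>))\<^sup>2"
      using Hs_norm_nonneg by (intro power_mono) auto
    then show ?thesis
      using Hs_norm_diff_sq_le[OF W(1)[of j] W(1)[of i]] W_sq[of i] W_sq[of j] by linarith
  qed
  have r2_lim: "(\<lambda>j. (r j)\<^sup>2) \<longlonglongrightarrow> 0" using tendsto_power[OF r_lim, of 2] by simp
  obtain v where v: "v \<in> Hs s" "(\<lambda>j. (Hs_norm s (\<lambda>\<psi>. u j \<psi> - v \<psi>))\<^sup>2) \<longlonglongrightarrow> 0"
  proof (rule Hs_complete[OF uH s0])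
    fix e :: real assume "e > 0"
    then have "\<forall>\<^sub>F j in sequentially. (r j)\<^sup>2 < e / 4" by (intro order_tendstoD(2)[OF r2_lim]) simp
    then obtain N where N: "\<And>j. j \<ge> N \<Longrightarrow> (r j)\<^sup>2 < e / 4" by (auto simp: eventually_sequentially)
    have "(Hs_norm s (\<lambda>\<psi>. u i \<psi> - u j \<psi>))\<^sup>2 < e" if "i \<ge> N" "j \<ge> N" for i j
      using u_diff[of i j] N[OF that(1)] N[OF that(2)] by linarith
    then show "\<exists>N. \<forall>i\<ge>N. \<forall>j\<ge>N. (Hs_norm s (\<lambda>\<psi>. u i \<psi> - u j \<psi>))\<^sup>2 < e" by blast
  qed
  have vT: "v \<in> Hs_tilde s \<Omega>"
    unfolding Hs_tilde_iff
  proof (intro conjI allI impI v(1))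
    fix e :: real assume "e > 0"
    then have "\<forall>\<^sub>F j in sequentially. (Hs_norm s (\<lambda>\<psi>. u j \<psi> - v \<psi>))\<^sup>2 < e\<^sup>2"
      by (intro order_tendstoD(2)[OF v(2)]) simp
    then obtain j where "(Hs_norm s (\<lambda>\<psi>. u j \<psi> - v \<psi>))\<^sup>2 < e\<^sup>2" by (auto simp: eventually_sequentially)
    then have "Hs_norm s (\<lambda>\<psi>. v \<psi> - u j \<psi>) < e"
      unfolding Hs_norm_minus_commute[OF uH v(1)] by (rule power2_less_imp_less) (use \<open>e > 0\<close> in simp)
    with \<phi> show "\<exists>\<phi>\<in>test_funs \<Omega>. Hs_norm s (\<lambda>\<psi>. v \<psi> - of_function \<phi> \<psi>) < e"
      unfolding u_def by blast
  qed
  have "restr \<Omega> v = w"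
  proof
    fix \<psi>
    show "restr \<Omega> v \<psi> = w \<psi>"
    proof (cases "\<psi> \<in> test_funs \<Omega>")
      case True
      then have S: "\<psi> \<in> schwartz" by (rule test_funs_schwartz)
      \<comment> \<open>On test functions of \<Omega> every \<open>X j\<close> takes the value of
        \<open>U - v\<close>, while its H^s norm tends to 0; hence \<open>U\<close> and
        \<open>v\<close> agree on \<Omega>.\<close>
      define X where "X j = (\<lambda>\<psi>. W j \<psi> - (v \<psi> - u j \<psi>))" for j
      have XH: "X j \<in> Hs s" for j unfolding X_def by (intro Hs_diff W v uH)
      have X_eq: "X j \<psi> = U \<psi> - v \<psi>" for j
        using fun_cong[OF rW[of j], of \<psi>] True by (simp add: restr_def X_def u_def)
      have "(\<lambda>j. (Hs_norm s (X j))\<^sup>2) \<longlonglongrightarrow> 0"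
      proof (rule Lim_null_comparison)
        show "\<forall>\<^sub>F j in sequentially. norm ((Hs_norm s (X j))\<^sup>2) \<le> 2 * (r j)\<^sup>2 + 2 * (Hs_norm s (\<lambda>\<psi>. u j \<psi> - v \<psi>))\<^sup>2"
        proof (rule always_eventually, rule)
          fix j
          show "norm ((Hs_norm s (X j))\<^sup>2) \<le> 2 * (r j)\<^sup>2 + 2 * (Hs_norm s (\<lambda>\<psi>. u j \<psi> - v \<psi>))\<^sup>2"
            using Hs_norm_diff_sq_le[OF W(1)[of j] Hs_diff[OF v(1) uH[of j]]] W_sq[of j]
            by (simp add: X_def Hs_norm_minus_commute[OF uH v(1)])
        qed
        show "(\<lambda>j. 2 * (r j)\<^sup>2 + 2 * (Hs_norm s (\<lambda>\<psi>. u j \<psi> - v \<psi>))\<^sup>2) \<longlonglongrightarrow> 0"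
          using tendsto_add[OF tendsto_mult_left[OF r2_lim, of 2] tendsto_mult_left[OF v(2), of 2]] by simp
      qed
      from tendsto_real_sqrt[OF this] have "(\<lambda>j. Hs_norm s (X j)) \<longlonglongrightarrow> 0"
        by (simp add: Hs_norm_nonneg)
      from tendsto_mult[OF this tendsto_const[of "sqrt (L2_sq lborel \<psi>)"]]
      have "(\<lambda>j. Hs_norm s (X j) * sqrt (L2_sq lborel \<psi>)) \<longlonglongrightarrow> 0" by simp
      moreover have "cmod (U \<psi> - v \<psi>) \<le> Hs_norm s (X j) * sqrt (L2_sq lborel \<psi>)" for j
        using Hs_pairing_le[OF XH s0 S] by (simp add: X_eq)
      ultimately have "cmod (U \<psi> - v \<psi>) \<le> 0"
        by (intro LIMSEQ_le_const) auto
      then show ?thesis using True by (simp add: U(2) restr_def)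
    qed (simp add: U(2) restr_def)
  qed
  with vT show "w \<in> restr \<Omega> ` Hs_tilde s \<Omega>" by blast
qed

theorem lemma2p2:
  fixes \<Omega> :: "(real^'n::finite) set" and s :: real
  assumes "open \<Omega>"
  shows
    "(restr \<Omega> ` Hs_supp s (closure \<Omega>) \<subseteq> HsD s \<Omega> \<and>
        (inj_on (restr \<Omega>) (Hs_supp s (closure \<Omega>)) \<longleftrightarrow> s_null s (frontier \<Omega>))) \<and>
     (0 \<le> s \<longrightarrow>
        restr \<Omega> ` Hs_ring s \<Omega> \<subseteq> HsD s \<Omega> \<and>
        inj_on (restr \<Omega>) (Hs_ring s \<Omega>)) \<and>
     (s \<in> \<nat> \<longrightarrow>
        unitary_iso (Hs_ring s \<Omega>) (Hs_norm s) (Hs_inner s)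
          (restr \<Omega> ` Hs_ring s \<Omega>) (HsD_norm s \<Omega>) (HsD_inner s \<Omega>) (restr \<Omega>)) \<and>
     (0 \<le> s \<longrightarrow>
        restr \<Omega> ` Hs_tilde s \<Omega> \<subseteq> HsD_0 s \<Omega> \<and>
        inj_on (restr \<Omega>) (Hs_tilde s \<Omega>) \<and>
        norm_closure (HsD_0 s \<Omega>) (HsD_norm s \<Omega>) (restr \<Omega> ` Hs_tilde s \<Omega>) = HsD_0 s \<Omega>) \<and>
     (s \<in> \<nat> \<longrightarrow>
        unitary_iso (Hs_tilde s \<Omega>) (Hs_norm s) (Hs_inner s)
          (HsD_0 s \<Omega>) (HsD_norm s \<Omega>) (HsD_inner s \<Omega>) (restr \<Omega>))"
proof (intro conjI impI)
  note \<Omega> = assms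
  have frontier: "frontier \<Omega> = closure \<Omega> - \<Omega>" using \<Omega> by (simp add: frontier_def interior_open)
  show "restr \<Omega> ` Hs_supp s (closure \<Omega>) \<subseteq> HsD s \<Omega>"
    using restr_HsD by (auto simp: Hs_supp_def)
  show "inj_on (restr \<Omega>) (Hs_supp s (closure \<Omega>)) \<longleftrightarrow> s_null s (frontier \<Omega>)"
  proof
    assume inj: "inj_on (restr \<Omega>) (Hs_supp s (closure \<Omega>))"
    show "s_null s (frontier \<Omega>)"
      unfolding s_null_def
    proof (intro allI impI)
      fix F assume F: "closed F \<and> F \<subseteq> frontier \<Omega>"
      have zero: "(\<lambda>\<phi>. 0) \<in> Hs_supp s G" for G :: "(real^'n) set"
        by (simp add: Hs_supp_def Hs_zero dist_supp_zero)
      have "u = (\<lambda>\<phi>. 0)" if u: "u \<in> Hs_supp s F" for u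
      proof (rule inj_onD[OF inj])
        \<comment> \<open>As \<Omega> is open, its frontier lies both in \<open>- \<Omega>\<close>
          and in the closure: such a \<open>u\<close> belongs to the domain and restricts to
          0.\<close>
        have "u \<in> Hs s" "u \<in> Hs_supp s (- \<Omega>)" using u F frontier by (auto simp: Hs_supp_def)
        then show "restr \<Omega> u = restr \<Omega> (\<lambda>\<phi>. 0)"
          using Hs_supp_Compl_iff[OF \<Omega>] by (simp add: restr_def)
        show "u \<in> Hs_supp s (closure \<Omega>)" using u F frontier by (auto simp: Hs_supp_def)
      qed (rule zero)
      then show "Hs_supp s F = {\<lambda>\<phi>. 0}" using zero by blast
    qed
  next
    assume null: "s_null s (frontier \<Omega>)"
    show "inj_on (restr \<Omega>) (Hs_supp s (closure \<Omega>))"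
    proof (rule inj_onI)
      fix u v assume u: "u \<in> Hs_supp s (closure \<Omega>)" and v: "v \<in> Hs_supp s (closure \<Omega>)"
        and eq: "restr \<Omega> u = restr \<Omega> v"
      then have H: "u \<in> Hs s" "v \<in> Hs s" by (auto simp: Hs_supp_def)
      have "dist_supp (\<lambda>\<phi>. u \<phi> - v \<phi>) \<subseteq> closure \<Omega>"
        using dist_supp_diff[of u v] u v by (auto simp: Hs_supp_def)
      with Hs_supp_diff_Compl[OF \<Omega> H eq] have "(\<lambda>\<phi>. u \<phi> - v \<phi>) \<in> Hs_supp s (frontier \<Omega>)"
        by (auto simp: Hs_supp_def frontier)
      \<comment> \<open>The frontier is itself closed, so it may be taken as \<open>F\<close> in the
        definition of \<open>s_null\<close>.\<close>
      with null have "(\<lambda>\<phi>. u \<phi> - v \<phi>) = (\<lambda>\<phi>. 0)" unfolding s_null_def by blast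
      then show "u = v" by (simp add: fun_eq_iff)
    qed
  qed
  show "restr \<Omega> ` Hs_ring s \<Omega> \<subseteq> HsD s \<Omega>"
    using restr_HsD by (auto simp: Hs_ring_def)
  show "inj_on (restr \<Omega>) (Hs_ring s \<Omega>)"
    by (rule Hs_ring_inj[OF \<Omega>])
  show "unitary_iso (Hs_ring s \<Omega>) (Hs_norm s) (Hs_inner s)
      (restr \<Omega> ` Hs_ring s \<Omega>) (HsD_norm s \<Omega>) (HsD_inner s \<Omega>) (restr \<Omega>)" if "s \<in> \<nat>"
    by (rule unitary_iso_restr[OF \<Omega> Hs_ring_orth[OF \<Omega> that]]) simp
  show tilde: "restr \<Omega> ` Hs_tilde s \<Omega> \<subseteq> HsD_0 s \<Omega>" if "0 \<le> s"
    by (rule restr_Hs_tilde_subset[OF that])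
  show "inj_on (restr \<Omega>) (Hs_tilde s \<Omega>)" if "0 \<le> s"
    by (rule inj_on_subset[OF Hs_ring_inj[OF \<Omega>] Hs_tilde_subset_Hs_ring[OF \<Omega> that]])
  show "norm_closure (HsD_0 s \<Omega>) (HsD_norm s \<Omega>) (restr \<Omega> ` Hs_tilde s \<Omega>) = HsD_0 s \<Omega>" if "0 \<le> s"
  proof
    \<comment> \<open>The image contains the restrictions of all test functions, which already
      approximate every element of \<open>HsD_0 s \<Omega>\<close>.\<close>
    show "HsD_0 s \<Omega> \<subseteq> norm_closure (HsD_0 s \<Omega>) (HsD_norm s \<Omega>) (restr \<Omega> ` Hs_tilde s \<Omega>)"
      unfolding norm_closure_def using test_funs_Hs_tilde[OF _ that] by (fastforce simp: HsD_0_iff)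
  qed (auto simp: norm_closure_def)
  show "unitary_iso (Hs_tilde s \<Omega>) (Hs_norm s) (Hs_inner s)
      (HsD_0 s \<Omega>) (HsD_norm s \<Omega>) (HsD_inner s \<Omega>) (restr \<Omega>)" if "s \<in> \<nat>"
  proof (rule unitary_iso_restr[OF \<Omega>])
    have "0 \<le> s" using that by (auto simp: Nats_def)
    then show "Hs_tilde s \<Omega> \<subseteq> Hs_orth s (Hs_supp s (- \<Omega>))"
      using Hs_tilde_subset_Hs_ring[OF \<Omega>] Hs_ring_orth[OF \<Omega> that] by blast
    show "restr \<Omega> ` Hs_tilde s \<Omega> = HsD_0 s \<Omega>"
      using restr_Hs_tilde_subset[OF \<open>0 \<le> s\<close>] restr_Hs_tilde_surj[OF \<Omega> that] by blast
  qed
qed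

end
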